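(* Let $A$ be an $SU(2)^2\times U(1)$-invariant $G_2$-instanton with gauge group $SU(2)$, defined in a neighbourhood of $\{0\}\times S^3$ in the BGGG $G_2$-manifold $\mathbb{R}^4\times S^3$ and extending smoothly over $\{0\}\times S^3$ on $P_1$; so $$A=A_1f^+T_1\otimes\eta_1^++A_2g^+(T_2\otimes\eta_2^++T_3\otimes\eta_3^+),\qquad f^+=f_1^+t+O(t^3),\quad g^+=g_1^+t+O(t^3)$$ with $(f_1^+,g_1^+)\in\mathbb{R}^2$. If $f_1^+\le\frac12$, or if $g_1^+\ge0$ and $g_1^+\ge f_1^+$, then $A$ extends globally to $\mathbb{R}^4\times S^3$ with bounded curvature if and only if $A$ has gauge group $U(1)$ and is of the form $$A=\frac{(r-9/4)(r+9/4)}{(r-3/4)(r+3/4)}\,x_1\,T_1\otimes\eta_1^+\quad\text{for some }x_1\in\mathbb{R}.$$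
   Context: Conventions: $SU(2)$ is identified with the unit quaternions; $\{T_i\}_{i=1}^3$ is a basis of $\mathfrak{su}(2)$ with $[T_i,T_j]=2\epsilon_{ijk}T_k$; $T_i^{\pm}=(T_i,\pm T_i)$; $\{\eta_i^{\pm}\}$ are the left-invariant 1-forms on $SU(2)^2$ dual to $\{T_i^{\pm}\}$. Manifold: $\mathbb{R}^4\times S^3\subset\mathbb{H}\times\mathbb{H}$ with $SU(2)^2$ acting by $(a_1,a_2)\cdot(p,q)=(a_1p,a_1q\bar a_2)$; the complement of $\{0\}\times S^3\cong SU(2)^2/\Delta SU(2)$ is identified with $\mathbb{R}^+_t\times SU(2)^2$ via $(t,a_1,a_2)\mapsto(ta_1,a_1\bar a_2)$. The extra $U(1)$ acts on $SU(2)^2$ by right multiplication by the diagonal one-parameter subgroup generated by $T_1^+$. BGGG structure: define $r\in[9/4,\infty)$ by $t(r)=\int_{9/4}^r\frac{\sqrt{(s-3/4)(s+3/4)}}{\sqrt{(s-9/4)(s+9/4)}}ds$ and $$A_1=\frac{\sqrt{(r-9/4)(r+9/4)}}{\sqrt{(r-3/4)(r+3/4)}},\quad A_2=A_3=\sqrt{\tfrac{(r-9/4)(r+3/4)}{3}},\quad B_1=\tfrac{2r}{3},\quad B_2=B_3=\sqrt{\tfrac{(r-3/4)(r+9/4)}{3}}.$$ With $\omega=4\sum_iA_iB_i\eta_i^-\wedge\eta_i^+$, $\Omega_1=8B_1B_2B_3\eta_{123}^--4\sum\epsilon_{ijk}A_iA_jB_k\eta_i^+\wedge\eta_j^+\wedge\eta_k^-$,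 $\Omega_2=-8A_1A_2A_3\eta_{123}^++4\sum\epsilon_{ijk}B_iB_jA_k\eta_i^-\wedge\eta_j^-\wedge\eta_k^+$, the $G_2$-structure is $\varphi=dt\wedge\omega+\Omega_1$, $\psi=*\varphi=\frac12\omega^2-dt\wedge\Omega_2$, with metric $g=dt^2+\sum_i(2A_i)^2(\eta_i^+)^2+(2B_i)^2(\eta_i^-)^2$. A $G_2$-instanton is a connection with $F_A\wedge\psi=0$. $P_1=SU(2)^2\times_{(\Delta SU(2),1)}SU(2)$ (trivial isotropy homomorphism), pulled back from $S^3$ to $\mathbb{R}^4\times S^3$. Every $SU(2)^2\times U(1)$-invariant $G_2$-instanton with gauge group $SU(2)$ near $\{0\}\times S^3$ extending smoothly on $P_1$ is, up to invariant gauge transformation, of the displayed form, where $f^+,g^+$ solve $$\dot f^++\tfrac12\Big(\tfrac{A_1}{B_2^2}-\tfrac{A_1}{A_2^2}\Big)f^+=-(g^+)^2,\qquad \dot g^++\tfrac12\Big(\tfrac{A_2^2+B_1^2+B_2^2}{A_2B_1B_2}-\tfrac{A_1^2+2A_2^2}{A_1A_2^2}\Big)g^+=-f^+g^+,$$ and is uniquely determined by $(f_1^+,g_1^+)\in\mathbb{R}^2$. Bounded curvature means $|F_A|_g$ is a bounded function. *)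

theory Defs
  imports "HOL-Analysis.Analysis" "HOL-Library.Landau_Symbols"
begin

text \<open>
  Quaternions are pairs (real part, imaginary part). With \<open>T\<^sub>i = axis i 1\<close> the
  basis of \<open>su(2) = Im H = real ^ 3\<close>, the commutator bracket is twice the cross product,
  i.e. \<open>[T\<^sub>i, T\<^sub>j] = 2 \<epsilon>\<^sub>i\<^sub>j\<^sub>k T\<^sub>k\<close>.
\<close>

type_synonym quat = "real \<times> (real ^ 3)"

definition qmult :: "quat \<Rightarrow> quat \<Rightarrow> quat" (infixl \<open>\<odot>\<close> 70)
  where "a \<odot> b = (fst a * fst b - snd a \<bullet> snd b,
                 fst a *\<^sub>R snd b + fst b *\<^sub>R snd a + cross3 (snd a) (snd b))"

definition qcnj :: "quat \<Rightarrow> quat"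
  where "qcnj a = (fst a, - snd a)"

definition SU2 :: "quat set"
  where "SU2 = sphere 0 1"

definition su2_bracket :: "real ^ 3 \<Rightarrow> real ^ 3 \<Rightarrow> real ^ 3"
  where "su2_bracket u v = 2 *\<^sub>R cross3 u v"

definition Ad :: "quat \<Rightarrow> real ^ 3 \<Rightarrow> real ^ 3"
  where "Ad a u = snd (a \<odot> (0, u) \<odot> qcnj a)"

definition Tgen :: "3 \<Rightarrow> real ^ 3"
  where "Tgen i = axis i 1"

definition levi_civita :: "3 \<Rightarrow> 3 \<Rightarrow> 3 \<Rightarrow> real"
  where "levi_civita i j k = cross3 (axis i 1) (axis j 1) $ k"


section \<open>Smooth maps and differential forms\<close>

text \<open>\<open>C\<^sup>k\<close> on open subsets of a finite-dimensional space, by iterated directional derivatives.\<close>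

primrec Ck_on :: "nat \<Rightarrow> ('a::euclidean_space \<Rightarrow> 'b::euclidean_space) \<Rightarrow> 'a set \<Rightarrow> bool"
  where
    "Ck_on 0 f S \<longleftrightarrow> continuous_on S f"
  | "Ck_on (Suc k) f S \<longleftrightarrow> (\<forall>x\<in>S. f differentiable (at x)) \<and>
       (\<forall>v. Ck_on k (\<lambda>x. frechet_derivative f (at x) v) S)"

definition smooth_on :: "('a::euclidean_space \<Rightarrow> 'b::euclidean_space) \<Rightarrow> 'a set \<Rightarrow> bool"
  where "smooth_on f S \<longleftrightarrow> (\<forall>k. Ck_on k f S)"

definition pullback ::
    "('a::real_normed_vector \<Rightarrow> 'b::real_normed_vector) \<Rightarrow> ('b \<Rightarrow> 'b \<Rightarrow> 'c) \<Rightarrow> 'a \<Rightarrow> 'a \<Rightarrow> 'c"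
  where "pullback h \<alpha> x v = \<alpha> (h x) (frechet_derivative h (at x) v)"

text \<open>
  An alternating form at a point is a function on lists of vectors (of length its degree).
  \<open>wedge k \<alpha> \<beta>\<close>, for \<open>\<alpha>\<close> of degree \<open>k\<close>, is the sum over shuffles, so that
  \<open>(\<alpha> \<and> \<beta>)(v, w) = \<alpha>(v) \<beta>(w) - \<alpha>(w) \<beta>(v)\<close> for 1-forms; the set \<open>S\<close> holds the positions of
  the arguments given to \<open>\<alpha>\<close> and the exponent counts the inversions of the shuffle.
\<close>

definition wedge ::
    "nat \<Rightarrow> ('v list \<Rightarrow> 'b::real_vector) \<Rightarrow> ('v list \<Rightarrow> real) \<Rightarrow> 'v list \<Rightarrow> 'b"
  where "wedge k \<alpha> \<beta> vs =
    (\<Sum>S | S \<subseteq> {..<length vs} \<and> card S = k.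
       ((-1) ^ card {(i, j). i \<in> S \<and> j \<notin> S \<and> j < i} * \<beta> (nths vs (- S))) *\<^sub>R \<alpha> (nths vs S))"

definition one_form :: "('v \<Rightarrow> 'b) \<Rightarrow> 'v list \<Rightarrow> 'b"
  where "one_form \<alpha> vs = \<alpha> (vs ! 0)"


section \<open>The manifold and its symmetries\<close>

type_synonym point = "quat \<times> quat"

definition M :: "point set"
  where "M = {x. snd x \<in> SU2}"

definition tube :: "real \<Rightarrow> point set"
  where "tube \<epsilon> = {x \<in> M. norm (fst x) < \<epsilon>}"

definition tangent :: "point \<Rightarrow> point set"
  where "tangent x = {v. snd v \<bullet> snd x = 0}"

definition act :: "quat \<Rightarrow> quat \<Rightarrow> point \<Rightarrow> point"
  where "act a1 a2 x = (a1 \<odot> fst x, a1 \<odot> snd x \<odot> qcnj a2)"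

text \<open>
  On the complement of the singular orbit, \<open>(p, q) = (t a\<^sub>1, a\<^sub>1 cnj a\<^sub>2)\<close> is inverted by
  \<open>t = |p|\<close>, \<open>a\<^sub>1 = p / |p|\<close>, \<open>a\<^sub>2 = cnj q a\<^sub>1\<close>. Right multiplication of
  \<open>(a\<^sub>1, a\<^sub>2)\<close> by \<open>(u, u)\<close> becomes \<open>(p, q) \<mapsto> (p u, q)\<close>.
\<close>

definition radius :: "point \<Rightarrow> real"
  where "radius x = norm (fst x)"

definition coord1 :: "point \<Rightarrow> quat"
  where "coord1 x = fst x /\<^sub>R radius x"

definition coord2 :: "point \<Rightarrow> quat"
  where "coord2 x = qcnj (snd x) \<odot> coord1 x"

definition u1 :: "real \<Rightarrow> quat"
  where "u1 \<theta> = (cos \<theta>, sin \<theta> *\<^sub>R Tgen 1)"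

definition act_u1 :: "real \<Rightarrow> point \<Rightarrow> point"
  where "act_u1 \<theta> x = (fst x \<odot> u1 \<theta>, snd x)"

text \<open>
  \<open>maurer_cartan\<close> is the left-invariant form \<open>a\<inverse> da\<close> on \<open>SU(2)\<close>. An element
  \<open>(X\<^sub>1, X\<^sub>2)\<close> of the Lie algebra of \<open>SU(2)\<^sup>2\<close> has coordinates \<open>(X\<^sub>1 \<plusminus> X\<^sub>2) / 2\<close> with respect to
  the basis \<open>(T\<^sub>i, \<plusminus> T\<^sub>i)\<close>, whence the dual coframe.
\<close>

definition maurer_cartan :: "quat \<Rightarrow> quat \<Rightarrow> real ^ 3"
  where "maurer_cartan a v = snd (qcnj a \<odot> v)"

definition dt :: "point \<Rightarrow> point \<Rightarrow> real"
  where "dt x = frechet_derivative radius (at x)"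

definition eta_plus :: "3 \<Rightarrow> point \<Rightarrow> point \<Rightarrow> real"
  where "eta_plus i x v =
    (pullback coord1 maurer_cartan x v $ i + pullback coord2 maurer_cartan x v $ i) / 2"

definition eta_minus :: "3 \<Rightarrow> point \<Rightarrow> point \<Rightarrow> real"
  where "eta_minus i x v =
    (pullback coord1 maurer_cartan x v $ i - pullback coord2 maurer_cartan x v $ i) / 2"


section \<open>The BGGG structure\<close>

text \<open>The integrand below is unbounded at \<open>9/4\<close>, but absolutely integrable.\<close>

definition bggg_t :: "real \<Rightarrow> real"
  where "bggg_t r = integral {9/4..r}
    (\<lambda>s. sqrt ((s - 3/4) * (s + 3/4)) / sqrt ((s - 9/4) * (s + 9/4)))"

definition bggg_r :: "real \<Rightarrow> real"
  where "bggg_r = inv_into {9/4..} bggg_t"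

definition coefA :: "3 \<Rightarrow> real \<Rightarrow> real"
  where "coefA i t = (let r = bggg_r t in
    if i = 1 then sqrt ((r - 9/4) * (r + 9/4)) / sqrt ((r - 3/4) * (r + 3/4))
    else sqrt ((r - 9/4) * (r + 3/4) / 3))"

definition coefB :: "3 \<Rightarrow> real \<Rightarrow> real"
  where "coefB i t = (let r = bggg_r t in
    if i = 1 then 2 * r / 3 else sqrt ((r - 3/4) * (r + 9/4) / 3))"

definition triple :: "('v \<Rightarrow> real) \<Rightarrow> ('v \<Rightarrow> real) \<Rightarrow> ('v \<Rightarrow> real) \<Rightarrow> 'v list \<Rightarrow> real"
  where "triple \<alpha> \<beta> \<gamma> = wedge 1 (one_form \<alpha>) (wedge 1 (one_form \<beta>) (one_form \<gamma>))"

definition omega :: "point \<Rightarrow> point list \<Rightarrow> real"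
  where "omega x vs = 4 * (\<Sum>i\<in>UNIV. coefA i (radius x) * coefB i (radius x) *
    wedge 1 (one_form (eta_minus i x)) (one_form (eta_plus i x)) vs)"

definition Omega2 :: "point \<Rightarrow> point list \<Rightarrow> real"
  where "Omega2 x vs = (let A = (\<lambda>i. coefA i (radius x)); B = (\<lambda>i. coefB i (radius x)) in
    - 8 * A 1 * A 2 * A 3 * triple (eta_plus 1 x) (eta_plus 2 x) (eta_plus 3 x) vs
    + 4 * (\<Sum>i\<in>UNIV. \<Sum>j\<in>UNIV. \<Sum>k\<in>UNIV. levi_civita i j k * B i * B j * A k *
        triple (eta_minus i x) (eta_minus j x) (eta_plus k x) vs))"

definition psi :: "point \<Rightarrow> point list \<Rightarrow> real"
  where "psi x vs = wedge 2 (omega x) (omega x) vs / 2 - wedge 1 (one_form (dt x)) (Omega2 x) vs"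

definition metric :: "point \<Rightarrow> point \<Rightarrow> point \<Rightarrow> real"
  where "metric x v w = dt x v * dt x w +
    (\<Sum>i\<in>UNIV. (2 * coefA i (radius x))\<^sup>2 * eta_plus i x v * eta_plus i x w +
               (2 * coefB i (radius x))\<^sup>2 * eta_minus i x v * eta_minus i x w)"

definition orthonormal_frame :: "point \<Rightarrow> point list \<Rightarrow> bool"
  where "orthonormal_frame x es \<longleftrightarrow> length es = 7 \<and> set es \<subseteq> tangent x \<and>
    (\<forall>i<7. \<forall>j<7. metric x (es ! i) (es ! j) = (if i = j then 1 else 0))"


section \<open>Connections on \<open>P\<^sub>1\<close>\<close>

text \<open>
  As its isotropy homomorphism is trivial, \<open>P\<^sub>1\<close> is the product bundle \<open>S\<^sup>3 \<times> SU(2)\<close>, with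
  \<open>SU(2)\<^sup>2\<close> acting on the first factor only. Connections on its pullback are therefore
  \<open>su(2)\<close>-valued 1-forms, and \<open>SU(2)\<^sup>2\<close>-invariance is plain invariance of the form. Only the values
  of a form on tangent vectors matter.

  To differentiate, a form on (an open subset of) \<open>M\<close> is pulled back along the retraction
  \<open>(p, q) \<mapsto> (p, q / |q|)\<close> to an open subset of the ambient space. This pullback is smooth iff the
  form is, and its exterior derivative restricts to that of the form.
\<close>

type_synonym connection = "point \<Rightarrow> point \<Rightarrow> real ^ 3"

definition retract_M :: "point \<Rightarrow> point"
  where "retract_M x = (fst x, snd x /\<^sub>R norm (snd x))"

definition smooth_connection_on :: "point set \<Rightarrow> connection \<Rightarrow> bool"
  where "smooth_connection_on U A \<longleftrightarrow>
    (let V = {x. snd x \<noteq> 0 \<and> retract_M x \<in> U} in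
      (\<forall>x\<in>V. linear (pullback retract_M A x)) \<and>
      (\<forall>v. smooth_on (\<lambda>x. pullback retract_M A x v) V))"

definition connection_eq_on :: "point set \<Rightarrow> connection \<Rightarrow> connection \<Rightarrow> bool"
  where "connection_eq_on U A A' \<longleftrightarrow> (\<forall>x\<in>U. \<forall>v\<in>tangent x. A x v = A' x v)"

text \<open>
  \<open>F = dA + [A \<and> A] / 2\<close>, that is
  \<open>F(v, w) = D\<^sub>v A(w) - D\<^sub>w A(v) + [A(v), A(w)]\<close> for constant ambient vectors \<open>v\<close>, \<open>w\<close>.
\<close>

definition curvature :: "connection \<Rightarrow> point \<Rightarrow> point list \<Rightarrow> real ^ 3"
  where "curvature A x vs = (let v = vs ! 0; w = vs ! 1; A' = pullback retract_M A in
    frechet_derivative (\<lambda>y. A' y w) (at x) v - frechet_derivative (\<lambda>y. A' y v) (at x) w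
    + su2_bracket (A x v) (A x w))"

text \<open>
  The extra \<open>U(1)\<close> is lifted to the bundle by the inclusion of \<open>exp (\<theta> T\<^sub>1)\<close> in \<open>SU(2)\<close>, for which
  the canonical form \<open>\<Sum>\<^sub>i T\<^sub>i \<otimes> \<eta>\<^sub>i\<^sup>+\<close> is invariant.
\<close>

definition invariant_on :: "point set \<Rightarrow> connection \<Rightarrow> bool"
  where "invariant_on U A \<longleftrightarrow>
    (\<forall>a1\<in>SU2. \<forall>a2\<in>SU2. connection_eq_on U (pullback (act a1 a2) A) A) \<and>
    (\<forall>\<theta>. connection_eq_on U (pullback (act_u1 \<theta>) A) (\<lambda>x v. Ad (qcnj (u1 \<theta>)) (A x v)))"

text \<open>
  The coframe, hence \<open>psi\<close> and \<open>metric\<close>, is only available off the singular orbit \<open>p = 0\<close>. By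
  density and continuity the conditions below are equivalent to those on all of the domain.
\<close>

definition G2_instanton_on :: "point set \<Rightarrow> connection \<Rightarrow> bool"
  where "G2_instanton_on U A \<longleftrightarrow> smooth_connection_on U A \<and>
    (\<forall>x\<in>U. fst x \<noteq> 0 \<longrightarrow>
      (\<forall>vs. length vs = 6 \<and> set vs \<subseteq> tangent x \<longrightarrow> wedge 2 (curvature A x) (psi x) vs = 0))"

definition bounded_curvature :: "connection \<Rightarrow> bool"
  where "bounded_curvature A \<longleftrightarrow>
    (\<exists>C. \<forall>x\<in>M. fst x \<noteq> 0 \<longrightarrow> (\<forall>es. orthonormal_frame x es \<longrightarrow>
      sqrt (\<Sum>(i, j) | i < j \<and> j < 7. (norm (curvature A x [es ! i, es ! j]))\<^sup>2) \<le> C))"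

definition extends_globally_with_bounded_curvature :: "real \<Rightarrow> connection \<Rightarrow> bool"
  where "extends_globally_with_bounded_curvature \<epsilon> A \<longleftrightarrow>
    (\<exists>A'. G2_instanton_on M A' \<and> invariant_on M A' \<and> connection_eq_on (tube \<epsilon>) A' A \<and>
      bounded_curvature A')"

definition has_gauge_group_U1_on :: "point set \<Rightarrow> connection \<Rightarrow> bool"
  where "has_gauge_group_U1_on U A \<longleftrightarrow>
    (\<exists>u. u \<noteq> 0 \<and> (\<forall>x\<in>U. \<forall>v\<in>tangent x. A x v \<in> span {u}))"

definition invariant_ansatz :: "(real \<Rightarrow> real) \<Rightarrow> (real \<Rightarrow> real) \<Rightarrow> connection"
  where "invariant_ansatz f g x v = (let t = radius x in
    (coefA 1 t * f t * eta_plus 1 x v) *\<^sub>R Tgen 1 +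
    (coefA 2 t * g t) *\<^sub>R (eta_plus 2 x v *\<^sub>R Tgen 2 + eta_plus 3 x v *\<^sub>R Tgen 3))"

definition abelian_instanton :: "real \<Rightarrow> connection"
  where "abelian_instanton x1 x v = (let r = bggg_r (radius x) in
    ((r - 9/4) * (r + 9/4) / ((r - 3/4) * (r + 3/4)) * x1 * eta_plus 1 x v) *\<^sub>R Tgen 1)"

end

theory Submission
  imports Defs
begin

text \<open>
  By invariance a connection off the singular orbit is given by its values on an invariant frame
  along the ray \<open>(t, 1)\<close>, \<open>t > 0\<close>, and the instanton equation becomes a system of ordinary differential
  equations in \<open>t\<close>. A global extension of \<open>A\<close> need not be in the gauge of the ansatz, so only
  gauge-invariant quantities are followed: the \<open>T\<^sub>1\<close>-coefficient \<open>b\<close> of \<open>\<eta>\<^sub>1\<^sup>+\<close>, the squared norm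
  \<open>P\<close> of the coefficient of \<open>\<eta>\<^sub>2\<^sup>+\<close>, and the squared norm of the \<open>\<eta>\<^sup>-\<close>-part, which vanishes near
  the singular orbit and hence everywhere by Gronwall's inequality. What remains is a closed system
  for \<open>b\<close> and \<open>P\<close>. With \<open>F = b / A\<^sub>1\<^sup>2\<close> and \<open>p = P / A\<^sub>2\<^sup>2\<close>, so that \<open>f = A\<^sub>1 F\<close> and \<open>p = g\<^sup>2\<close>
  for the ansatz, \<open>F\<close> is nonincreasing and \<open>p\<close> is either zero or nowhere zero. If \<open>p\<close> is nonzero
  and \<open>F < 1\<close> somewhere, then \<open>p\<close> eventually increases and \<open>- F\<close> satisfies a Riccati inequality, so
  the solution blows up in finite time. If \<open>f\<^sub>1 \<le> 1/2\<close> then \<open>F < lim\<^bsub>t \<rightarrow> 0\<^esub> F = 2 f\<^sub>1 \<le> 1\<close>; if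
  \<open>g\<^sub>1 \<ge> f\<^sub>1 > 1/2\<close> and \<open>F \<ge> 1\<close> throughout, then \<open>f \<le> g\<close> persists and forces \<open>F\<close> to decrease
  linearly, a contradiction. Hence \<open>p = 0\<close> and \<open>F\<close> is constant, which is the abelian solution.

  Conversely an abelian \<open>A\<close> is continued by the explicit formula. Smoothness across the singular
  orbit is inherited from \<open>A\<close>, so only the complement of the orbit needs an argument.
\<close>

text \<open>The threshold 1 for F comes from infinity: p' = 2 (\<open>growth_rate\<close> - A1 F) p,
  where \<open>growth_rate\<close> and A1 both tend to 1. So p eventually grows exponentially once F
  has dropped below 1, and F' = - p / A1 then drives F to minus infinity. The bound 1/2 on f1 is the
  same threshold seen from the singular orbit, where A1 behaves like t / 2. The instanton equation
  is handled in two ways. To extract the differential equations it is evaluated on a few chosen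
  six-tuples of a frame dual to the coframe. To verify it for the abelian connection every six-tuple
  counts, so there the products of 1-forms are sorted into a normal form instead of being evaluated.
  In the second case, f1 <= g1, the delicate point is that f <= g is known only as a limit at t = 0,
  with equality allowed. It is propagated by a Gronwall estimate for ln (f / g) started arbitrarily
  close to 0.\<close>

section \<open>Wedge products\<close>

definition inversions :: "nat set \<Rightarrow> (nat \<times> nat) set"
  where "inversions S = {(i, j). i \<in> S \<and> j \<notin> S \<and> j < i}"

lemma finite_inversions: "finite S \<Longrightarrow> finite (inversions S)"
  by (rule finite_subset[of _ "Sigma S (\<lambda>i. {..<i})"]) (auto simp: inversions_def)

lemma card_inversions_insert_0: "card (inversions (insert 0 (Suc ` S))) = card (inversions S)"
proof -
  have "inversions (insert 0 (Suc ` S)) = map_prod Suc Suc ` inversions S"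
  proof (intro equalityI subsetI)
    fix p assume "p \<in> inversions (insert 0 (Suc ` S))"
    then obtain i j where p: "p = (i, j)" "i \<in> insert 0 (Suc ` S)" "j \<notin> insert 0 (Suc ` S)" "j < i"
      by (auto simp: inversions_def)
    then obtain i' where i': "i = Suc i'" "i' \<in> S" by auto
    obtain j' where j': "j = Suc j'" "j' \<notin> S" using p(3) by (cases j) auto
    show "p \<in> map_prod Suc Suc ` inversions S"
      using p i' j' by (intro image_eqI[of _ _ "(i', j')"]) (auto simp: inversions_def)
  qed (auto simp: inversions_def)
  then show ?thesis
    by (simp add: card_image prod.inj_map inj_on_subset[OF _ subset_UNIV])
qed

text \<open>Position 0 then lies outside the chosen set and below all its elements, so it adds one
  inversion per element.\<close>

lemma card_inversions_Suc:
  assumes "finite S"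
  shows "card (inversions (Suc ` S)) = card S + card (inversions S)"
proof -
  have "inversions (Suc ` S) = (\<lambda>i. (Suc i, 0)) ` S \<union> map_prod Suc Suc ` inversions S"
  proof (intro equalityI subsetI)
    fix p assume "p \<in> inversions (Suc ` S)"
    then obtain i j where p: "p = (Suc i, j)" "i \<in> S" "j \<notin> Suc ` S" "j < Suc i"
      by (auto simp: inversions_def)
    show "p \<in> (\<lambda>i. (Suc i, 0)) ` S \<union> map_prod Suc Suc ` inversions S"
    proof (cases j)
      case (Suc j')
      then have "p \<in> map_prod Suc Suc ` inversions S"
        using p by (intro image_eqI[of _ _ "(i, j')"]) (auto simp: inversions_def)
      then show ?thesis ..
    qed (use p in auto)
  qed (auto simp: inversions_def)
  moreover have "(\<lambda>i. (Suc i, 0)) ` S \<inter> map_prod Suc Suc ` inversions S = {}" by auto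
  moreover have "card ((\<lambda>i. (Suc i, 0::nat)) ` S) = card S" by (rule card_image) (auto simp: inj_on_def)
  moreover have "card (map_prod Suc Suc ` inversions S) = card (inversions S)"
    by (simp add: card_image prod.inj_map inj_on_subset[OF _ subset_UNIV])
  ultimately show ?thesis
    using assms by (simp add: card_Un_disjoint finite_inversions)
qed

lemma subsets_of_card_Suc:
  "{S. S \<subseteq> {..<Suc n} \<and> card S = Suc k} =
    (\<lambda>S. insert 0 (Suc ` S)) ` {S. S \<subseteq> {..<n} \<and> card S = k} \<union>
    (`) Suc ` {S. S \<subseteq> {..<n} \<and> card S = Suc k}" (is "?L = ?R")
proof (intro equalityI subsetI)
  fix S assume S: "S \<in> ?L"
  define S' where "S' = {i. Suc i \<in> S}"
  have sub: "S' \<subseteq> {..<n}" using S by (auto simp: S'_def)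
  then have fin: "finite S'" by (rule finite_subset) simp
  have img: "Suc ` S' = S - {0}"
  proof (intro equalityI subsetI)
    fix i assume "i \<in> S - {0}"
    then show "i \<in> Suc ` S'" by (cases i) (auto simp: S'_def)
  qed (auto simp: S'_def)
  have c: "card (Suc ` S') = card S'" by (simp add: card_image)
  show "S \<in> ?R"
  proof (cases "0 \<in> S")
    case True
    then have e: "S = insert 0 (Suc ` S')" using img by auto
    then have "card S = Suc (card S')" using fin c by simp
    then show ?thesis using e sub S by auto
  next
    case False
    then have e: "S = Suc ` S'" using img by auto
    then show ?thesis using sub S c by auto
  qed
next
  fix S assume "S \<in> ?R"
  then show "S \<in> ?L"
  proof
    assume "S \<in> (\<lambda>S. insert 0 (Suc ` S)) ` {S. S \<subseteq> {..<n} \<and> card S = k}"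
    then obtain S' where S': "S = insert 0 (Suc ` S')" "S' \<subseteq> {..<n}" "card S' = k" by auto
    then have "finite S'" by (auto intro: finite_subset)
    then show ?thesis using S' by (auto simp: card_image)
  qed (auto simp: card_image)
qed

lemma wedge_altdef:
  "wedge k \<alpha> \<beta> vs = (\<Sum>S | S \<subseteq> {..<length vs} \<and> card S = k.
    ((-1) ^ card (inversions S) * \<beta> (nths vs (- S))) *\<^sub>R \<alpha> (nths vs S))"
  by (simp add: wedge_def inversions_def)

text \<open>The first argument goes either to \<open>\<alpha>\<close> or to \<open>\<beta>\<close>;
  in the latter case it is moved past the \<open>Suc k\<close> arguments of \<open>\<alpha>\<close>,
  whence the sign. This recursion replaces the sum over subsets, so that a product can be evaluated
  on an explicit list by rewriting.\<close>

lemma wedge_Cons: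
  "wedge (Suc k) \<alpha> \<beta> (v # vs) = wedge k (\<lambda>us. \<alpha> (v # us)) \<beta> vs +
    (-1) ^ Suc k *\<^sub>R wedge (Suc k) \<alpha> (\<lambda>us. \<beta> (v # us)) vs"
proof -
  let ?n = "length vs"
  let ?s = "\<lambda>S. ((-1) ^ card (inversions S) * \<beta> (nths (v # vs) (- S))) *\<^sub>R \<alpha> (nths (v # vs) S)"
  let ?A = "{S. S \<subseteq> {..<?n} \<and> card S = k}" and ?B = "{S. S \<subseteq> {..<?n} \<and> card S = Suc k}"
  have fin: "finite ?A" "finite ?B" by auto
  have inj1: "inj_on (\<lambda>S. insert 0 (Suc ` S)) ?A"
  proof (rule inj_onI)
    fix S T assume "insert 0 (Suc ` S) = insert 0 (Suc ` T)"
    then have "insert 0 (Suc ` S) - {0} = insert 0 (Suc ` T) - {0}" by simp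
    then have "Suc ` S = Suc ` T" by auto
    then show "S = T" by (simp add: inj_image_eq_iff)
  qed
  have inj2: "inj_on ((`) Suc) ?B" by (auto simp: inj_on_def inj_image_eq_iff)
  have 1: "?s (insert 0 (Suc ` S)) = ((-1) ^ card (inversions S) * \<beta> (nths vs (- S))) *\<^sub>R \<alpha> (v # nths vs S)" for S
  proof -
    have "{j. Suc j \<in> insert 0 (Suc ` S)} = S" "{j. Suc j \<in> - insert 0 (Suc ` S)} = - S" by auto
    then show ?thesis by (simp add: nths_Cons card_inversions_insert_0)
  qed
  have 2: "?s (Suc ` S) = (-1) ^ Suc k *\<^sub>R
      (((-1) ^ card (inversions S) * \<beta> (v # nths vs (- S))) *\<^sub>R \<alpha> (nths vs S))" if "S \<in> ?B" for S
  proof -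
    have "finite S" using that by (auto intro: finite_subset)
    moreover have "{j. Suc j \<in> Suc ` S} = S" "{j. Suc j \<in> - (Suc ` S)} = - S" by auto
    ultimately show ?thesis using that by (simp add: nths_Cons card_inversions_Suc power_add)
  qed
  have "wedge (Suc k) \<alpha> \<beta> (v # vs) = sum ?s ((\<lambda>S. insert 0 (Suc ` S)) ` ?A \<union> (`) Suc ` ?B)"
    by (simp add: wedge_altdef subsets_of_card_Suc)
  also have "\<dots> = sum ?s ((\<lambda>S. insert 0 (Suc ` S)) ` ?A) + sum ?s ((`) Suc ` ?B)"
    using fin by (intro sum.union_disjoint) auto
  also have "sum ?s ((\<lambda>S. insert 0 (Suc ` S)) ` ?A) = (\<Sum>S\<in>?A. ?s (insert 0 (Suc ` S)))"
    using inj1 by (simp add: sum.reindex)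
  also have "\<dots> = wedge k (\<lambda>us. \<alpha> (v # us)) \<beta> vs"
    unfolding 1 by (simp add: wedge_altdef)
  also have "sum ?s ((`) Suc ` ?B) = (\<Sum>S\<in>?B. ?s (Suc ` S))"
    using inj2 by (simp add: sum.reindex)
  also have "\<dots> = (-1) ^ Suc k *\<^sub>R wedge (Suc k) \<alpha> (\<lambda>us. \<beta> (v # us)) vs"
    unfolding wedge_altdef scaleR_sum_right using 2 by (intro sum.cong) auto
  finally show ?thesis .
qed

lemma wedge_0: "wedge 0 \<alpha> \<beta> vs = \<beta> vs *\<^sub>R \<alpha> []"
proof -
  have "card S = 0 \<longleftrightarrow> S = {}" if "S \<subseteq> {..<length vs}" for S
    using finite_subset[OF that] by simp
  then have "{S. S \<subseteq> {..<length vs} \<and> card S = 0} = {{}}" by auto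
  moreover have "nths vs UNIV = vs" by (simp add: nths_all)
  ultimately show ?thesis by (simp add: wedge_altdef inversions_def)
qed

lemma wedge_Nil: "wedge (Suc k) \<alpha> \<beta> [] = 0"
  unfolding wedge_altdef by (rule sum.neutral) auto

lemma wedge_1_Cons:
  "wedge 1 \<alpha> \<beta> (v # vs) = \<beta> vs *\<^sub>R \<alpha> [v] - wedge 1 \<alpha> (\<lambda>us. \<beta> (v # us)) vs"
  using wedge_Cons[of 0 \<alpha> \<beta> v vs] by (simp add: wedge_0)

lemma wedge_2_Cons:
  "wedge 2 \<alpha> \<beta> (v # vs) = wedge 1 (\<lambda>us. \<alpha> (v # us)) \<beta> vs + wedge 2 \<alpha> (\<lambda>us. \<beta> (v # us)) vs"
  using wedge_Cons[of 1 \<alpha> \<beta> v vs] by (simp add: numeral_2_eq_2)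

lemma wedge_1_2_Nil: "wedge 1 \<alpha> \<beta> [] = 0" "wedge 2 \<alpha> \<beta> [] = 0"
  using wedge_Nil[of 0] wedge_Nil[of 1] by (simp_all add: numeral_2_eq_2)

text \<open>Forms are functions on lists of every length, while many identities between them hold
  only in the right degree. Agreement is therefore asked only on the lengths that occur in the
  product.\<close>

lemma wedge_cong:
  assumes "\<And>us. \<lbrakk>length us = k; set us \<subseteq> set vs\<rbrakk> \<Longrightarrow> \<alpha> us = \<alpha>' us"
    and "\<And>us. \<lbrakk>length us + k = length vs; set us \<subseteq> set vs\<rbrakk> \<Longrightarrow> \<beta> us = \<beta>' us"
  shows "wedge k \<alpha> \<beta> vs = wedge k \<alpha>' \<beta>' vs"
  unfolding wedge_altdef
proof (rule sum.cong[OF refl])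
  fix S assume "S \<in> {S. S \<subseteq> {..<length vs} \<and> card S = k}"
  then have S: "S \<subseteq> {..<length vs}" "card S = k" by auto
  then have "{i. i < length vs \<and> i \<in> S} = S" by auto
  moreover have "{i. i < length vs \<and> i \<notin> S} = {..<length vs} - S" by auto
  moreover have "card ({..<length vs} - S) + k = length vs"
    using S card_mono[OF _ S(1)] finite_subset[OF S(1)] by (simp add: card_Diff_subset)
  ultimately have "length (nths vs S) = k" "length (nths vs (- S)) + k = length vs"
    using S by (simp_all add: length_nths)
  then show "((-1) ^ card (inversions S) * \<beta> (nths vs (- S))) *\<^sub>R \<alpha> (nths vs S) =
      ((-1) ^ card (inversions S) * \<beta>' (nths vs (- S))) *\<^sub>R \<alpha>' (nths vs S)"
    using assms by (simp add: set_nths_subset)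
qed

lemma wedge_add_right: "wedge k \<alpha> (\<lambda>us. \<beta> us + \<gamma> us) vs = wedge k \<alpha> \<beta> vs + wedge k \<alpha> \<gamma> vs"
  by (simp add: wedge_altdef algebra_simps sum.distrib)

lemma wedge_scale_right: "wedge k \<alpha> (\<lambda>us. c * \<beta> us) vs = c *\<^sub>R wedge k \<alpha> \<beta> vs"
  by (simp add: wedge_altdef scaleR_sum_right mult.left_commute)

lemma wedge_diff_right: "wedge k \<alpha> (\<lambda>us. \<beta> us - \<gamma> us) vs = wedge k \<alpha> \<beta> vs - wedge k \<alpha> \<gamma> vs"
  using wedge_add_right[of k \<alpha> \<beta> "\<lambda>us. (-1) * \<gamma> us"] by (simp only: wedge_scale_right) simp

lemma wedge_minus_right: "wedge k \<alpha> (\<lambda>us. - \<beta> us) vs = - wedge k \<alpha> \<beta> vs"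
  using wedge_scale_right[of k \<alpha> "-1" \<beta> vs] by simp

lemma wedge_add_left: "wedge k (\<lambda>us. \<alpha> us + \<gamma> us) \<beta> vs = wedge k \<alpha> \<beta> vs + wedge k \<gamma> \<beta> vs"
  by (simp add: wedge_altdef algebra_simps sum.distrib)

lemma wedge_scale_left: "wedge k (\<lambda>us. c *\<^sub>R \<alpha> us) \<beta> vs = c *\<^sub>R wedge k \<alpha> \<beta> vs"
  by (simp add: wedge_altdef scaleR_sum_right mult.commute)

lemma wedge_diff_left: "wedge k (\<lambda>us. \<alpha> us - \<gamma> us) \<beta> vs = wedge k \<alpha> \<beta> vs - wedge k \<gamma> \<beta> vs"
  using wedge_add_left[of k \<alpha> "\<lambda>us. (-1) *\<^sub>R \<gamma> us"] by (simp only: wedge_scale_left) simp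

lemma wedge_scaleR_const: "wedge k (\<lambda>us. \<alpha> us *\<^sub>R c) \<beta> vs = wedge k \<alpha> \<beta> vs *\<^sub>R c"
  by (simp add: wedge_altdef scaleR_sum_left)

text \<open>Products of 1-forms nested to the right have a normal form, reached by sorting the
  factors and without appeal to associativity. \<open>wedge_2_assoc\<close> brings a product with a
  decomposable 2-form into this shape.\<close>

definition wedge1 :: "('v \<Rightarrow> real) \<Rightarrow> ('v list \<Rightarrow> real) \<Rightarrow> 'v list \<Rightarrow> real" (infixr \<open>\<cdot>\<close> 70)
  where "a \<cdot> G = wedge 1 (one_form a) G"

lemma wedge1_Nil: "(a \<cdot> G) [] = 0"
  by (simp add: wedge1_def wedge_1_2_Nil del: One_nat_def)

lemma wedge1_Cons: "(a \<cdot> G) (v # vs) = a v * G vs - (a \<cdot> (\<lambda>us. G (v # us))) vs"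
  by (simp add: wedge1_def wedge_1_Cons one_form_def del: One_nat_def)

lemma wedge1_linear:
  "a \<cdot> (\<lambda>us. G us + H us) = (\<lambda>us. (a \<cdot> G) us + (a \<cdot> H) us)"
  "a \<cdot> (\<lambda>us. G us - H us) = (\<lambda>us. (a \<cdot> G) us - (a \<cdot> H) us)"
  "a \<cdot> (\<lambda>us. c * G us) = (\<lambda>us. c * (a \<cdot> G) us)"
  "a \<cdot> (\<lambda>us. G us * c) = (\<lambda>us. (a \<cdot> G) us * c)"
  "a \<cdot> (\<lambda>us. - G us) = (\<lambda>us. - (a \<cdot> G) us)"
  "a \<cdot> (\<lambda>us. 0) = (\<lambda>us. 0)"
  using wedge_scale_right[of 1 "one_form a" c G]
  by (simp_all add: wedge1_def fun_eq_iff wedge_add_right wedge_diff_right wedge_scale_right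
      wedge_minus_right mult.commute)
    (simp add: wedge_altdef)

text \<open>Contraction with the first argument is an antiderivation, hence the induction with
  \<open>G\<close> arbitrary. Lists of every length are covered, so the identity lifts to an
  equation between functions that can rewrite inside further products.\<close>

lemma wedge1_anticommute_at: "(a \<cdot> b \<cdot> G) vs = - (b \<cdot> a \<cdot> G) vs"
  by (induction vs arbitrary: G) (simp_all add: wedge1_Nil wedge1_Cons wedge1_linear algebra_simps)

lemma wedge1_anticommute: "a \<cdot> b \<cdot> G = (\<lambda>vs. - (b \<cdot> a \<cdot> G) vs)"
  by (rule ext) (rule wedge1_anticommute_at)

lemma wedge1_self: "a \<cdot> a \<cdot> G = (\<lambda>vs. 0)"
proof
  fix vs show "(a \<cdot> a \<cdot> G) vs = 0" using wedge1_anticommute_at[of a a G vs] by simp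
qed

text \<open>Both sides satisfy the same recursion in the first argument. The formula for the
  contraction of the 2-form holds only on one-element lists, so the induction step passes through
  \<open>wedge_cong\<close>.\<close>

lemma wedge_2_assoc: "wedge 2 (wedge 1 (one_form a) (one_form b)) G vs = (a \<cdot> b \<cdot> G) vs"
proof (induction vs arbitrary: G)
  case (Cons v vs)
  have "wedge 1 (\<lambda>us. wedge 1 (one_form a) (one_form b) (v # us)) G vs
      = wedge 1 (\<lambda>us. a v *\<^sub>R one_form b us - b v *\<^sub>R one_form a us) G vs"
  proof (rule wedge_cong)
    fix us :: "'a list" assume "length us = 1"
    then obtain u where "us = [u]" by (auto simp: length_Suc_conv)
    then show "wedge 1 (one_form a) (one_form b) (v # us) = a v *\<^sub>R one_form b us - b v *\<^sub>R one_form a us"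
      by (simp add: wedge_1_Cons wedge_1_2_Nil one_form_def del: One_nat_def)
  qed simp
  also have "\<dots> = a v * (b \<cdot> G) vs - b v * (a \<cdot> G) vs"
    unfolding wedge_diff_left wedge_scale_left wedge1_def by simp
  finally show ?case
    using Cons by (simp add: wedge_2_Cons wedge1_Cons wedge1_linear)
qed (simp add: wedge_1_2_Nil wedge1_Nil)

section \<open>Quaternions and the invariant coframe\<close>

lemma quat_eq_iff:
  "a = b \<longleftrightarrow> fst a = fst b \<and> snd a $ 1 = snd b $ 1 \<and> snd a $ 2 = snd b $ 2 \<and> snd a $ 3 = snd b $ 3"
  for a b :: quat
  by (auto simp: prod_eq_iff vec_eq_iff forall_3)

lemmas quat_components = qmult_def qcnj_def inner_vec_def sum_3 cross3_def vector_3 forall_3 vec_eq_iff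

lemma qmult_assoc: "(a \<odot> b) \<odot> c = a \<odot> (b \<odot> c)"
  unfolding quat_eq_iff by (simp add: quat_components algebra_simps)

lemma qcnj_qmult: "qcnj (a \<odot> b) = qcnj b \<odot> qcnj a"
  unfolding quat_eq_iff by (simp add: quat_components algebra_simps)

lemma qcnj_qcnj [simp]: "qcnj (qcnj a) = a"
  by (simp add: qcnj_def)

lemma norm_qcnj [simp]: "norm (qcnj a) = norm a"
  by (simp add: qcnj_def norm_prod_def)

lemma norm_quat: "(norm a)\<^sup>2 = (fst a)\<^sup>2 + snd a \<bullet> snd a" for a :: quat
  by (simp add: norm_prod_def power2_norm_eq_inner)

lemma qcnj_qmult_self: "qcnj a \<odot> a = ((norm a)\<^sup>2, 0)" "a \<odot> qcnj a = ((norm a)\<^sup>2, 0)"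
  unfolding quat_eq_iff norm_quat by (simp_all add: quat_components power2_eq_square)

lemma qmult_real [simp]: "(r, 0) \<odot> a = r *\<^sub>R a" "a \<odot> (r, 0) = r *\<^sub>R a"
  unfolding quat_eq_iff by (simp_all add: quat_components)

lemma norm_qmult [simp]: "norm (a \<odot> b) = norm a * norm b"
proof -
  have "(norm (a \<odot> b))\<^sup>2 = (norm a * norm b)\<^sup>2"
    unfolding power_mult_distrib norm_quat
    by (simp add: quat_components power2_eq_square algebra_simps)
  then show ?thesis by (simp add: power2_eq_iff_nonneg)
qed

lemma qcnj_eq_0_iff [simp]: "qcnj a = 0 \<longleftrightarrow> a = 0"
  by (metis norm_eq_zero norm_qcnj)

lemma qmult_eq_0_iff [simp]: "a \<odot> b = 0 \<longleftrightarrow> a = 0 \<or> b = 0"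
  by (metis mult_eq_0_iff norm_eq_zero norm_qmult)

lemma bilinear_qmult: "bilinear (\<odot>)"
  unfolding bilinear_def linear_iff quat_eq_iff
  by (auto simp: quat_components algebra_simps)

lemma bounded_bilinear_qmult: "bounded_bilinear (\<odot>)"
  by (rule bilinear_conv_bounded_bilinear[THEN iffD1, OF bilinear_qmult])

interpretation qmult: bounded_bilinear "(\<odot>)"
  by (rule bounded_bilinear_qmult)

lemma bounded_linear_qcnj: "bounded_linear qcnj"
  unfolding qcnj_def by (intro bounded_linear_Pair bounded_linear_minus bounded_linear_fst bounded_linear_snd)

lemma qcnj_add: "qcnj (a + b) = qcnj a + qcnj b"
  and qcnj_scaleR: "qcnj (r *\<^sub>R a) = r *\<^sub>R qcnj a"
  by (simp_all add: qcnj_def)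

lemmas has_derivative_qcnj = bounded_linear.has_derivative[OF bounded_linear_qcnj]

text \<open>The pullback of the Maurer-Cartan form along the normalization \<open>a \<mapsto> a / |a|\<close>.\<close>

definition log_form :: "quat \<Rightarrow> quat \<Rightarrow> real ^ 3"
  where "log_form a v = snd (qcnj a \<odot> v) /\<^sub>R (norm a)\<^sup>2"

lemma linear_log_form: "linear (log_form a)"
  unfolding log_form_def by (rule linearI) (simp_all add: qmult.add_right qmult.scaleR_right algebra_simps)

text \<open>\<open>qcnj a \<odot> a\<close> is real, so a radial term contributes nothing to the
  imaginary part, and the scale cancels against the squared norm.\<close>

lemma log_form_rescale:
  assumes "c \<noteq> 0"
  shows "log_form (c *\<^sub>R a) (c *\<^sub>R v + d *\<^sub>R a) = log_form a v"
  using assms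
  by (cases "a = 0") (simp_all add: log_form_def qcnj_scaleR qmult.scaleR_left qmult.scaleR_right
      qmult.add_right qcnj_qmult_self power_mult_distrib power2_eq_square divide_simps)

text \<open>The derivative of the factor \<open>c\<close> contributes a multiple of
  \<open>qcnj (f x) \<odot> f x\<close>, which is real. That \<open>c\<close> normalizes
  \<open>f\<close> is asked at \<open>x\<close> alone: for \<open>coord2\<close> the factor is the
  inverse norm of p, and this is the inverse norm of cnj(q) p only on \<open>M\<close>.\<close>

lemma maurer_cartan_normalized:
  assumes "(f has_derivative f') (at x)" "(c has_derivative c') (at x)"
    and "c x = inverse (norm (f x))" "f x \<noteq> 0"
  shows "pullback (\<lambda>y. c y *\<^sub>R f y) maurer_cartan x v = log_form (f x) (f' v)"
proof -
  have "((\<lambda>y. c y *\<^sub>R f y) has_derivative (\<lambda>v. c x *\<^sub>R f' v + c' v *\<^sub>R f x)) (at x)"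
    using assms(1,2) by (intro derivative_eq_intros) auto
  then have "frechet_derivative (\<lambda>y. c y *\<^sub>R f y) (at x) = (\<lambda>v. c x *\<^sub>R f' v + c' v *\<^sub>R f x)"
    by (rule frechet_derivative_at[symmetric])
  then show ?thesis
    using assms(3,4) by (simp add: pullback_def maurer_cartan_def log_form_def qcnj_scaleR qmult.scaleR_left
        qmult.scaleR_right qmult.add_right qcnj_qmult_self power2_eq_square)
qed

definition theta1 :: "point \<Rightarrow> point \<Rightarrow> real ^ 3"
  where "theta1 x v = log_form (fst x) (fst v)"

definition theta2 :: "point \<Rightarrow> point \<Rightarrow> real ^ 3"
  where "theta2 x v = log_form (qcnj (snd x) \<odot> fst x) (qcnj (snd v) \<odot> fst x + qcnj (snd x) \<odot> fst v)"

definition dnorm :: "point \<Rightarrow> point \<Rightarrow> real"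
  where "dnorm x v = fst x \<bullet> fst v / norm (fst x)"

lemma has_derivative_radius:
  assumes "fst x \<noteq> 0"
  shows "((\<lambda>y::point. norm (fst y)) has_derivative dnorm x) (at x)"
proof -
  have "((\<lambda>y::point. norm (fst y)) has_derivative (\<lambda>v. fst v \<bullet> sgn (fst x))) (at x)"
    using assms by (intro has_derivative_compose[OF has_derivative_fst[OF has_derivative_ident] has_derivative_norm]) auto
  then show ?thesis
    by (rule has_derivative_eq_rhs) (auto simp: dnorm_def sgn_div_norm inner_commute divide_inverse mult.commute)
qed

lemma has_derivative_inverse_radius:
  "fst x \<noteq> 0 \<Longrightarrow> ((\<lambda>y::point. inverse (norm (fst y))) has_derivative
    (\<lambda>v. - (inverse (norm (fst x)) * dnorm x v * inverse (norm (fst x))))) (at x)"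
  by (intro Deriv.has_derivative_inverse has_derivative_radius) auto

lemma pullback_coord1:
  assumes "fst x \<noteq> 0"
  shows "pullback coord1 maurer_cartan x v = theta1 x v"
proof -
  from maurer_cartan_normalized[OF _ has_derivative_inverse_radius[OF assms], of fst fst v] assms
  show ?thesis by (simp add: coord1_def[abs_def] radius_def theta1_def has_derivative_fst)
qed

lemma has_derivative_qcnj_qmult:
  "((\<lambda>y::point. qcnj (snd y) \<odot> fst y) has_derivative
    (\<lambda>v. qcnj (snd v) \<odot> fst x + qcnj (snd x) \<odot> fst v)) (at x)"
proof -
  have "((\<lambda>y::point. qcnj (snd y)) has_derivative (\<lambda>v. qcnj (snd v))) (at x)"
    by (intro has_derivative_qcnj has_derivative_snd has_derivative_ident)
  from qmult.FDERIV[OF this has_derivative_fst[OF has_derivative_ident]]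
  show ?thesis by (simp add: add.commute)
qed

lemma pullback_coord2:
  assumes "x \<in> M" "fst x \<noteq> 0"
  shows "pullback coord2 maurer_cartan x v = theta2 x v"
proof -
  have n: "norm (snd x) = 1" using assms(1) by (simp add: M_def SU2_def)
  then have "qcnj (snd x) \<odot> fst x \<noteq> 0" using assms(2) by auto
  with maurer_cartan_normalized[OF has_derivative_qcnj_qmult has_derivative_inverse_radius[OF assms(2)], of v] n
  show ?thesis by (simp add: coord2_def[abs_def] coord1_def radius_def theta2_def qmult.scaleR_right)
qed

definition etap :: "point \<Rightarrow> point \<Rightarrow> real ^ 3"
  where "etap x v = (1/2) *\<^sub>R (theta1 x v + theta2 x v)"

definition etam :: "point \<Rightarrow> point \<Rightarrow> real ^ 3"
  where "etam x v = (1/2) *\<^sub>R (theta1 x v - theta2 x v)"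

lemma eta_eq:
  assumes "x \<in> M" "fst x \<noteq> 0"
  shows "eta_plus i x v = etap x v $ i" "eta_minus i x v = etam x v $ i"
  using assms by (simp_all add: eta_plus_def eta_minus_def etap_def etam_def pullback_coord1 pullback_coord2)

lemma linear_eta: "linear (etap x)" "linear (etam x)"
proof -
  have "linear (\<lambda>v. log_form a (L v))" if "linear L" for a and L :: "point \<Rightarrow> quat"
    using linear_compose[OF that linear_log_form] by (simp add: comp_def)
  moreover have "linear (\<lambda>v. qcnj (snd v) \<odot> fst x + qcnj (snd x) \<odot> fst v)"
    by (rule linearI) (simp_all add: qmult.add_right qmult.add_left qcnj_add qcnj_scaleR
        qmult.scaleR_left qmult.scaleR_right scaleR_add_right)
  ultimately have 1: "linear (theta1 x)" "linear (theta2 x)"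
    by (simp_all add: theta1_def[abs_def] theta2_def[abs_def] linear_fst)
  show "linear (etap x)" "linear (etam x)"
    unfolding etap_def[abs_def] etam_def[abs_def]
    by (rule linear_compose_scale_right[OF linear_compose_add[OF 1]]
        linear_compose_scale_right[OF linear_compose_sub[OF 1]])+
qed

lemma dt_eq: "fst x \<noteq> 0 \<Longrightarrow> dt x = dnorm x"
  unfolding dt_def radius_def[abs_def] by (rule frechet_derivative_at[symmetric]) (rule has_derivative_radius)

section \<open>The retraction onto the manifold\<close>

abbreviation "dretract y \<equiv> frechet_derivative retract_M (at y)"

text \<open>The coefficient \<open>d\<close> of the normal part stays abstract: later it is either
  removed by \<open>log_form_rescale\<close> or forced to vanish by tangency.\<close>

lemma retract_derivative:
  assumes "snd y \<noteq> 0"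
  obtains d where "\<And>v. dretract y v = (fst v, inverse (norm (snd y)) *\<^sub>R snd v + d v *\<^sub>R snd y)"
    and "\<And>v. dretract y v \<in> tangent (retract_M y)"
    and "(retract_M has_derivative dretract y) (at y)"
proof -
  have n: "((\<lambda>y::point. norm (snd y)) has_derivative (\<lambda>v. snd v \<bullet> sgn (snd y))) (at y)"
    using assms by (intro has_derivative_compose[OF has_derivative_snd[OF has_derivative_ident] has_derivative_norm]) auto
  define d where "d v = - (inverse (norm (snd y)) * (snd v \<bullet> sgn (snd y)) * inverse (norm (snd y)))" for v :: point
  have i: "((\<lambda>y::point. inverse (norm (snd y))) has_derivative d) (at y)"
    using Deriv.has_derivative_inverse[OF _ n] assms by (simp add: d_def[abs_def])
  have D: "(retract_M has_derivative (\<lambda>v. (fst v, inverse (norm (snd y)) *\<^sub>R snd v + d v *\<^sub>R snd y))) (at y)"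
    unfolding retract_M_def[abs_def]
    by (rule has_derivative_Pair[OF has_derivative_fst[OF has_derivative_ident]
          has_derivative_scaleR[OF i has_derivative_snd[OF has_derivative_ident]]])
  note F = frechet_derivative_at[OF D]
  show thesis
  proof (rule that)
    fix v
    show "dretract y v = (fst v, inverse (norm (snd y)) *\<^sub>R snd v + d v *\<^sub>R snd y)"
      by (simp add: F[symmetric])
    show "dretract y v \<in> tangent (retract_M y)"
      unfolding F[symmetric] using assms
      by (simp add: tangent_def retract_M_def d_def inner_add_left inner_diff_left sgn_div_norm dot_square_norm
          power2_eq_square field_simps)
  next
    show "(retract_M has_derivative dretract y) (at y)" using D F by simp
  qed
qed

lemma tangent_retract_M: "snd y \<noteq> 0 \<Longrightarrow> dretract y v \<in> tangent (retract_M y)"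
  by (erule retract_derivative)

lemma retract_M_in_M: "snd y \<noteq> 0 \<Longrightarrow> retract_M y \<in> M"
  by (simp add: retract_M_def M_def SU2_def)

lemma retract_M_M: "x \<in> M \<Longrightarrow> retract_M x = x"
  by (simp add: retract_M_def M_def SU2_def)

text \<open>On \<open>M\<close> the derivative of the retraction adds a multiple of
  \<open>snd x\<close> to \<open>snd v\<close>. Both \<open>v\<close> and its image are orthogonal
  to the unit vector \<open>snd x\<close>, so that multiple is zero.\<close>

lemma pullback_retract_M:
  assumes "x \<in> M" "v \<in> tangent x"
  shows "pullback retract_M A x v = A x v"
proof -
  have s: "snd x \<noteq> 0" "norm (snd x) = 1" using assms(1) by (auto simp: M_def SU2_def)
  obtain d where d: "\<And>v. frechet_derivative retract_M (at x) v = (fst v, inverse (norm (snd x)) *\<^sub>R snd v + d v *\<^sub>R snd x)"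
    "\<And>v. frechet_derivative retract_M (at x) v \<in> tangent (retract_M x)"
    using retract_derivative[OF s(1)] by metis
  have "d v * (snd x \<bullet> snd x) = 0"
    using d(2)[of v] assms unfolding retract_M_M[OF assms(1)] d(1) tangent_def
    by (simp add: s inner_add_left)
  then have "d v = 0" using s by simp
  then show ?thesis using d(1)[of v] s assms(1) by (simp add: pullback_def retract_M_M)
qed

text \<open>Replacing q by q / |q| rescales cnj(q) p and changes its derivative by a multiple of
  itself, to both of which \<open>log_form\<close> is blind. Hence the coframe may be differentiated
  through its ambient formulas, without the retraction.\<close>

lemma coframe_retract:
  assumes "snd y \<noteq> 0" "fst y \<noteq> 0"
  shows "etap (retract_M y) (dretract y v) = etap y v"
    "etam (retract_M y) (dretract y v) = etam y v"
    "dnorm (retract_M y) (dretract y v) = dnorm y v"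
proof -
  obtain d where d: "\<And>v. dretract y v = (fst v, inverse (norm (snd y)) *\<^sub>R snd v + d v *\<^sub>R snd y)"
    using retract_derivative[OF assms(1)] by metis
  let ?c = "inverse (norm (snd y))"
  have 1: "theta1 (retract_M y) (dretract y v) = theta1 y v"
    by (simp add: d theta1_def retract_M_def)
  have "theta2 (retract_M y) (dretract y v) =
      log_form (?c *\<^sub>R (qcnj (snd y) \<odot> fst y))
        (?c *\<^sub>R (qcnj (snd v) \<odot> fst y + qcnj (snd y) \<odot> fst v) + d v *\<^sub>R (qcnj (snd y) \<odot> fst y))"
    by (simp add: d theta2_def retract_M_def qcnj_add qcnj_scaleR qmult.add_left qmult.scaleR_left algebra_simps)
  also have "\<dots> = theta2 y v"
    unfolding theta2_def by (rule log_form_rescale) (use assms in simp)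
  finally show "etap (retract_M y) (dretract y v) = etap y v"
    "etam (retract_M y) (dretract y v) = etam y v"
    by (simp_all add: etap_def etam_def 1)
  show "dnorm (retract_M y) (dretract y v) = dnorm y v"
    by (simp add: d dnorm_def retract_M_def)
qed

section \<open>Structure equations and curvature\<close>

text \<open>The Maurer-Cartan equation multiplied by the fourth power of the norm of
  \<open>p\<close>, which leaves a polynomial identity in the components.\<close>

lemma log_form_identity:
  "(norm p)\<^sup>2 *\<^sub>R (snd (qcnj a \<odot> b) - snd (qcnj b \<odot> a))
    - (2 * (p \<bullet> a)) *\<^sub>R snd (qcnj p \<odot> b) + (2 * (p \<bullet> b)) *\<^sub>R snd (qcnj p \<odot> a) =
    - 2 *\<^sub>R cross3 (snd (qcnj p \<odot> a)) (snd (qcnj p \<odot> b))"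
  unfolding norm_quat inner_prod_def
  by (simp add: quat_components power2_eq_square) (intro conjI; algebra)

text \<open>\<open>a\<close> is the derivative of the base point \<open>p\<close>, and
  \<open>h\<close> that of the vector \<open>b\<close> to which the form is applied. For
  \<open>theta2\<close> the term \<open>h\<close> is nonzero because cnj(q) p is not linear; being
  symmetric in the two directions, it cancels in the exterior derivative.\<close>

definition log_form_deriv :: "quat \<Rightarrow> quat \<Rightarrow> quat \<Rightarrow> quat \<Rightarrow> real ^ 3"
  where "log_form_deriv p a b h = (snd (qcnj a \<odot> b) + snd (qcnj p \<odot> h)) /\<^sub>R (norm p)\<^sup>2
    - (2 * (p \<bullet> a) / (norm p) ^ 4) *\<^sub>R snd (qcnj p \<odot> b)"

lemma has_derivative_log_form:
  assumes "(f has_derivative f') (at x)" "(g has_derivative g') (at x)" "f x \<noteq> 0"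
  shows "((\<lambda>y. log_form (f y) (g y)) has_derivative
    (\<lambda>v. log_form_deriv (f x) (f' v) (g x) (g' v))) (at x)"
proof -
  have 1: "((\<lambda>y. snd (qcnj (f y) \<odot> g y)) has_derivative
      (\<lambda>v. snd (qcnj (f x) \<odot> g' v + qcnj (f' v) \<odot> g x))) (at x)"
    by (rule has_derivative_snd[OF qmult.FDERIV[OF has_derivative_qcnj[OF assms(1)] assms(2)]])
  have "((\<lambda>y. f y \<bullet> f y) has_derivative (\<lambda>v. f x \<bullet> f' v + f' v \<bullet> f x)) (at x)"
    by (rule has_derivative_inner[OF assms(1) assms(1)])
  then have "((\<lambda>y. (norm (f y))\<^sup>2) has_derivative (\<lambda>v. 2 * (f x \<bullet> f' v))) (at x)"
    by (simp add: power2_norm_eq_inner inner_commute)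
  then have 2: "((\<lambda>y. inverse ((norm (f y))\<^sup>2)) has_derivative
      (\<lambda>v. - (inverse ((norm (f x))\<^sup>2) * (2 * (f x \<bullet> f' v)) * inverse ((norm (f x))\<^sup>2)))) (at x)"
    using assms(3) by (intro Deriv.has_derivative_inverse) auto
  show ?thesis
    unfolding log_form_def log_form_deriv_def
    by (rule has_derivative_eq_rhs[OF has_derivative_scaleR[OF 2 1]])
      (simp add: fun_eq_iff field_simps power4_eq_xxxx power2_eq_square)
qed

lemma log_form_structure:
  assumes "p \<noteq> 0"
  shows "log_form_deriv p a b h - log_form_deriv p b a h = - 2 *\<^sub>R cross3 (log_form p a) (log_form p b)"
proof -
  let ?n = "(norm p)\<^sup>2"
  define N where "N = ?n"
  have n: "N \<noteq> 0" "norm p ^ 4 = ?n * ?n" using assms by (simp_all add: N_def power4_eq_xxxx power2_eq_square)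
  have "log_form_deriv p a b h - log_form_deriv p b a h = inverse (?n * ?n) *\<^sub>R
    (?n *\<^sub>R (snd (qcnj a \<odot> b) - snd (qcnj b \<odot> a))
    - (2 * (p \<bullet> a)) *\<^sub>R snd (qcnj p \<odot> b) + (2 * (p \<bullet> b)) *\<^sub>R snd (qcnj p \<odot> a))"
    using n(1) unfolding log_form_deriv_def n(2) N_def[symmetric] by (simp add: vec_eq_iff field_simps)
  also have "\<dots> = - 2 *\<^sub>R cross3 (log_form p a) (log_form p b)"
    unfolding log_form_identity log_form_def cross_mult_left cross_mult_right
    by (simp add: power4_eq_xxxx power2_eq_square)
  finally show ?thesis .
qed

definition dtheta1 :: "point \<Rightarrow> point \<Rightarrow> point \<Rightarrow> real ^ 3"
  where "dtheta1 x v w = log_form_deriv (fst x) (fst v) (fst w) 0"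

definition dtheta2 :: "point \<Rightarrow> point \<Rightarrow> point \<Rightarrow> real ^ 3"
  where "dtheta2 x v w = log_form_deriv (qcnj (snd x) \<odot> fst x)
    (qcnj (snd v) \<odot> fst x + qcnj (snd x) \<odot> fst v) (qcnj (snd w) \<odot> fst x + qcnj (snd x) \<odot> fst w)
    (qcnj (snd w) \<odot> fst v + qcnj (snd v) \<odot> fst w)"

lemma has_derivative_theta1:
  assumes "fst x \<noteq> 0"
  shows "((\<lambda>y. theta1 y w) has_derivative (\<lambda>v. dtheta1 x v w)) (at x)"
  unfolding theta1_def dtheta1_def
  by (rule has_derivative_log_form[OF has_derivative_fst[OF has_derivative_ident] has_derivative_const assms])

lemma has_derivative_theta2:
  assumes "fst x \<noteq> 0" "snd x \<noteq> 0"
  shows "((\<lambda>y. theta2 y w) has_derivative (\<lambda>v. dtheta2 x v w)) (at x)"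
proof -
  have "((\<lambda>y. qcnj (snd w) \<odot> fst y + qcnj (snd y) \<odot> fst w) has_derivative
      (\<lambda>v. qcnj (snd w) \<odot> fst v + qcnj (snd v) \<odot> fst w)) (at x)"
    by (intro has_derivative_add bounded_linear.has_derivative[OF qmult.bounded_linear_right]
        bounded_linear.has_derivative[OF qmult.bounded_linear_left]
        has_derivative_qcnj[OF has_derivative_snd[OF has_derivative_ident]]
        has_derivative_fst[OF has_derivative_ident])
  moreover have "qcnj (snd x) \<odot> fst x \<noteq> 0" using assms by simp
  ultimately show ?thesis
    unfolding theta2_def dtheta2_def
    by (intro has_derivative_log_form has_derivative_qcnj_qmult)
qed

lemma theta_structure:
  assumes "fst x \<noteq> 0" "snd x \<noteq> 0"
  shows "dtheta1 x v w - dtheta1 x w v = - 2 *\<^sub>R cross3 (theta1 x v) (theta1 x w)"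
    "dtheta2 x v w - dtheta2 x w v = - 2 *\<^sub>R cross3 (theta2 x v) (theta2 x w)"
proof -
  show "dtheta1 x v w - dtheta1 x w v = - 2 *\<^sub>R cross3 (theta1 x v) (theta1 x w)"
    unfolding dtheta1_def theta1_def by (rule log_form_structure[OF assms(1)])
  have n: "qcnj (snd x) \<odot> fst x \<noteq> 0" using assms by simp
  show "dtheta2 x v w - dtheta2 x w v = - 2 *\<^sub>R cross3 (theta2 x v) (theta2 x w)"
    unfolding dtheta2_def theta2_def
    by (simp only: log_form_structure[OF n] add.commute[of "qcnj (snd v) \<odot> fst w"])
qed

definition detap :: "point \<Rightarrow> point \<Rightarrow> point \<Rightarrow> real ^ 3"
  where "detap x v w = (1/2) *\<^sub>R (dtheta1 x v w + dtheta2 x v w)"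

definition detam :: "point \<Rightarrow> point \<Rightarrow> point \<Rightarrow> real ^ 3"
  where "detam x v w = (1/2) *\<^sub>R (dtheta1 x v w - dtheta2 x v w)"

lemma has_derivative_eta:
  assumes "fst x \<noteq> 0" "snd x \<noteq> 0"
  shows "((\<lambda>y. etap y w) has_derivative (\<lambda>v. detap x v w)) (at x)"
    "((\<lambda>y. etam y w) has_derivative (\<lambda>v. detam x v w)) (at x)"
  unfolding etap_def etam_def detap_def detam_def
  by (rule has_derivative_scaleR_right[OF has_derivative_add[OF has_derivative_theta1[OF assms(1)]
          has_derivative_theta2[OF assms]]]
      has_derivative_scaleR_right[OF has_derivative_diff[OF has_derivative_theta1[OF assms(1)]
          has_derivative_theta2[OF assms]]])+

lemma eta_structure:
  assumes "fst x \<noteq> 0" "snd x \<noteq> 0"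
  shows "detap x v w - detap x w v = - 2 *\<^sub>R (cross3 (etap x v) (etap x w) + cross3 (etam x v) (etam x w))"
      (is ?p)
    "detam x v w - detam x w v = - 2 *\<^sub>R (cross3 (etap x v) (etam x w) + cross3 (etam x v) (etap x w))" (is ?m)
proof -
  have "detap x v w - detap x w v =
      (1/2) *\<^sub>R ((dtheta1 x v w - dtheta1 x w v) + (dtheta2 x v w - dtheta2 x w v))"
    "detam x v w - detam x w v =
      (1/2) *\<^sub>R ((dtheta1 x v w - dtheta1 x w v) - (dtheta2 x v w - dtheta2 x w v))"
    by (simp_all add: detap_def detam_def algebra_simps)
  then show ?p ?m
    unfolding theta_structure[OF assms] etap_def etam_def
    by (simp_all add: cross3_def vec_eq_iff forall_3 vector_3 algebra_simps)
qed

section \<open>Invariant forms and their curvature\<close>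

definition invariant_form ::
    "(real \<Rightarrow> real ^ 3) \<Rightarrow> (3 \<Rightarrow> real \<Rightarrow> real ^ 3) \<Rightarrow> (3 \<Rightarrow> real \<Rightarrow> real ^ 3) \<Rightarrow> connection"
  where "invariant_form a P Q x v = dnorm x v *\<^sub>R a (norm (fst x)) +
    (\<Sum>i\<in>UNIV. (etap x v $ i) *\<^sub>R P i (norm (fst x)) + (etam x v $ i) *\<^sub>R Q i (norm (fst x)))"

lemma pullback_retract_invariant_form:
  assumes "connection_eq_on {x \<in> M. fst x \<noteq> 0} A (invariant_form a P Q)"
    and "fst y \<noteq> 0" "snd y \<noteq> 0"
  shows "pullback retract_M A y v = invariant_form a P Q y v"
proof -
  have "retract_M y \<in> {x \<in> M. fst x \<noteq> 0}"
    using assms(2) retract_M_in_M[OF assms(3)] by (simp add: retract_M_def)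
  moreover have "dretract y v \<in> tangent (retract_M y)"
    by (rule tangent_retract_M[OF assms(3)])
  ultimately have "pullback retract_M A y v = invariant_form a P Q (retract_M y) (dretract y v)"
    using assms(1) unfolding connection_eq_on_def pullback_def by blast
  also have "\<dots> = invariant_form a P Q y v"
    unfolding invariant_form_def coframe_retract[OF assms(3,2)] by (simp add: retract_M_def)
  finally show ?thesis .
qed

definition regular :: "point set"
  where "regular = {y. fst y \<noteq> 0 \<and> snd y \<noteq> 0}"

lemma open_regular: "open regular"
  unfolding regular_def by (intro open_Collect_conj open_Collect_neq continuous_intros)

definition ddnorm :: "point \<Rightarrow> point \<Rightarrow> point \<Rightarrow> real"
  where "ddnorm x v w = (fst v \<bullet> fst w) / norm (fst x) - (fst x \<bullet> fst w) * (fst x \<bullet> fst v) / norm (fst x) ^ 3"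

lemma has_derivative_dnorm:
  assumes "fst x \<noteq> 0"
  shows "((\<lambda>y. dnorm y w) has_derivative (\<lambda>v. ddnorm x v w)) (at x)"
proof -
  have 2: "((\<lambda>y. fst y \<bullet> fst w) has_derivative (\<lambda>v. fst v \<bullet> fst w)) (at x)"
    by (rule has_derivative_inner_left[OF has_derivative_fst[OF has_derivative_ident]])
  show ?thesis
    unfolding dnorm_def[abs_def] divide_inverse
    by (rule has_derivative_eq_rhs[OF has_derivative_mult[OF 2 has_derivative_inverse_radius[OF assms]]])
      (use assms in \<open>simp add: fun_eq_iff ddnorm_def dnorm_def field_simps power3_eq_cube\<close>)
qed

lemma has_derivative_radial:
  assumes "fst x \<noteq> 0" "(a has_vector_derivative a') (at (norm (fst x)))"
  shows "((\<lambda>y::point. a (norm (fst y))) has_derivative (\<lambda>v. dnorm x v *\<^sub>R a')) (at x)"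
  using has_derivative_compose[OF has_derivative_radius[OF assms(1)] assms(2)[unfolded has_vector_derivative_def]] .

lemma has_derivative_invariant_form:
  assumes "fst x \<noteq> 0" "snd x \<noteq> 0"
    and "(a has_vector_derivative a') (at (norm (fst x)))"
    and "\<And>i. (P i has_vector_derivative P' i) (at (norm (fst x)))"
    and "\<And>i. (Q i has_vector_derivative Q' i) (at (norm (fst x)))"
  shows "((\<lambda>y. invariant_form a P Q y w) has_derivative (\<lambda>v.
    (dnorm x w *\<^sub>R dnorm x v *\<^sub>R a' + ddnorm x v w *\<^sub>R a (norm (fst x))) +
    (\<Sum>i\<in>UNIV. ((etap x w $ i) *\<^sub>R dnorm x v *\<^sub>R P' i + (detap x v w $ i) *\<^sub>R P i (norm (fst x))) +
      ((etam x w $ i) *\<^sub>R dnorm x v *\<^sub>R Q' i + (detam x v w $ i) *\<^sub>R Q i (norm (fst x)))))) (at x)"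
  unfolding invariant_form_def
  by (rule has_derivative_add[OF has_derivative_scaleR[OF has_derivative_dnorm[OF assms(1)]
          has_derivative_radial[OF assms(1,3)]]
        has_derivative_sum[OF has_derivative_add[OF
          has_derivative_scaleR[OF bounded_linear.has_derivative[OF bounded_linear_vec_nth
            has_derivative_eta(1)[OF assms(1,2)]] has_derivative_radial[OF assms(1) assms(4)]]
          has_derivative_scaleR[OF bounded_linear.has_derivative[OF bounded_linear_vec_nth
            has_derivative_eta(2)[OF assms(1,2)]] has_derivative_radial[OF assms(1) assms(5)]]]]])

text \<open>The radial term is closed, since the second derivative \<open>ddnorm\<close> is
  symmetric, so it survives only inside the bracket. The derivatives of the other coframe elements
  are eliminated by \<open>eta_structure\<close>.\<close>

lemma curvature_invariant_form:
  assumes A: "connection_eq_on {x \<in> M. fst x \<noteq> 0} A (invariant_form a P Q)"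
    and x: "x \<in> M" "fst x \<noteq> 0"
    and vw: "v \<in> tangent x" "w \<in> tangent x"
    and deriv: "(a has_vector_derivative a') (at (norm (fst x)))"
      "\<And>i. (P i has_vector_derivative P' i) (at (norm (fst x)))"
      "\<And>i. (Q i has_vector_derivative Q' i) (at (norm (fst x)))"
  shows "curvature A x [v, w] =
    (\<Sum>i\<in>UNIV. (dnorm x v * etap x w $ i - dnorm x w * etap x v $ i) *\<^sub>R P' i
      + (dnorm x v * etam x w $ i - dnorm x w * etam x v $ i) *\<^sub>R Q' i
      - (2 * (cross3 (etap x v) (etap x w) + cross3 (etam x v) (etam x w)) $ i) *\<^sub>R P i (norm (fst x))
      - (2 * (cross3 (etap x v) (etam x w) + cross3 (etam x v) (etap x w)) $ i) *\<^sub>R Q i (norm (fst x)))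
    + su2_bracket (invariant_form a P Q x v) (invariant_form a P Q x w)"
proof -
  have s: "snd x \<noteq> 0" using x by (auto simp: M_def SU2_def)
  define D where "D v w = (dnorm x w *\<^sub>R dnorm x v *\<^sub>R a' + ddnorm x v w *\<^sub>R a (norm (fst x))) +
    (\<Sum>i\<in>UNIV. ((etap x w $ i) *\<^sub>R dnorm x v *\<^sub>R P' i + (detap x v w $ i) *\<^sub>R P i (norm (fst x))) +
      ((etam x w $ i) *\<^sub>R dnorm x v *\<^sub>R Q' i + (detam x v w $ i) *\<^sub>R Q i (norm (fst x))))" for v w
  have "((\<lambda>y. pullback retract_M A y w) has_derivative (\<lambda>v. D v w)) (at x)" for w
    unfolding D_def
    by (rule has_derivative_transform_within_open[OF has_derivative_invariant_form[OF x(2) s deriv] open_regular])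
      (use x s pullback_retract_invariant_form[OF A] in \<open>auto simp: regular_def\<close>)
  then have F: "frechet_derivative (\<lambda>y. pullback retract_M A y w) (at x) = (\<lambda>v. D v w)" for w
    by (rule frechet_derivative_at[symmetric])
  have e: "A x v = invariant_form a P Q x v" "A x w = invariant_form a P Q x w"
    using A x vw unfolding connection_eq_on_def by blast+
  have "ddnorm x v w = ddnorm x w v" by (simp add: ddnorm_def inner_commute mult.commute)
  then have "D v w - D w v =
    (\<Sum>i\<in>UNIV. (dnorm x v * etap x w $ i - dnorm x w * etap x v $ i) *\<^sub>R P' i
      + (dnorm x v * etam x w $ i - dnorm x w * etam x v $ i) *\<^sub>R Q' i
      + ((detap x v w - detap x w v) $ i) *\<^sub>R P i (norm (fst x))
      + ((detam x v w - detam x w v) $ i) *\<^sub>R Q i (norm (fst x)))"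
    by (simp add: D_def sum_subtractf[symmetric] algebra_simps)
  then show ?thesis
    unfolding eta_structure[OF x(2) s]
    by (simp add: curvature_def Let_def F e algebra_simps)
qed

section \<open>The form psi on a frame and in nested form\<close>

text \<open>Here and in the next two definitions the constituents of \<open>psi\<close> are formed
  from arbitrary 1-forms on any type, which separates the exterior algebra from the
  geometry.\<close>

definition symplectic_form :: "(3 \<Rightarrow> 'v \<Rightarrow> real) \<Rightarrow> (3 \<Rightarrow> 'v \<Rightarrow> real) \<Rightarrow> (3 \<Rightarrow> real) \<Rightarrow> (3 \<Rightarrow> real) \<Rightarrow> 'v list \<Rightarrow> real"
  where "symplectic_form p m A B vs = 4 * (\<Sum>i\<in>UNIV. A i * B i * wedge 1 (one_form (m i)) (one_form (p i)) vs)"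

definition volume_form :: "(3 \<Rightarrow> 'v \<Rightarrow> real) \<Rightarrow> (3 \<Rightarrow> 'v \<Rightarrow> real) \<Rightarrow> (3 \<Rightarrow> real) \<Rightarrow> (3 \<Rightarrow> real) \<Rightarrow> 'v list \<Rightarrow> real"
  where "volume_form p m A B vs =
    - 8 * A 1 * A 2 * A 3 * triple (p 1) (p 2) (p 3) vs
    + 4 * (\<Sum>i\<in>UNIV. \<Sum>j\<in>UNIV. \<Sum>k\<in>UNIV. levi_civita i j k * B i * B j * A k *
        triple (m i) (m j) (p k) vs)"

definition coassociative_form :: "('v \<Rightarrow> real) \<Rightarrow> (3 \<Rightarrow> 'v \<Rightarrow> real) \<Rightarrow> (3 \<Rightarrow> 'v \<Rightarrow> real) \<Rightarrow>
    (3 \<Rightarrow> real) \<Rightarrow> (3 \<Rightarrow> real) \<Rightarrow> 'v list \<Rightarrow> real"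
  where "coassociative_form d p m A B vs =
    wedge 2 (symplectic_form p m A B) (symplectic_form p m A B) vs / 2
    - wedge 1 (one_form d) (volume_form p m A B) vs"

lemma psi_eq_coassociative_form:
  "psi x = coassociative_form (dt x) (\<lambda>i. eta_plus i x) (\<lambda>i. eta_minus i x)
    (\<lambda>i. coefA i (radius x)) (\<lambda>i. coefB i (radius x))"
proof -
  have "omega x = symplectic_form (\<lambda>i. eta_plus i x) (\<lambda>i. eta_minus i x)
      (\<lambda>i. coefA i (radius x)) (\<lambda>i. coefB i (radius x))"
    by (simp add: fun_eq_iff omega_def symplectic_form_def)
  moreover have "Omega2 x = volume_form (\<lambda>i. eta_plus i x) (\<lambda>i. eta_minus i x)
      (\<lambda>i. coefA i (radius x)) (\<lambda>i. coefB i (radius x))"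
    by (simp add: fun_eq_iff Omega2_def volume_form_def Let_def)
  ultimately show ?thesis unfolding psi_def[abs_def] coassociative_form_def[abs_def] by simp
qed

lemma levi_civita_simps:
  "levi_civita 1 2 3 = 1" "levi_civita 2 3 1 = 1" "levi_civita 3 1 2 = 1"
  "levi_civita 1 3 2 = -1" "levi_civita 3 2 1 = -1" "levi_civita 2 1 3 = -1"
  "levi_civita i i k = 0" "levi_civita i k i = 0" "levi_civita k i i = 0"
proof -
  have v: "axis 1 1 = (vector [1, 0, 0] :: real ^ 3)" "axis 2 1 = (vector [0, 1, 0] :: real ^ 3)"
    "axis 3 1 = (vector [0, 0, 1] :: real ^ 3)"
    by (simp_all add: vec_eq_iff forall_3 axis_def)
  show "levi_civita 1 2 3 = 1" "levi_civita 2 3 1 = 1" "levi_civita 3 1 2 = 1"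
    "levi_civita 1 3 2 = -1" "levi_civita 3 2 1 = -1" "levi_civita 2 1 3 = -1"
    unfolding levi_civita_def v by (simp_all add: cross3_def)
  have "levi_civita i j k = cross3 (axis i 1) (axis j 1) \<bullet> axis k 1" for i j k
    by (simp add: levi_civita_def inner_axis)
  then show "levi_civita i i k = 0" "levi_civita i k i = 0" "levi_civita k i i = 0"
    by (simp_all add: dot_cross_self cross_refl inner_commute)
qed

lemma symplectic_form_Cons2:
  "symplectic_form p m A B [u, v] = 4 * (\<Sum>i\<in>UNIV. A i * B i * (m i u * p i v - m i v * p i u))"
  by (simp add: symplectic_form_def wedge_1_Cons wedge_1_2_Nil one_form_def algebra_simps del: One_nat_def)

lemma wedge_1_one_form_Cons4:
  "wedge 1 (one_form a) G [u, v, w, z] =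
    a u * G [v, w, z] - a v * G [u, w, z] + a w * G [u, v, z] - a z * G [u, v, w]"
  by (simp add: wedge_1_Cons wedge_1_2_Nil one_form_def del: One_nat_def)

lemma wedge_2_Cons4:
  "wedge 2 F G [a, b, c, d] =
    G [c, d] *\<^sub>R F [a, b] - G [b, d] *\<^sub>R F [a, c] + G [b, c] *\<^sub>R F [a, d]
    + G [a, d] *\<^sub>R F [b, c] - G [a, c] *\<^sub>R F [b, d] + G [a, b] *\<^sub>R F [c, d]"
  by (simp add: wedge_2_Cons wedge_1_Cons wedge_1_2_Nil del: One_nat_def)

lemma wedge_2_Cons6:
  "wedge 2 F G [a, b, c, d, e, f] =
    G [c, d, e, f] *\<^sub>R F [a, b] - G [b, d, e, f] *\<^sub>R F [a, c] + G [b, c, e, f] *\<^sub>R F [a, d]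
    - G [b, c, d, f] *\<^sub>R F [a, e] + G [b, c, d, e] *\<^sub>R F [a, f]
    + G [a, d, e, f] *\<^sub>R F [b, c] - G [a, c, e, f] *\<^sub>R F [b, d] + G [a, c, d, f] *\<^sub>R F [b, e]
    - G [a, c, d, e] *\<^sub>R F [b, f]
    + G [a, b, e, f] *\<^sub>R F [c, d] - G [a, b, d, f] *\<^sub>R F [c, e] + G [a, b, d, e] *\<^sub>R F [c, f]
    + G [a, b, c, f] *\<^sub>R F [d, e] - G [a, b, c, e] *\<^sub>R F [d, f] + G [a, b, c, d] *\<^sub>R F [e, f]"
  by (simp add: wedge_2_Cons wedge_1_Cons wedge_1_2_Nil del: One_nat_def)

lemma triple_Cons3:
  "triple a b c [u, v, w] = a u * (b v * c w - b w * c v) - a v * (b u * c w - b w * c u)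
    + a w * (b u * c v - b v * c u)"
  by (simp add: triple_def wedge_1_Cons wedge_1_2_Nil one_form_def algebra_simps del: One_nat_def)

lemma volume_form_Cons3:
  "volume_form p m A B [u, v, w] =
    - 8 * A 1 * A 2 * A 3 * triple (p 1) (p 2) (p 3) [u, v, w]
    + 4 * (B 1 * B 2 * A 3 * (triple (m 1) (m 2) (p 3) [u, v, w] - triple (m 2) (m 1) (p 3) [u, v, w])
      + B 2 * B 3 * A 1 * (triple (m 2) (m 3) (p 1) [u, v, w] - triple (m 3) (m 2) (p 1) [u, v, w])
      + B 3 * B 1 * A 2 * (triple (m 3) (m 1) (p 2) [u, v, w] - triple (m 1) (m 3) (p 2) [u, v, w]))"
  by (simp add: volume_form_def sum_3 levi_civita_simps algebra_simps)

lemma coassociative_form_Cons4: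
  "coassociative_form d p m A B [a, b, c, e] = (let s = symplectic_form p m A B; V = volume_form p m A B in
    s [a, b] * s [c, e] - s [a, c] * s [b, e] + s [a, e] * s [b, c]
    - (d a * V [b, c, e] - d b * V [a, c, e] + d c * V [a, b, e] - d e * V [a, b, c]))"
  unfolding coassociative_form_def wedge_2_Cons4 wedge_1_one_form_Cons4 Let_def by (simp add: mult.commute)

definition dual_frame :: "('v \<Rightarrow> real) \<Rightarrow> (3 \<Rightarrow> 'v \<Rightarrow> real) \<Rightarrow> (3 \<Rightarrow> 'v \<Rightarrow> real) \<Rightarrow> 'v \<Rightarrow> (3 \<Rightarrow> 'v) \<Rightarrow> (3 \<Rightarrow> 'v) \<Rightarrow> bool"
  where "dual_frame d p m D U W \<longleftrightarrow> d D = 1 \<and>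
    (\<forall>i. d (U i) = 0 \<and> d (W i) = 0 \<and> p i D = 0 \<and> m i D = 0) \<and>
    (\<forall>i j. p i (U j) = (if i = j then 1 else 0) \<and> p i (W j) = 0 \<and>
      m i (W j) = (if i = j then 1 else 0) \<and> m i (U j) = 0)"

text \<open>Each six-tuple omits one vector of the seven-dimensional frame and thereby isolates one
  radial derivative: those of the coefficients along \<open>U 1\<close>, \<open>W 1\<close>,
  \<open>U 2\<close>, \<open>W 2\<close> in turn. Index 3 is tied to index 2 by the U(1)
  symmetry.\<close>

lemma wedge_coassociative_form_dual_frame:
  assumes "dual_frame d p m D U W"
  shows "wedge 2 F (coassociative_form d p m A B) [D, U 1, U 2, U 3, W 2, W 3] =
      - (16 * (A 2 * (B 2 * (A 3 * B 3)))) *\<^sub>R F [D, U 1] - (8 * (B 2 * (B 3 * A 1))) *\<^sub>R F [U 2, U 3] +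
      (8 * A 1 * A 2 * A 3) *\<^sub>R F [W 2, W 3]"
    "wedge 2 F (coassociative_form d p m A B) [D, W 1, U 2, U 3, W 2, W 3] =
      (8 * (B 1 * (B 2 * A 3))) *\<^sub>R F [U 2, W 3] - (16 * (A 2 * (B 2 * (A 3 * B 3)))) *\<^sub>R F [D, W 1] -
      (8 * (B 3 * (B 1 * A 2))) *\<^sub>R F [U 3, W 2]"
    "wedge 2 F (coassociative_form d p m A B) [D, U 1, W 1, U 2, U 3, W 3] =
      (16 * (A 1 * (B 1 * (A 3 * B 3)))) *\<^sub>R F [D, U 2] - (8 * (B 3 * (B 1 * A 2))) *\<^sub>R F [U 1, U 3] +
      (8 * A 1 * A 2 * A 3) *\<^sub>R F [W 1, W 3]"
    "wedge 2 F (coassociative_form d p m A B) [D, U 1, W 1, W 2, U 3, W 3] =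
      (16 * (A 1 * (B 1 * (A 3 * B 3)))) *\<^sub>R F [D, W 2] + (8 * (B 1 * (B 2 * A 3))) *\<^sub>R F [U 1, W 3] +
      (8 * (B 2 * (B 3 * A 1))) *\<^sub>R F [W 1, U 3]"
  using assms
  by (simp_all add: dual_frame_def wedge_2_Cons6 coassociative_form_Cons4 Let_def symplectic_form_Cons2
      volume_form_Cons3 triple_Cons3 sum_3)

definition unit_form :: "'v list \<Rightarrow> real"
  where "unit_form vs = (if vs = [] then 1 else 0)"

text \<open>The expansion of omega^2 / 2 minus the product of dt with Omega2. The 16 is the square
  of the factor 4 in omega, the two orders of each pair absorbing the 1/2; the 8 in the mixed terms
  is twice the factor 4 in Omega2, again because of the two orders.\<close>

definition nested_form :: "('v \<Rightarrow> real) \<Rightarrow> (3 \<Rightarrow> 'v \<Rightarrow> real) \<Rightarrow> (3 \<Rightarrow> 'v \<Rightarrow> real) \<Rightarrow>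
    (3 \<Rightarrow> real) \<Rightarrow> (3 \<Rightarrow> real) \<Rightarrow> 'v list \<Rightarrow> real"
  where "nested_form d p m A B vs =
    16 * (A 1 * B 1 * A 2 * B 2) * (m 1 \<cdot> p 1 \<cdot> m 2 \<cdot> p 2 \<cdot> unit_form) vs
    + 16 * (A 1 * B 1 * A 3 * B 3) * (m 1 \<cdot> p 1 \<cdot> m 3 \<cdot> p 3 \<cdot> unit_form) vs
    + 16 * (A 2 * B 2 * A 3 * B 3) * (m 2 \<cdot> p 2 \<cdot> m 3 \<cdot> p 3 \<cdot> unit_form) vs
    + 8 * (A 1 * A 2 * A 3) * (d \<cdot> p 1 \<cdot> p 2 \<cdot> p 3 \<cdot> unit_form) vs
    - 8 * (B 1 * B 2 * A 3) * (d \<cdot> m 1 \<cdot> m 2 \<cdot> p 3 \<cdot> unit_form) vs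
    - 8 * (B 2 * B 3 * A 1) * (d \<cdot> m 2 \<cdot> m 3 \<cdot> p 1 \<cdot> unit_form) vs
    - 8 * (B 3 * B 1 * A 2) * (d \<cdot> m 3 \<cdot> m 1 \<cdot> p 2 \<cdot> unit_form) vs"

lemma coassociative_form_nested:
  assumes "length vs = 4"
  shows "coassociative_form d p m A B vs = nested_form d p m A B vs"
proof -
  obtain a b c e where vs: "vs = [a, b, c, e]"
    using assms by (auto simp: numeral_eq_Suc length_Suc_conv)
  show ?thesis
    by (simp add: vs nested_form_def coassociative_form_Cons4 Let_def symplectic_form_Cons2
      volume_form_Cons3 triple_Cons3 sum_3 wedge1_Cons wedge1_Nil wedge1_linear unit_form_def) (simp add: algebra_simps)
qed

text \<open>After sorting, every term is a multiple of the single 6-form that lacks the factor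
  \<open>m 1\<close>. The total coefficient vanishes by the last assumption, which is the linear
  differential equation for a coefficient \<open>h\<close> with derivative \<open>k\<close>.\<close>

lemma abelian_wedge_coassociative_form:
  assumes "length vs = 6"
    and "\<And>us. \<lbrakk>length us = 2; set us \<subseteq> set vs\<rbrakk> \<Longrightarrow> F us =
      (k * wedge 1 (one_form d) (one_form (p 1)) us - 2 * h * (wedge 1 (one_form (p 2)) (one_form (p 3)) us
        + wedge 1 (one_form (m 2)) (one_form (m 3)) us)) *\<^sub>R T"
    and "k * (A 2 * B 2 * A 3 * B 3) = h * (A 1 * B 2 * B 3 - A 1 * A 2 * A 3)"
  shows "wedge 2 F (coassociative_form d p m A B) vs = 0"
proof -
  define G where "G = nested_form d p m A B"
  let ?F = "\<lambda>us. k *\<^sub>R wedge 1 (one_form d) (one_form (p 1)) us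
    - (2 * h) *\<^sub>R (wedge 1 (one_form (p 2)) (one_form (p 3)) us + wedge 1 (one_form (m 2)) (one_form (m 3)) us)"
  have "wedge 2 F (coassociative_form d p m A B) vs = wedge 2 (\<lambda>us. ?F us *\<^sub>R T) G vs"
    using assms(1,2) by (intro wedge_cong) (simp_all add: coassociative_form_nested G_def)
  also have "\<dots> = (k * (d \<cdot> p 1 \<cdot> G) vs
      - 2 * h * ((p 2 \<cdot> p 3 \<cdot> G) vs + (m 2 \<cdot> m 3 \<cdot> G) vs)) *\<^sub>R T"
    unfolding wedge_scaleR_const wedge_diff_left wedge_scale_left wedge_add_left wedge_2_assoc by simp
  also have "k * (d \<cdot> p 1 \<cdot> G) vs - 2 * h * ((p 2 \<cdot> p 3 \<cdot> G) vs + (m 2 \<cdot> m 3 \<cdot> G) vs) =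
    16 * (k * (A 2 * B 2 * A 3 * B 3) - h * (A 1 * B 2 * B 3 - A 1 * A 2 * A 3))
      * (d \<cdot> p 1 \<cdot> m 2 \<cdot> p 2 \<cdot> m 3 \<cdot> p 3 \<cdot> unit_form) vs"
  proof -
    note ac = wedge1_anticommute
    \<comment> \<open>The instances are oriented by the order \<open>d\<close>, \<open>p 1\<close>,
      \<open>p 2\<close>, \<open>p 3\<close>, \<open>m 1\<close>, \<open>m 2\<close>,
      \<open>m 3\<close>, so that rewriting with them sorts the factors and terminates.\<close>
    note sort =
      ac[of "p 1" d] ac[of "p 2" d] ac[of "p 3" d]
      ac[of "m 1" d] ac[of "m 2" d] ac[of "m 3" d]
      ac[of "p 2" "p 1"] ac[of "p 3" "p 1"] ac[of "m 1" "p 1"]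
      ac[of "m 2" "p 1"] ac[of "m 3" "p 1"] ac[of "p 3" "p 2"]
      ac[of "m 1" "p 2"] ac[of "m 2" "p 2"] ac[of "m 3" "p 2"]
      ac[of "m 1" "p 3"] ac[of "m 2" "p 3"] ac[of "m 3" "p 3"]
      ac[of "m 2" "m 1"] ac[of "m 3" "m 1"] ac[of "m 3" "m 2"]
    show ?thesis
      unfolding G_def nested_form_def[abs_def] by (simp add: wedge1_linear wedge1_self sort) (simp add: algebra_simps)
  qed
  finally show ?thesis using assms(3) by simp
qed

section \<open>Invariant connections\<close>

lemma qmult_right_inner: "(b \<odot> a) \<bullet> (c \<odot> a) = (norm a)\<^sup>2 * (b \<bullet> c)"
  unfolding norm_quat inner_prod_def by (simp add: quat_components power2_eq_square) algebra

lemma qmult_left_inner: "(a \<odot> b) \<bullet> (a \<odot> c) = (norm a)\<^sup>2 * (b \<bullet> c)"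
  unfolding norm_quat inner_prod_def by (simp add: quat_components power2_eq_square) algebra

lemma qcnj_qmult_cancel: "norm a = 1 \<Longrightarrow> qcnj a \<odot> (a \<odot> b) = b"
  by (simp add: qmult_assoc[symmetric] qcnj_qmult_self)

lemma log_form_left_invariant: "norm a = 1 \<Longrightarrow> log_form (a \<odot> p) (a \<odot> v) = log_form p v"
  by (simp add: log_form_def qcnj_qmult qmult_assoc qcnj_qmult_cancel)

lemma linear_Ad: "linear (Ad a)"
proof (rule linearI)
  have "((0::real), u + v) = (0, u) + (0, v)" "(0, r *\<^sub>R u) = r *\<^sub>R ((0::real), u)" for r and u v :: "real ^ 3" by simp_all
  then show "Ad a (u + v) = Ad a u + Ad a v" "Ad a (r *\<^sub>R u) = r *\<^sub>R Ad a u" for r u v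
    by (simp_all only: Ad_def qmult.add_left qmult.add_right qmult.scaleR_left qmult.scaleR_right snd_add snd_scaleR)
qed

text \<open>Conjugation by a unit quaternion keeps the real part real, so it commutes with taking
  the imaginary part.\<close>

lemma log_form_right_equivariant: "norm a = 1 \<Longrightarrow> log_form (p \<odot> a) (v \<odot> a) = Ad (qcnj a) (log_form p v)"
proof -
  assume a: "norm a = 1"
  have "snd (qcnj a \<odot> w \<odot> a) = snd (qcnj a \<odot> (0, snd w) \<odot> a)" for w
  proof -
    have w: "w = (fst w, 0) + (0, snd w)" by simp
    have "qcnj a \<odot> w \<odot> a = fst w *\<^sub>R (qcnj a \<odot> a) + qcnj a \<odot> (0, snd w) \<odot> a"
      by (subst w) (simp only: qmult.add_left qmult.add_right qmult_real qmult.scaleR_left)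
    then show ?thesis by (simp add: qcnj_qmult_self)
  qed
  then have "snd (qcnj (p \<odot> a) \<odot> (v \<odot> a)) = Ad (qcnj a) (snd (qcnj p \<odot> v))"
    by (simp add: Ad_def qcnj_qmult qmult_assoc)
  then show ?thesis
    using a by (simp add: log_form_def linear_scale[OF linear_Ad])
qed

lemma norm_u1 [simp]: "norm (u1 \<theta>) = 1"
  by (simp add: u1_def norm_prod_def Tgen_def)

lemma linear_act: "linear (act a1 a2)"
  by (rule linearI) (simp_all add: act_def qmult.add_left qmult.add_right qmult.scaleR_left qmult.scaleR_right)

lemma linear_act_u1: "linear (act_u1 \<theta>)"
  by (rule linearI) (simp_all add: act_u1_def qmult.add_left qmult.scaleR_left)

lemma pullback_linear:
  fixes h :: "point \<Rightarrow> point"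
  assumes "linear h"
  shows "pullback h A x v = A (h x) (h v)"
proof -
  have "(h has_derivative h) (at x)"
    by (rule bounded_linear_imp_has_derivative[OF linear_conv_bounded_linear[THEN iffD1, OF assms]])
  then show ?thesis by (simp add: pullback_def frechet_derivative_at[symmetric])
qed

lemma act_radius: "norm a1 = 1 \<Longrightarrow> norm (fst (act a1 a2 x)) = norm (fst x)"
  by (simp add: act_def)

lemma coframe_act:
  assumes "norm a1 = 1" "norm a2 = 1"
  shows "etap (act a1 a2 x) (act a1 a2 v) = etap x v" "etam (act a1 a2 x) (act a1 a2 v) = etam x v"
    "dnorm (act a1 a2 x) (act a1 a2 v) = dnorm x v"
proof -
  have 1: "theta1 (act a1 a2 x) (act a1 a2 v) = theta1 x v"
    using assms by (simp add: theta1_def act_def log_form_left_invariant)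
  have "qcnj (snd (act a1 a2 z)) \<odot> fst (act a1 a2 z') = a2 \<odot> (qcnj (snd z) \<odot> fst z')" for z z' :: point
    using assms by (simp add: act_def qcnj_qmult qmult_assoc qcnj_qmult_cancel)
  then have 2: "theta2 (act a1 a2 x) (act a1 a2 v) = theta2 x v"
    using assms by (simp add: theta2_def qmult.add_right[symmetric] log_form_left_invariant)
  show "etap (act a1 a2 x) (act a1 a2 v) = etap x v" "etam (act a1 a2 x) (act a1 a2 v) = etam x v"
    by (simp_all add: etap_def etam_def 1 2)
  show "dnorm (act a1 a2 x) (act a1 a2 v) = dnorm x v"
    using assms by (simp add: dnorm_def act_def qmult_left_inner)
qed

lemma coframe_act_u1:
  shows "etap (act_u1 \<theta> x) (act_u1 \<theta> v) = Ad (qcnj (u1 \<theta>)) (etap x v)"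
    "etam (act_u1 \<theta> x) (act_u1 \<theta> v) = Ad (qcnj (u1 \<theta>)) (etam x v)"
    "dnorm (act_u1 \<theta> x) (act_u1 \<theta> v) = dnorm x v"
proof -
  note lin = linear_scale[OF linear_Ad] linear_add[OF linear_Ad] linear_diff[OF linear_Ad]
  have 1: "theta1 (act_u1 \<theta> x) (act_u1 \<theta> v) = Ad (qcnj (u1 \<theta>)) (theta1 x v)"
    by (simp add: theta1_def act_u1_def log_form_right_equivariant)
  have "theta2 (act_u1 \<theta> x) (act_u1 \<theta> v) = log_form ((qcnj (snd x) \<odot> fst x) \<odot> u1 \<theta>)
     ((qcnj (snd v) \<odot> fst x + qcnj (snd x) \<odot> fst v) \<odot> u1 \<theta>)"
    by (simp add: theta2_def act_u1_def qmult_assoc qmult.add_left)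
  then have 2: "theta2 (act_u1 \<theta> x) (act_u1 \<theta> v) = Ad (qcnj (u1 \<theta>)) (theta2 x v)"
    by (simp add: theta2_def log_form_right_equivariant)
  show "etap (act_u1 \<theta> x) (act_u1 \<theta> v) = Ad (qcnj (u1 \<theta>)) (etap x v)"
    "etam (act_u1 \<theta> x) (act_u1 \<theta> v) = Ad (qcnj (u1 \<theta>)) (etam x v)"
    by (simp_all add: etap_def etam_def 1 2 lin)
  show "dnorm (act_u1 \<theta> x) (act_u1 \<theta> v) = dnorm x v"
    by (simp add: dnorm_def act_u1_def qmult_right_inner)
qed

lemma Ad_u1:
  "Ad (qcnj (u1 \<theta>)) w = vector [w $ 1, cos (2 * \<theta>) * w $ 2 + sin (2 * \<theta>) * w $ 3,
    cos (2 * \<theta>) * w $ 3 - sin (2 * \<theta>) * w $ 2]"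
proof -
  have T: "Tgen 1 $ 1 = 1" "Tgen 1 $ 2 = 0" "Tgen 1 $ 3 = 0" by (simp_all add: Tgen_def axis_def)
  have c: "cos (2 * \<theta>) = cos \<theta> * cos \<theta> - sin \<theta> * sin \<theta>" "sin (2 * \<theta>) = 2 * sin \<theta> * cos \<theta>"
    by (simp_all add: cos_double power2_eq_square sin_double)
  have s: "cos \<theta> * cos \<theta> + sin \<theta> * sin \<theta> = 1"
    using sin_cos_squared_add2[of \<theta>] by (simp add: power2_eq_square)
  have w: "sin \<theta> * w $ 1 * sin \<theta> + cos \<theta> * (cos \<theta> * w $ 1) = w $ 1 * (cos \<theta> * cos \<theta> + sin \<theta> * sin \<theta>)"
    by algebra
  show ?thesis
    unfolding Ad_def u1_def c
    by (simp add: quat_components T w[unfolded s]) (intro conjI; algebra)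
qed

section \<open>The dual frame along the ray\<close>

definition base_point :: "real \<Rightarrow> point"
  where "base_point t = ((t, 0), (1, 0))"

definition radial_vec :: point
  where "radial_vec = ((1, 0), 0)"

text \<open>Together with \<open>radial_vec\<close> and \<open>minus_vec\<close> this is the frame
  dual to the coframe at \<open>base_point t\<close>; the factors \<open>t\<close> and 2 come from
  inverting the formulas of \<open>coframe_base_point\<close>.\<close>

definition plus_vec :: "real \<Rightarrow> 3 \<Rightarrow> point"
  where "plus_vec t i = ((0, t *\<^sub>R axis i 1), 0)"

definition minus_vec :: "real \<Rightarrow> 3 \<Rightarrow> point"
  where "minus_vec t i = ((0, t *\<^sub>R axis i 1), (0, 2 *\<^sub>R axis i 1))"

abbreviation "radial_part A t \<equiv> A (base_point t) radial_vec"
abbreviation "plus_part A i t \<equiv> A (base_point t) (plus_vec t i)"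
abbreviation "minus_part A i t \<equiv> A (base_point t) (minus_vec t i)"

lemma base_point_simps:
  assumes "t > 0"
  shows "base_point t \<in> M" "fst (base_point t) \<noteq> 0" "norm (fst (base_point t)) = t" "radius (base_point t) = t"
  using assms by (auto simp: base_point_def M_def SU2_def norm_prod_def radius_def prod_eq_iff)

lemma coframe_base_point:
  assumes "t > 0"
  shows "dnorm (base_point t) v = fst (fst v)"
    "etap (base_point t) v = (1 / t) *\<^sub>R snd (fst v) - (1 / 2) *\<^sub>R snd (snd v)"
    "etam (base_point t) v = (1 / 2) *\<^sub>R snd (snd v)"
proof -
  have n: "norm ((t, 0::real^3)) = t" using assms by (simp add: norm_prod_def)
  have c: "qcnj (t, 0) = (t, 0)" "qcnj (1, 0) = (1, 0)" by (simp_all add: qcnj_def)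
  show "dnorm (base_point t) v = fst (fst v)"
    using assms by (simp add: dnorm_def base_point_def n inner_prod_def)
  have 1: "theta1 (base_point t) v = (1 / t) *\<^sub>R snd (fst v)"
    using assms by (simp add: theta1_def base_point_def log_form_def n c power2_eq_square field_simps)
  have 2: "theta2 (base_point t) v = (1 / t) *\<^sub>R snd (fst v) - snd (snd v)"
    using assms unfolding theta2_def base_point_def fst_conv snd_conv c log_form_def qmult_real
    by (simp add: n c power2_eq_square qcnj_def vec_eq_iff field_simps)
  show "etap (base_point t) v = (1 / t) *\<^sub>R snd (fst v) - (1 / 2) *\<^sub>R snd (snd v)"
    "etam (base_point t) v = (1 / 2) *\<^sub>R snd (snd v)"
    by (simp_all add: etap_def etam_def 1 2 vec_eq_iff field_simps)
qed

lemma coframe_frame: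
  assumes "t > 0"
  shows "dnorm (base_point t) radial_vec = 1" "etap (base_point t) radial_vec = 0" "etam (base_point t) radial_vec = 0"
    "dnorm (base_point t) (plus_vec t i) = 0" "etap (base_point t) (plus_vec t i) = axis i 1"
    "etam (base_point t) (plus_vec t i) = 0"
    "dnorm (base_point t) (minus_vec t i) = 0" "etap (base_point t) (minus_vec t i) = 0"
    "etam (base_point t) (minus_vec t i) = axis i 1"
  using assms by (simp_all add: coframe_base_point radial_vec_def plus_vec_def minus_vec_def)

lemma frame_tangent:
  "radial_vec \<in> tangent (base_point t)" "plus_vec s i \<in> tangent (base_point t)" "minus_vec s i \<in> tangent (base_point t)"
  by (simp_all add: tangent_def radial_vec_def plus_vec_def minus_vec_def base_point_def inner_prod_def)

lemma frame_expansion: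
  assumes "t > 0" "v \<in> tangent (base_point t)"
  shows "v = dnorm (base_point t) v *\<^sub>R radial_vec +
    (\<Sum>i\<in>UNIV. (etap (base_point t) v $ i) *\<^sub>R plus_vec t i + (etam (base_point t) v $ i) *\<^sub>R minus_vec t i)"
  using assms unfolding coframe_base_point[OF assms(1)]
  by (simp add: sum_3 prod_eq_iff vec_eq_iff forall_3 axis_def radial_vec_def plus_vec_def minus_vec_def
      tangent_def base_point_def inner_prod_def field_simps)

lemma act_to_base_point:
  assumes "x \<in> M" "fst x \<noteq> 0"
  obtains a1 a2 where "norm a1 = 1" "norm a2 = 1" "act a1 a2 x = base_point (norm (fst x))"
proof
  \<comment> \<open>The first group element turns p into its norm; the second must then be the image
    of q under the first, so that q is sent to 1.\<close>
  let ?a = "qcnj (fst x) /\<^sub>R norm (fst x)"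
  have n: "norm (snd x) = 1" using assms by (simp add: M_def SU2_def)
  show 1: "norm ?a = 1" using assms by simp
  then show 2: "norm (?a \<odot> snd x) = 1" using n by simp
  have "snd (act ?a (?a \<odot> snd x) x) = (1, 0)"
    using qcnj_qmult_self(2)[of "?a \<odot> snd x"] 2 by (simp add: act_def)
  moreover have "fst (act ?a (?a \<odot> snd x) x) = (norm (fst x), 0)"
    using assms by (simp add: act_def qmult.scaleR_left qcnj_qmult_self power2_eq_square)
  ultimately show "act ?a (?a \<odot> snd x) x = base_point (norm (fst x))"
    by (simp add: base_point_def prod_eq_iff)
qed

lemma act_tangent:
  assumes "norm a1 = 1" "norm a2 = 1" "v \<in> tangent x"
  shows "act a1 a2 v \<in> tangent (act a1 a2 x)"
  using assms by (simp add: tangent_def act_def qmult_right_inner qmult_left_inner)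

lemma smooth_connection_linear:
  assumes "smooth_connection_on U A" "x \<in> U" "x \<in> M"
  shows "linear (pullback retract_M A x)"
proof -
  have "snd x \<noteq> 0" using assms(3) by (auto simp: M_def SU2_def)
  then show ?thesis
    using assms retract_M_M[OF assms(3)] by (simp add: smooth_connection_on_def Let_def del: split_paired_All)
qed

text \<open>The group is transitive on each level set of the radius, so everything is transported to
  the ray and expanded in the frame there. \<open>A\<close> is constrained on tangent vectors only;
  linearity is therefore taken from its pullback along the retraction, which agrees with
  \<open>A\<close> on them.\<close>

lemma invariant_connection_eq:
  assumes A: "smooth_connection_on M A" "invariant_on M A"
  shows "connection_eq_on {x \<in> M. fst x \<noteq> 0} A
    (invariant_form (\<lambda>t. radial_part A t) (\<lambda>i t. plus_part A i t)
      (\<lambda>i t. minus_part A i t))"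
  unfolding connection_eq_on_def
proof clarify
  fix x v assume x: "x \<in> M" "fst x \<noteq> 0" and v: "v \<in> tangent x"
  let ?t = "norm (fst x)" let ?b = "base_point ?t"
  have t: "?t > 0" using x by simp
  obtain a1 a2 where a: "norm a1 = 1" "norm a2 = 1" "act a1 a2 x = ?b"
    using act_to_base_point[OF x] .
  let ?w = "act a1 a2 v"
  have w: "?w \<in> tangent ?b" using act_tangent[OF a(1,2) v] a(3) by simp
  have "a1 \<in> SU2" "a2 \<in> SU2" using a by (simp_all add: SU2_def)
  then have "pullback (act a1 a2) A x v = A x v"
    using A(2) x v unfolding invariant_on_def connection_eq_on_def by blast
  then have "A x v = A ?b ?w" by (simp add: pullback_linear[OF linear_act] a(3))
  also have "\<dots> = pullback retract_M A ?b ?w"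
    using base_point_simps[OF t] w by (simp add: pullback_retract_M)
  also have "\<dots> = pullback retract_M A ?b (dnorm ?b ?w *\<^sub>R radial_vec +
    (\<Sum>i\<in>UNIV. (etap ?b ?w $ i) *\<^sub>R plus_vec ?t i + (etam ?b ?w $ i) *\<^sub>R minus_vec ?t i))"
    using frame_expansion[OF t w] by simp
  also have "\<dots> = dnorm ?b ?w *\<^sub>R A ?b radial_vec +
    (\<Sum>i\<in>UNIV. (etap ?b ?w $ i) *\<^sub>R A ?b (plus_vec ?t i) + (etam ?b ?w $ i) *\<^sub>R A ?b (minus_vec ?t i))"
  proof -
    have lin: "linear (pullback retract_M A ?b)"
      using smooth_connection_linear[OF A(1)] base_point_simps[OF t] by simp
    have e: "pullback retract_M A ?b u = A ?b u" if "u \<in> tangent ?b" for u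
      using base_point_simps[OF t] that by (simp add: pullback_retract_M)
    show ?thesis
      by (simp add: linear_add[OF lin] linear_scale[OF lin] linear_sum[OF lin] e frame_tangent)
  qed
  finally show "A x v = invariant_form (\<lambda>t. radial_part A t) (\<lambda>i t. plus_part A i t)
      (\<lambda>i t. minus_part A i t) x v"
    using coframe_act[OF a(1,2), of x v] by (simp add: invariant_form_def a(3))
qed

section \<open>The instanton equations\<close>

lemma has_vector_derivative_component:
  "(f has_vector_derivative f') (at t) \<Longrightarrow> ((\<lambda>t. f t $ i) has_real_derivative f' $ i) (at t)"
  unfolding has_real_derivative_iff_has_vector_derivative
  by (rule bounded_linear.has_vector_derivative[OF bounded_linear_vec_nth])

lemma smooth_on_differentiable: "smooth_on f S \<Longrightarrow> x \<in> S \<Longrightarrow> f differentiable (at x)"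
proof -
  assume "smooth_on f S" "x \<in> S"
  then have "Ck_on (Suc 0) f S" "x \<in> S" unfolding smooth_on_def by blast+
  then show ?thesis by simp
qed

lemma frame_component_differentiable:
  assumes A: "smooth_connection_on M A" and t: "t > 0"
  shows "\<exists>d. ((\<lambda>t. radial_part A t) has_vector_derivative d) (at t)"
    "\<exists>d. ((\<lambda>t. plus_part A i t) has_vector_derivative d) (at t)"
    "\<exists>d. ((\<lambda>t. minus_part A i t) has_vector_derivative d) (at t)"
proof -
  define L where "L s v = pullback retract_M A (base_point s) v" for s v
  have V: "base_point s \<in> {x. snd x \<noteq> 0 \<and> retract_M x \<in> M}" if "s > 0" for s
    using base_point_simps[OF that] by (simp add: retract_M_M) (auto simp: base_point_def prod_eq_iff)
  have L_eq: "A (base_point s) v = L s v" if "s > 0" "v \<in> tangent (base_point s)" for s v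
    using that base_point_simps[OF that(1)] by (simp add: L_def pullback_retract_M)
  have lin: "linear (L s)" if "s > 0" for s
    unfolding L_def using smooth_connection_linear[OF A] base_point_simps[OF that] by blast
  have D: "(\<lambda>s. L s v) differentiable (at t)" for v
  proof -
    have "smooth_on (\<lambda>x. pullback retract_M A x v) {x. snd x \<noteq> 0 \<and> retract_M x \<in> M}"
      using A unfolding smooth_connection_on_def Let_def by blast
    then have 1: "(\<lambda>x. pullback retract_M A x v) differentiable (at (base_point t))"
      using V[OF t] by (rule smooth_on_differentiable)
    have "bounded_linear (\<lambda>s. (((s::real), (0::real^3)), (0::quat)))"
      by (intro bounded_linear_Pair bounded_linear_ident bounded_linear_zero)
    then have "((\<lambda>s. ((s, 0), 0) + ((0, 0), (1, 0))) has_derivative (\<lambda>s. (((s::real), (0::real^3)), (0::quat)))) (at t)"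
      by (intro has_derivative_add_const bounded_linear_imp_has_derivative)
    then have "base_point differentiable (at t)"
      unfolding differentiable_def base_point_def[abs_def] by (auto simp: zero_prod_def)
    then show ?thesis
      unfolding L_def using 1 differentiable_chain_at[of base_point t] by (simp add: comp_def)
  qed
  have tr: "\<exists>d. (f has_vector_derivative d) (at t)"
    if g: "g differentiable (at t)" and e: "\<And>s. s > 0 \<Longrightarrow> f s = g s" for f g :: "real \<Rightarrow> real ^ 3"
  proof -
    have "(g has_vector_derivative vector_derivative g (at t)) (at t)"
      using g by (simp add: vector_derivative_works)
    then have "(f has_vector_derivative vector_derivative g (at t)) (at t)"
      by (rule has_vector_derivative_transform_within_open[of _ _ _ "{0<..}"]) (use t e in auto)
    then show ?thesis ..
  qed
  show "\<exists>d. ((\<lambda>t. radial_part A t) has_vector_derivative d) (at t)"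
    by (rule tr[OF D[of radial_vec]]) (simp add: L_eq frame_tangent)
  \<comment> \<open>The frame vectors vary with \<open>s\<close> but are affine in it, so linearity
    reduces the components to values on constant vectors.\<close>
  have p: "plus_vec s i = s *\<^sub>R plus_vec 1 i" for s by (simp add: plus_vec_def)
  have m: "minus_vec s i = s *\<^sub>R plus_vec 1 i + ((0, 0), (0, 2 *\<^sub>R axis i 1))" for s
    by (simp add: plus_vec_def minus_vec_def)
  show "\<exists>d. ((\<lambda>t. plus_part A i t) has_vector_derivative d) (at t)"
  proof (rule tr[of "\<lambda>s. s *\<^sub>R L s (plus_vec 1 i)"])
    show "(\<lambda>s. s *\<^sub>R L s (plus_vec 1 i)) differentiable at t"
      by (intro differentiable_scaleR D differentiable_ident)
    fix s :: real assume "s > 0"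
    then show "plus_part A i s = s *\<^sub>R L s (plus_vec 1 i)"
      using L_eq[OF _ frame_tangent(2)[of s i]] linear_scale[OF lin] p[of s] by simp
  qed
  let ?w = "((0, 0), (0, 2 *\<^sub>R axis i 1)) :: point"
  show "\<exists>d. ((\<lambda>t. minus_part A i t) has_vector_derivative d) (at t)"
  proof (rule tr[of "\<lambda>s. s *\<^sub>R L s (plus_vec 1 i) + L s ?w"])
    show "(\<lambda>s. s *\<^sub>R L s (plus_vec 1 i) + L s ?w) differentiable at t"
      by (intro differentiable_scaleR D differentiable_ident differentiable_add)
    fix s :: real assume "s > 0"
    then show "minus_part A i s = s *\<^sub>R L s (plus_vec 1 i) + L s ?w"
      using L_eq[OF _ frame_tangent(3)[of s i]] linear_scale[OF lin, of s] linear_add[OF lin, of s] m[of s] by simp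
  qed
qed

text \<open>The extra circle rotates the frame index and the value in su(2) by the same angle, so
  the coefficients commute with that rotation.\<close>

lemma frame_component_equivariant:
  assumes A: "smooth_connection_on M A" "invariant_on M A" and t: "t > 0"
  shows "radial_part A t $ 2 = 0 \<and> radial_part A t $ 3 = 0" (is ?a)
    "plus_part A 1 t $ 2 = 0 \<and> plus_part A 1 t $ 3 = 0 \<and> plus_part A 2 t $ 1 = 0" (is ?p)
    "plus_part A 3 t = vector [0, - plus_part A 2 t $ 3, plus_part A 2 t $ 2]" (is ?p')
    "minus_part A 1 t $ 2 = 0 \<and> minus_part A 1 t $ 3 = 0 \<and> minus_part A 2 t $ 1 = 0" (is ?m)
    "minus_part A 3 t = vector [0, - minus_part A 2 t $ 3, minus_part A 2 t $ 2]" (is ?m')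
proof -
  let ?b = "base_point t"
  \<comment> \<open>The adjoint action doubles the angle, so this is a quarter turn of the plane of
    the axes 2 and 3. Commuting with this one rotation already gives all the relations.\<close>
  define u where "u = act_u1 (pi / 4)"
  define R where "R w = (vector [w $ 1, w $ 3, - w $ 2] :: real ^ 3)" for w :: "real ^ 3"
  have R: "Ad (qcnj (u1 (pi / 4))) w = R w" for w
  proof -
    have "2 * (pi / 4) = pi / 2" by simp
    then show ?thesis by (simp only: Ad_u1 R_def sin_pi_half cos_pi_half) simp
  qed
  define a P Q where "a = (\<lambda>t. radial_part A t)" and
    "P = (\<lambda>i t. plus_part A i t)" and "Q = (\<lambda>i t. minus_part A i t)"
  have nf: "norm (fst (u ?b)) = t" using base_point_simps[OF t] by (simp add: u_def act_u1_def)
  have uM: "u ?b \<in> {x \<in> M. fst x \<noteq> 0}"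
  proof -
    have "fst (u ?b) \<noteq> 0" using nf t by (metis less_irrefl norm_zero)
    then show ?thesis using base_point_simps[OF t] by (simp add: u_def act_u1_def M_def)
  qed
  have key: "dnorm ?b v *\<^sub>R a t + (\<Sum>i\<in>UNIV. (R (etap ?b v) $ i) *\<^sub>R P i t + (R (etam ?b v) $ i) *\<^sub>R Q i t) = R (A ?b v)"
    if v: "v \<in> tangent ?b" for v
  proof -
    have "A (u ?b) (u v) = R (A ?b v)"
      using A(2) base_point_simps[OF t] v unfolding invariant_on_def connection_eq_on_def R[symmetric] u_def
      by (simp add: pullback_linear[OF linear_act_u1])
    moreover have "u v \<in> tangent (u ?b)" using v by (simp add: tangent_def u_def act_u1_def)
    then have "A (u ?b) (u v) = invariant_form a P Q (u ?b) (u v)"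
      using invariant_connection_eq[OF A] uM unfolding connection_eq_on_def a_def P_def Q_def by blast
    moreover have "invariant_form a P Q (u ?b) (u v) =
        dnorm ?b v *\<^sub>R a t + (\<Sum>i\<in>UNIV. (R (etap ?b v) $ i) *\<^sub>R P i t + (R (etam ?b v) $ i) *\<^sub>R Q i t)"
      unfolding invariant_form_def nf by (simp add: u_def coframe_act_u1 R)
    ultimately show ?thesis by simp
  qed
  have Rax: "R (axis 1 1) = axis 1 1" "R (axis 2 1) = - axis 3 1" "R (axis 3 1) = axis 2 1" "R 0 = 0"
    by (simp_all add: R_def vec_eq_iff forall_3 axis_def)
  have sum_axis: "(\<Sum>i\<in>UNIV. (axis j 1 $ i) *\<^sub>R F i) = F j" for F :: "3 \<Rightarrow> real ^ 3" and j
    by (simp add: axis_def if_distrib[of "\<lambda>c. c *\<^sub>R _"] cong: if_cong)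
  have aPQ: "A ?b radial_vec = a t" "A ?b (plus_vec t i) = P i t" "A ?b (minus_vec t i) = Q i t" for i
    by (simp_all add: a_def P_def Q_def)
  note simps = coframe_frame[OF t] aPQ Rax sum_axis sum_negf
  have "a t = R (a t)"
    using key[OF frame_tangent(1)] unfolding simps by simp
  moreover have "P 1 t = R (P 1 t)"
    using key[OF frame_tangent(2), of t 1] unfolding simps by (simp add: sum_axis)
  moreover have "- P 3 t = R (P 2 t)"
    using key[OF frame_tangent(2), of t 2] unfolding simps by (simp add: sum_axis sum_negf)
  moreover have "P 2 t = R (P 3 t)"
    using key[OF frame_tangent(2), of t 3] unfolding simps by (simp add: sum_axis)
  moreover have "Q 1 t = R (Q 1 t)"
    using key[OF frame_tangent(3), of t 1] unfolding simps by (simp add: sum_axis)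
  moreover have "- Q 3 t = R (Q 2 t)"
    using key[OF frame_tangent(3), of t 2] unfolding simps by (simp add: sum_axis sum_negf)
  moreover have "Q 2 t = R (Q 3 t)"
    using key[OF frame_tangent(3), of t 3] unfolding simps by (simp add: sum_axis)
  ultimately have e: "a t = R (a t)" "P 1 t = R (P 1 t)" "- P 3 t = R (P 2 t)" "P 2 t = R (P 3 t)"
    "Q 1 t = R (Q 1 t)" "- Q 3 t = R (Q 2 t)" "Q 2 t = R (Q 3 t)"
    by blast+
  show ?a ?p ?p' ?m ?m'
    using e[unfolded R_def vec_eq_iff forall_3 vector_3 vector_uminus_component a_def P_def Q_def]
    unfolding vec_eq_iff forall_3 vector_3
    by (elim conjE; intro conjI; linarith)+
qed

lemma curvature_frame:
  assumes A: "smooth_connection_on M A" "invariant_on M A" and t: "t > 0"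
    and P': "\<And>i. (plus_part A i has_vector_derivative P' i) (at t)"
    and Q': "\<And>i. (minus_part A i has_vector_derivative Q' i) (at t)"
  shows "curvature A (base_point t) [radial_vec, plus_vec t i] = P' i + su2_bracket (radial_part A t) (plus_part A i t)"
      (is ?rp)
    and "curvature A (base_point t) [radial_vec, minus_vec t i] = Q' i + su2_bracket (radial_part A t) (minus_part A i t)"
      (is ?rm)
    and "curvature A (base_point t) [plus_vec t i, plus_vec t j] =
      - 2 *\<^sub>R (\<Sum>k\<in>UNIV. levi_civita i j k *\<^sub>R plus_part A k t) + su2_bracket (plus_part A i t) (plus_part A j t)"
      (is ?pp)
    and "curvature A (base_point t) [minus_vec t i, minus_vec t j] =
      - 2 *\<^sub>R (\<Sum>k\<in>UNIV. levi_civita i j k *\<^sub>R plus_part A k t) + su2_bracket (minus_part A i t) (minus_part A j t)"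
      (is ?mm)
    and "curvature A (base_point t) [plus_vec t i, minus_vec t j] =
      - 2 *\<^sub>R (\<Sum>k\<in>UNIV. levi_civita i j k *\<^sub>R minus_part A k t) + su2_bracket (plus_part A i t) (minus_part A j t)"
      (is ?pm)
    and "curvature A (base_point t) [minus_vec t i, plus_vec t j] =
      - 2 *\<^sub>R (\<Sum>k\<in>UNIV. levi_civita i j k *\<^sub>R minus_part A k t) + su2_bracket (minus_part A i t) (plus_part A j t)"
      (is ?mp)
proof -
  let ?b = "base_point t" and ?a = "radial_part A" and ?P = "plus_part A" and ?Q = "minus_part A"
  obtain a' where a': "(?a has_vector_derivative a') (at t)"
    using frame_component_differentiable(1)[OF A(1) t] by blast
  note [simp] = base_point_simps[OF t] coframe_frame[OF t] frame_tangent
  have s: "(\<Sum>k\<in>UNIV. (axis i 1 $ k) *\<^sub>R F k) = F i" for F :: "3 \<Rightarrow> real ^ 3" and i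
    by (simp add: axis_def if_distrib[of "\<lambda>c. c *\<^sub>R _"] cong: if_cong)
  have f: "invariant_form ?a ?P ?Q ?b radial_vec = ?a t" "invariant_form ?a ?P ?Q ?b (plus_vec t i) = ?P i t"
    "invariant_form ?a ?P ?Q ?b (minus_vec t i) = ?Q i t" for i
    by (simp_all add: invariant_form_def s)
  have n: "(\<Sum>k\<in>UNIV. - ((2 * levi_civita i j k) *\<^sub>R F k)) = - 2 *\<^sub>R (\<Sum>k\<in>UNIV. levi_civita i j k *\<^sub>R F k)"
    for F :: "3 \<Rightarrow> real ^ 3"
    by (simp add: scaleR_sum_right)
  have "norm (fst ?b) = t" by simp
  note curv = curvature_invariant_form[OF invariant_connection_eq[OF A], of ?b, unfolded this, OF _ _ _ _ a' P' Q']
  show ?rp ?rm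
    by (simp_all add: curv f s)
  show ?pp ?mm ?pm ?mp
    by (simp_all add: curv f n[unfolded levi_civita_def] levi_civita_def)
qed

lemma dual_frame_base_point:
  assumes "t > 0"
  shows "dual_frame (dt (base_point t)) (\<lambda>i. eta_plus i (base_point t)) (\<lambda>i. eta_minus i (base_point t))
    radial_vec (plus_vec t) (minus_vec t)"
  using assms base_point_simps[OF assms]
  by (simp add: dual_frame_def eta_eq dt_eq coframe_frame axis_def)

lemma coef_3: "coefA 3 = coefA 2" "coefB 3 = coefB 2"
  by (simp_all add: fun_eq_iff coefA_def coefB_def)

text \<open>The equations for single components contain the uncontrolled radial part
  \<open>a\<close>, which rotates \<open>(z2, z3)\<close> and \<open>(y2, y3)\<close> with the same
  angular velocity. Squared norms and the inner product of the two vectors do not see this rotation,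
  so the right-hand sides are free of \<open>a\<close>.\<close>

lemma instanton_ode:
  assumes A: "G2_instanton_on M A" "invariant_on M A" and t: "t > 0"
    and pos: "\<And>i. coefA i t > 0" "\<And>i. coefB i t > 0"
  defines "b \<equiv> \<lambda>t. plus_part A 1 t $ 1" and "c \<equiv> \<lambda>t. minus_part A 1 t $ 1"
    and "z2 \<equiv> \<lambda>t. plus_part A 2 t $ 2" and "z3 \<equiv> \<lambda>t. plus_part A 2 t $ 3"
    and "y2 \<equiv> \<lambda>t. minus_part A 2 t $ 2" and "y3 \<equiv> \<lambda>t. minus_part A 2 t $ 3"
  shows "(b has_real_derivative coefA 1 t / (coefA 2 t)\<^sup>2 * (b t - ((z2 t)\<^sup>2 + (z3 t)\<^sup>2))
      - coefA 1 t / (coefB 2 t)\<^sup>2 * (b t - ((y2 t)\<^sup>2 + (y3 t)\<^sup>2))) (at t)" (is ?b)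
    and "((\<lambda>t. (z2 t)\<^sup>2 + (z3 t)\<^sup>2) has_real_derivative
      2 * ((1 - b t) / coefA 1 t - coefA 2 t / (coefB 1 t * coefB 2 t)) * ((z2 t)\<^sup>2 + (z3 t)\<^sup>2)
      + 2 * (coefA 2 t / (coefB 1 t * coefB 2 t)) * c t * (z2 t * y2 t + z3 t * y3 t)) (at t)" (is ?z)
    and "((\<lambda>t. (c t)\<^sup>2 + (y2 t)\<^sup>2 + (y3 t)\<^sup>2) has_real_derivative
      4 * (coefB 1 t / (coefA 2 t * coefB 2 t)) * (c t * (z2 t * y2 t + z3 t * y3 t) - (c t)\<^sup>2)
      - 2 * (1 - b t) / coefA 1 t * ((y2 t)\<^sup>2 + (y3 t)\<^sup>2)
      + 2 * (coefB 2 t / (coefB 1 t * coefA 2 t)) * (c t * (z2 t * y2 t + z3 t * y3 t) - ((y2 t)\<^sup>2 + (y3 t)\<^sup>2))) (at t)" (is ?y)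
proof -
  let ?bp = "base_point t"
  have sm: "smooth_connection_on M A" using A(1) by (simp add: G2_instanton_on_def)
  define F where "F = curvature A ?bp"
  obtain P' where P': "\<And>i. (plus_part A i has_vector_derivative P' i) (at t)"
    using frame_component_differentiable(2)[OF sm t] by metis
  obtain Q' where Q': "\<And>i. (minus_part A i has_vector_derivative Q' i) (at t)"
    using frame_component_differentiable(3)[OF sm t] by metis
  note F = curvature_frame[OF sm A(2) t P' Q', folded F_def]
  have v: "radial_part A t = vector [a, 0, 0]" "plus_part A 1 t = vector [b t, 0, 0]"
    "plus_part A 2 t = vector [0, z2 t, z3 t]" "plus_part A 3 t = vector [0, - z3 t, z2 t]"
    "minus_part A 1 t = vector [c t, 0, 0]" "minus_part A 2 t = vector [0, y2 t, y3 t]"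
    "minus_part A 3 t = vector [0, - y3 t, y2 t]" if "a = radial_part A t $ 1" for a
    using frame_component_equivariant[OF sm A(2) t] that
    by (simp_all add: b_def c_def z2_def z3_def y2_def y3_def vec_eq_iff forall_3)
  obtain a where a: "a = radial_part A t $ 1" by blast
  have inst: "wedge 2 F (psi ?bp) vs = 0" if "length vs = 6" "set vs \<subseteq> tangent ?bp" for vs
    using A(1) base_point_simps[OF t] that unfolding G2_instanton_on_def F_def by blast
  note frame = wedge_coassociative_form_dual_frame[OF dual_frame_base_point[OF t],
      of F "\<lambda>i. coefA i (radius ?bp)" "\<lambda>i. coefB i (radius ?bp)", folded psi_eq_coassociative_form,
      unfolded base_point_simps[OF t] coef_3]
  note br = su2_bracket_def cross3_def vec_eq_iff forall_3 vector_3 sum_3 levi_civita_simps v[OF a]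
  obtain A1 A2 B1 B2 where AB: "coefA 1 t = A1" "coefA 2 t = A2" "coefB 1 t = B1" "coefB 2 t = B2" by blast
  have AB0: "A1 > 0" "A2 > 0" "B1 > 0" "B2 > 0" using pos AB by auto
  have e1: "16 * (A2 * (B2 * (A2 * B2))) * (P' 1 $ 1) =
      8 * (B2 * (B2 * A1)) * (2 * b t - 2 * ((z2 t)\<^sup>2 + (z3 t)\<^sup>2))
      - 8 * A1 * A2 * A2 * (2 * b t - 2 * ((y2 t)\<^sup>2 + (y3 t)\<^sup>2))"
    using frame(1) inst[of "[radial_vec, plus_vec t 1, plus_vec t 2, plus_vec t 3, minus_vec t 2, minus_vec t 3]"]
    by (simp add: frame_tangent F br AB power2_eq_square algebra_simps)
  have e2: "16 * (A2 * (B2 * (A2 * B2))) * (Q' 1 $ 1) =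
      16 * (B1 * (B2 * A2)) * (2 * (z2 t * y2 t + z3 t * y3 t) - 2 * c t)"
    using frame(2) inst[of "[radial_vec, minus_vec t 1, plus_vec t 2, plus_vec t 3, minus_vec t 2, minus_vec t 3]"]
    by (simp add: frame_tangent F br AB power2_eq_square algebra_simps)
  have e3: "16 * (A1 * (B1 * (A2 * B2))) * (P' 2 $ 2 - 2 * a * z3 t) =
      16 * (B2 * (B1 * A2)) * (1 - b t) * z2 t - 16 * (A1 * A2 * A2) * (z2 t - c t * y2 t)"
    "16 * (A1 * (B1 * (A2 * B2))) * (P' 2 $ 3 + 2 * a * z2 t) =
      16 * (B2 * (B1 * A2)) * (1 - b t) * z3 t - 16 * (A1 * A2 * A2) * (z3 t - c t * y3 t)"
    using frame(3) inst[of "[radial_vec, plus_vec t 1, minus_vec t 1, plus_vec t 2, plus_vec t 3, minus_vec t 3]"]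
    by (simp_all add: frame_tangent F br AB power2_eq_square algebra_simps)
  have e4: "16 * (A1 * (B1 * (A2 * B2))) * (Q' 2 $ 2 - 2 * a * y3 t) =
      - 16 * (B1 * (B2 * A2)) * (1 - b t) * y2 t - 16 * (B2 * (B2 * A1)) * (y2 t - c t * z2 t)"
    "16 * (A1 * (B1 * (A2 * B2))) * (Q' 2 $ 3 + 2 * a * y2 t) =
      - 16 * (B1 * (B2 * A2)) * (1 - b t) * y3 t - 16 * (B2 * (B2 * A1)) * (y3 t - c t * z3 t)"
    using frame(4) inst[of "[radial_vec, plus_vec t 1, minus_vec t 1, minus_vec t 2, plus_vec t 3, minus_vec t 3]"]
    by (simp_all add: frame_tangent F br AB power2_eq_square algebra_simps)
  note cd = has_vector_derivative_component
  have d: "(b has_real_derivative P' 1 $ 1) (at t)" "(z2 has_real_derivative P' 2 $ 2) (at t)"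
    "(z3 has_real_derivative P' 2 $ 3) (at t)" "(c has_real_derivative Q' 1 $ 1) (at t)"
    "(y2 has_real_derivative Q' 2 $ 2) (at t)" "(y3 has_real_derivative Q' 2 $ 3) (at t)"
    unfolding b_def z2_def z3_def c_def y2_def y3_def by (rule cd[OF P'] cd[OF Q'])+
  have solve: "x = r / k" if "k * x = r" "k > 0" for x r k :: real
    using that by (simp add: field_simps)
  have k: "16 * (A2 * (B2 * (A2 * B2))) > 0" "16 * (A1 * (B1 * (A2 * B2))) > 0" using AB0 by simp_all
  have s1: "P' 1 $ 1 = A1 / A2\<^sup>2 * (b t - ((z2 t)\<^sup>2 + (z3 t)\<^sup>2)) - A1 / B2\<^sup>2 * (b t - ((y2 t)\<^sup>2 + (y3 t)\<^sup>2))"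
    unfolding solve[OF e1 k(1)] using AB0 by (simp add: field_simps power2_eq_square)
  have s2: "Q' 1 $ 1 = 2 * (B1 / (A2 * B2)) * (z2 t * y2 t + z3 t * y3 t - c t)"
    unfolding solve[OF e2 k(1)] using AB0 by (simp add: field_simps power2_eq_square)
  have s3: "P' 2 $ 2 - 2 * a * z3 t = (1 - b t) / A1 * z2 t - A2 / (B1 * B2) * (z2 t - c t * y2 t)"
    "P' 2 $ 3 + 2 * a * z2 t = (1 - b t) / A1 * z3 t - A2 / (B1 * B2) * (z3 t - c t * y3 t)"
    unfolding solve[OF e3(1) k(2)] solve[OF e3(2) k(2)] using AB0 by (simp_all add: field_simps power2_eq_square)
  have s4: "Q' 2 $ 2 - 2 * a * y3 t = - (1 - b t) / A1 * y2 t - B2 / (B1 * A2) * (y2 t - c t * z2 t)"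
    "Q' 2 $ 3 + 2 * a * y2 t = - (1 - b t) / A1 * y3 t - B2 / (B1 * A2) * (y3 t - c t * z3 t)"
    unfolding solve[OF e4(1) k(2)] solve[OF e4(2) k(2)] using AB0 by (simp_all add: field_simps power2_eq_square)
  \<comment> \<open>Pairing each derivative with its own vector cancels the terms in
    \<open>a\<close>, so they may be inserted to match \<open>s3\<close>; the same device serves
    \<open>sy\<close> with \<open>s4\<close>.\<close>
  have sz: "2 * (z2 t * P' 2 $ 2 + z3 t * P' 2 $ 3) =
      2 * ((1 - b t) / A1 - A2 / (B1 * B2)) * ((z2 t)\<^sup>2 + (z3 t)\<^sup>2)
      + 2 * (A2 / (B1 * B2)) * c t * (z2 t * y2 t + z3 t * y3 t)"
  proof -
    have "2 * (z2 t * P' 2 $ 2 + z3 t * P' 2 $ 3) =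
        2 * (z2 t * (P' 2 $ 2 - 2 * a * z3 t) + z3 t * (P' 2 $ 3 + 2 * a * z2 t))"
      by algebra
    then show ?thesis
      unfolding s3 by (rule trans) (use AB0 in \<open>simp add: field_simps power2_eq_square\<close>)
  qed
  have sy: "2 * (c t * Q' 1 $ 1 + y2 t * Q' 2 $ 2 + y3 t * Q' 2 $ 3) =
      4 * (B1 / (A2 * B2)) * (c t * (z2 t * y2 t + z3 t * y3 t) - (c t)\<^sup>2)
      - 2 * (1 - b t) / A1 * ((y2 t)\<^sup>2 + (y3 t)\<^sup>2)
      + 2 * (B2 / (B1 * A2)) * (c t * (z2 t * y2 t + z3 t * y3 t) - ((y2 t)\<^sup>2 + (y3 t)\<^sup>2))"
  proof -
    have "2 * (c t * Q' 1 $ 1 + y2 t * Q' 2 $ 2 + y3 t * Q' 2 $ 3) =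
        2 * (c t * Q' 1 $ 1 + y2 t * (Q' 2 $ 2 - 2 * a * y3 t) + y3 t * (Q' 2 $ 3 + 2 * a * y2 t))"
      by algebra
    then show ?thesis
      unfolding s2 s4 by (rule trans) (use AB0 in \<open>simp add: field_simps power2_eq_square\<close>)
  qed
  show ?b unfolding AB using d(1) s1 by simp
  show ?z unfolding AB sz[symmetric]
    by (rule derivative_eq_intros d refl | simp)+
  show ?y unfolding AB sy[symmetric]
    by (rule derivative_eq_intros d refl | simp)+
qed

section \<open>The BGGG radial coordinate\<close>

abbreviation bggg_dt :: "real \<Rightarrow> real"
  where "bggg_dt s \<equiv> sqrt ((s - 3/4) * (s + 3/4)) / sqrt ((s - 9/4) * (s + 9/4))"

text \<open>The integrand is a continuous function \<open>m\<close> times the singular factor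
  \<open>k\<close>, whose primitive 2 sqrt (s - 9/4) is continuous up to the endpoint.\<close>

lemma bggg_dt_integrable:
  assumes "9/4 \<le> r"
  shows "bggg_dt integrable_on {9/4..r}"
proof -
  define k where "k s = 1 / sqrt (s - 9/4)" for s :: real
  define m where "m s = sqrt ((s - 3/4) * (s + 3/4)) / sqrt (s + 9/4)" for s :: real
  have "(k has_integral (2 * sqrt (r - 9/4) - 2 * sqrt (9/4 - 9/4))) {9/4..r}"
  proof (rule fundamental_theorem_of_calculus_interior[OF assms])
    show "continuous_on {9/4..r} (\<lambda>s. 2 * sqrt (s - 9/4))" by (intro continuous_intros)
    fix s assume "s \<in> {9/4<..<r}"
    then show "((\<lambda>s. 2 * sqrt (s - 9/4)) has_vector_derivative k s) (at s)"
      unfolding has_real_derivative_iff_has_vector_derivative[symmetric] k_def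
      by (auto intro!: derivative_eq_intros simp: field_simps)
  qed
  then have "k integrable_on {9/4..r}" by blast
  then have k: "k absolutely_integrable_on {9/4..r}"
    by (rule nonnegative_absolutely_integrable_1) (simp add: k_def)
  have m: "continuous_on {9/4..r} m"
    unfolding m_def by (intro continuous_intros) auto
  have "(\<lambda>s. m s * k s) absolutely_integrable_on {9/4..r}"
  proof (rule absolutely_integrable_bounded_measurable_product_real[OF _ _ _ k])
    show "m \<in> borel_measurable (lebesgue_on {9/4..r})"
      by (rule continuous_imp_measurable_on_sets_lebesgue[OF m]) simp
    show "bounded (m ` {9/4..r})"
      by (intro compact_imp_bounded compact_continuous_image m) simp
  qed simp
  moreover have "(\<lambda>s. m s * k s) = bggg_dt"
    by (simp add: fun_eq_iff m_def k_def real_sqrt_mult mult.commute)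
  ultimately show ?thesis by (simp add: absolutely_integrable_on_def)
qed

lemma continuous_on_bggg_t: "continuous_on {9/4..} bggg_t"
proof -
  have "continuous (at r within {9/4..}) bggg_t" if "9/4 \<le> r" for r
  proof -
    have "continuous_on {9/4..r + 1} bggg_t"
      unfolding bggg_t_def using that by (intro indefinite_integral_continuous_1 bggg_dt_integrable) simp
    then have "continuous (at r within {9/4..r + 1}) bggg_t"
      using that by (simp add: continuous_on_eq_continuous_within)
    moreover have "at r within {9/4..r + 1} = at r within {9/4..}"
      by (rule at_within_nhd[of r "{..<r + 1}"]) auto
    ultimately show ?thesis by simp
  qed
  then show ?thesis by (simp add: continuous_on_eq_continuous_within)
qed

lemma has_real_derivative_bggg_t:
  assumes "9/4 < r"
  shows "(bggg_t has_real_derivative bggg_dt r) (at r)"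
proof -
  have "continuous (at r within {9/4..r + 1}) bggg_dt"
    using assms by (intro continuous_intros) auto
  then have "((\<lambda>u. integral {9/4..u} bggg_dt) has_vector_derivative bggg_dt r) (at r within {9/4..r + 1})"
    using integral_has_vector_derivative_continuous_at[OF bggg_dt_integrable, of "r + 1" r "{}"] assms by simp
  moreover have "at r within {9/4..r + 1} = at r"
    using assms by (intro at_within_interior) simp
  ultimately show ?thesis
    by (simp add: has_real_derivative_iff_has_vector_derivative bggg_t_def[abs_def])
qed

lemma bggg_dt_gt_1: "9/4 < r \<Longrightarrow> 1 < bggg_dt r"
proof -
  assume r: "9/4 < r"
  then have "0 < (r - 9/4) * (r + 9/4)" by simp
  moreover have "(r - 9/4) * (r + 9/4) < (r - 3/4) * (r + 3/4)" by (simp add: algebra_simps)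
  ultimately show ?thesis by (simp only: less_divide_eq_1_pos real_sqrt_gt_zero real_sqrt_less_iff)
qed

text \<open>The integrand exceeds 1, so \<open>bggg_t r - r\<close> increases. This quantitative
  form yields injectivity and unboundedness of \<open>bggg_t\<close> at once.\<close>

lemma bggg_t_less:
  assumes "9/4 \<le> r" "r < s"
  shows "s - r < bggg_t s - bggg_t r"
proof -
  have "bggg_t r - r < bggg_t s - s"
  proof (rule DERIV_pos_imp_increasing_open[OF assms(2)])
    fix x assume x: "r < x" "x < s"
    have "((\<lambda>x. bggg_t x - x) has_real_derivative bggg_dt x - 1) (at x)"
      using x assms by (intro derivative_intros has_real_derivative_bggg_t) simp
    then show "\<exists>y. ((\<lambda>x. bggg_t x - x) has_real_derivative y) (at x) \<and> 0 < y"
      using bggg_dt_gt_1[of x] x assms by auto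
  next
    show "continuous_on {r..s} (\<lambda>x. bggg_t x - x)"
      using assms by (intro continuous_intros continuous_on_subset[OF continuous_on_bggg_t]) auto
  qed
  then show ?thesis by simp
qed

lemma bggg_t_start: "bggg_t (9/4) = 0"
  by (simp add: bggg_t_def)

lemma inj_on_bggg_t: "inj_on bggg_t {9/4..}"
proof (rule linorder_inj_onI)
  fix x y :: real assume "x < y" "x \<in> {9/4..}"
  then show "bggg_t x \<noteq> bggg_t y" using bggg_t_less[of x y] by simp
qed auto

lemma bggg_r_bggg_t: "9/4 \<le> r \<Longrightarrow> bggg_r (bggg_t r) = r"
  unfolding bggg_r_def by (rule inv_into_f_f[OF inj_on_bggg_t]) simp

lemma bggg_t_surj:
  assumes "0 \<le> t"
  obtains r where "9/4 \<le> r" "bggg_t r = t"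
proof -
  have "t \<le> bggg_t (9/4 + t)"
    using bggg_t_less[of "9/4" "9/4 + t"] assms by (cases "t = 0") (auto simp: bggg_t_start)
  then have "\<exists>r\<ge>9/4. r \<le> 9/4 + t \<and> bggg_t r = t"
    using assms by (intro IVT') (auto simp: bggg_t_start intro: continuous_on_subset[OF continuous_on_bggg_t])
  then show thesis using that by blast
qed

lemma bggg_t_bggg_r: "0 \<le> t \<Longrightarrow> bggg_t (bggg_r t) = t"
  by (erule bggg_t_surj) (auto simp: bggg_r_bggg_t)

lemma bggg_r_gt: "0 < t \<Longrightarrow> 9/4 < bggg_r t"
proof -
  assume t: "0 < t"
  obtain r where r: "9/4 \<le> r" "bggg_t r = t" using bggg_t_surj[of t] t by auto
  then have "r \<noteq> 9/4" using t bggg_t_start by (metis less_irrefl)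
  then show ?thesis using r bggg_r_bggg_t[OF r(1)] by simp
qed

lemma bggg_r_le_iff:
  assumes "0 < t" "9/4 \<le> r"
  shows "bggg_r t \<le> r \<longleftrightarrow> t \<le> bggg_t r"
  using bggg_t_less[of "bggg_r t" r] bggg_t_less[of r "bggg_r t"] bggg_r_gt[of t] bggg_t_bggg_r[of t] assms
  by (cases "bggg_r t" r rule: linorder_cases) auto

text \<open>\<open>coefA 1\<close> is the reciprocal of the integrand of \<open>bggg_t\<close>. The
  margin \<open>a\<close> keeps the inverse function argument away from 9/4, where the integrand is
  unbounded.\<close>

lemma has_real_derivative_bggg_r:
  assumes "0 < t"
  shows "(bggg_r has_real_derivative coefA 1 t) (at t)"
proof -
  define r where "r = bggg_r t"
  have r: "9/4 < r" "bggg_t r = t" using bggg_r_gt[OF assms] bggg_t_bggg_r assms by (auto simp: r_def)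
  obtain a where a: "9/4 < a" "a < r" using dense r(1) by blast
  have "isCont bggg_r (bggg_t r)"
  proof (rule isCont_inverse_function2[of a r "r + 1"])
    fix z assume "a \<le> z" "z \<le> r + 1"
    then show "bggg_r (bggg_t z) = z" "isCont bggg_t z"
      using a bggg_r_bggg_t[of z] DERIV_isCont[OF has_real_derivative_bggg_t[of z]] by auto
  qed (use a in auto)
  then have "(bggg_r has_real_derivative inverse (bggg_dt r)) (at t)"
    using assms r bggg_dt_gt_1[OF r(1)]
    by (intro DERIV_inverse_function[where f = bggg_t and a = 0 and b = "t + 1"])
      (auto simp: r_def[symmetric] bggg_t_bggg_r intro: has_real_derivative_bggg_t)
  then show ?thesis by (simp add: coefA_def Let_def r_def)
qed

lemma bggg_r_tendsto: "(bggg_r \<longlongrightarrow> 9/4) (at_right 0)"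
proof (rule order_tendstoI)
  fix a :: real assume "a < 9/4"
  then show "eventually (\<lambda>t. a < bggg_r t) (at_right 0)"
    using eventually_at_right_less[of 0] by (auto elim!: eventually_mono dest!: bggg_r_gt)
next
  fix a :: real assume a: "9/4 < a"
  define s where "s = (9/4 + a) / 2"
  have s: "9/4 < s" "s < a" using a by (simp_all add: s_def)
  have "0 < bggg_t s" using bggg_t_less[of "9/4" s] s by (simp add: bggg_t_start)
  then have "eventually (\<lambda>t. t < bggg_t s) (at_right 0)" by (auto simp: eventually_at_right_field)
  moreover have "eventually (\<lambda>t. t > 0) (at_right (0::real))" by (simp add: eventually_at_right_less)
  ultimately show "eventually (\<lambda>t. bggg_r t < a) (at_right 0)"
  proof eventually_elim
    case (elim t)
    then show ?case using bggg_r_le_iff[of t s] s by auto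
  qed
qed

lemma bggg_r_unbounded: "\<exists>T>0. \<forall>t\<ge>T. R \<le> bggg_r t"
proof -
  define R' where "R' = max R (9/4 + 1)"
  have R': "9/4 < R'" by (simp add: R'_def)
  then have "0 < bggg_t R'" using bggg_t_less[of "9/4" R'] by (simp add: bggg_t_start)
  moreover have "R \<le> bggg_r t" if "t \<ge> bggg_t R'" for t
  proof (rule ccontr)
    assume "\<not> R \<le> bggg_r t"
    then have "bggg_r t < R'" by (simp add: R'_def)
    moreover have "0 < t" using that \<open>0 < bggg_t R'\<close> by simp
    ultimately have "bggg_t (bggg_r t) < bggg_t R'"
      using bggg_t_less[of "bggg_r t" R'] bggg_r_gt[of t] by simp
    then show False using that \<open>0 < t\<close> by (simp add: bggg_t_bggg_r)
  qed
  ultimately show ?thesis by blast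
qed

section \<open>The metric coefficients and their derivatives\<close>

lemma coef_pos:
  assumes "0 < t"
  shows "0 < coefA i t" "0 < coefB i t"
  using bggg_r_gt[OF assms] by (simp_all add: coefA_def coefB_def Let_def)

lemma coef_sq:
  assumes "0 < t"
  defines "r \<equiv> bggg_r t"
  shows "(coefA 1 t)\<^sup>2 = (r - 9/4) * (r + 9/4) / ((r - 3/4) * (r + 3/4))"
    "(coefA 2 t)\<^sup>2 = (r - 9/4) * (r + 3/4) / 3" "(coefB 2 t)\<^sup>2 = (r - 3/4) * (r + 9/4) / 3" "coefB 1 t = 2 * r / 3"
  using bggg_r_gt[OF assms(1)] by (simp_all add: coefA_def coefB_def Let_def r_def power_divide)

text \<open>Opaque names for the four linear factors let algebraic simplification treat them as
  positive atoms instead of multiplying them out.\<close>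

lemma coef_factors:
  assumes "0 < t"
  obtains r x1 x2 x3 x4 where "bggg_r t = r" "9/4 < r"
    "r - 9/4 = x1" "r + 9/4 = x2" "r - 3/4 = x3" "r + 3/4 = x4" "x1 > 0" "x2 > 0" "x3 > 0" "x4 > 0"
    "(coefA 1 t)\<^sup>2 = x1 * x2 / (x3 * x4)" "(coefA 2 t)\<^sup>2 = x1 * x4 / 3" "(coefB 2 t)\<^sup>2 = x3 * x2 / 3"
    "coefB 1 t = 2 * r / 3"
  using that coef_sq[OF assms] bggg_r_gt[OF assms] by auto

lemma coefA_1_less_1: "0 < t \<Longrightarrow> coefA 1 t < 1"
  using bggg_dt_gt_1[OF bggg_r_gt[of t]] bggg_r_gt[of t]
  by (simp add: coefA_def Let_def divide_simps split: if_splits)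

text \<open>The rate on the right is the coefficient of \<open>b\<close> in its own equation when P
  = 0. So the square of \<open>coefA 1\<close> solves the abelian equation, and dividing
  \<open>b\<close> by it leaves only the nonlinear term, which has a sign.\<close>

lemma has_real_derivative_coefA_1_sq:
  assumes "0 < t"
  shows "((\<lambda>t. (coefA 1 t)\<^sup>2) has_real_derivative
    (coefA 1 t)\<^sup>2 * (coefA 1 t / (coefA 2 t)\<^sup>2 - coefA 1 t / (coefB 2 t)\<^sup>2)) (at t)"
proof -
  define r where "r = bggg_r t"
  have r: "9/4 < r" using bggg_r_gt[OF assms] by (simp add: r_def)
  let ?h = "\<lambda>r::real. (r - 9/4) * (r + 9/4) / ((r - 3/4) * (r + 3/4))"
  have 1: "(?h has_real_derivative 9 * r / ((r - 3/4) * (r + 3/4))\<^sup>2) (at r)"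
  proof -
    have g: "(r - 3/4) * (r + 3/4) \<noteq> 0" using r by simp
    have "((\<lambda>r. (r - 9/4) * (r + 9/4)) has_real_derivative 2 * r) (at r)"
      "((\<lambda>r. (r - 3/4) * (r + 3/4)) has_real_derivative 2 * r) (at r)"
      by (auto intro!: derivative_eq_intros)
    from DERIV_divide[OF this g] show ?thesis
    proof (rule DERIV_cong)
      have "2 * r * ((r - 3/4) * (r + 3/4)) - (r - 9/4) * (r + 9/4) * (2 * r) = 9 * r"
        by (simp add: algebra_simps)
      then show "(2 * r * ((r - 3/4) * (r + 3/4)) - (r - 9/4) * (r + 9/4) * (2 * r)) /
          ((r - 3/4) * (r + 3/4) * ((r - 3/4) * (r + 3/4))) = 9 * r / ((r - 3/4) * (r + 3/4))\<^sup>2"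
        by (simp only: power2_eq_square)
    qed
  qed
  have "((\<lambda>t. ?h (bggg_r t)) has_real_derivative 9 * r / ((r - 3/4) * (r + 3/4))\<^sup>2 * coefA 1 t) (at t)"
    using DERIV_chain2[OF 1[unfolded r_def] has_real_derivative_bggg_r[OF assms]] by (simp add: r_def)
  then have "((\<lambda>t. (coefA 1 t)\<^sup>2) has_real_derivative 9 * r / ((r - 3/4) * (r + 3/4))\<^sup>2 * coefA 1 t) (at t)"
    by (rule has_field_derivative_transform_within_open[of _ _ _ "{0<..}"]) (use assms in \<open>auto simp: coef_sq\<close>)
  moreover have "9 * r / ((r - 3/4) * (r + 3/4))\<^sup>2 * coefA 1 t =
      ?h r * (coefA 1 t / ((r - 9/4) * (r + 3/4) / 3) - coefA 1 t / ((r - 3/4) * (r + 9/4) / 3))"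
  proof -
    have "r - 3/4 > 0" "r + 3/4 > 0" "r - 9/4 > 0" "r + 9/4 > 0" using r by simp_all
    moreover obtain a b c d where e: "a = r - 3/4" "b = r + 3/4" "c = r - 9/4" "d = r + 9/4" by blast
    moreover have "9 * r = 3 * (a * d - c * b)" unfolding e by (simp add: field_simps)
    ultimately show ?thesis
      unfolding e[symmetric] by (simp add: divide_simps power2_eq_square) (simp add: algebra_simps)
  qed
  ultimately show ?thesis
    by (simp add: coef_sq[OF assms] r_def[symmetric])
qed

section \<open>Growth of solutions\<close>

text \<open>Integrating factor exp (- I). As \<open>u\<close> may have either sign, the lemma can
  also be applied to a negated function, which is how \<open>P_eq_0\<close> propagates vanishing
  backwards.\<close>

lemma gronwall:
  fixes u u' k :: "real \<Rightarrow> real"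
  assumes "s \<le> T" and u: "\<And>x. s \<le> x \<Longrightarrow> x \<le> T \<Longrightarrow> (u has_real_derivative u' x) (at x)"
    and k: "continuous_on {s..T} k" and le: "\<And>x. s \<le> x \<Longrightarrow> x \<le> T \<Longrightarrow> u' x \<le> k x * u x"
  shows "u T \<le> u s * exp (integral {s..T} k)"
proof -
  define I where "I x = integral {s..x} k" for x
  have "u T * exp (- I T) \<le> u s * exp (- I s)"
  proof (rule DERIV_nonpos_imp_decreasing_open[OF assms(1)])
    fix x assume x: "s < x" "x < T"
    have "(I has_real_derivative k x) (at x within {s..T})"
      unfolding I_def using k x by (intro integral_has_real_derivative) auto
    moreover have "at x within {s..T} = at x" using x by (intro at_within_interior) simp
    ultimately have "(I has_real_derivative k x) (at x)" by simp
    then have "((\<lambda>x. u x * exp (- I x)) has_real_derivative (u' x - k x * u x) * exp (- I x)) (at x)"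
      using u[of x] x by (auto intro!: derivative_eq_intros simp: algebra_simps)
    moreover have "(u' x - k x * u x) * exp (- I x) \<le> 0"
      using le[of x] x by (intro mult_nonpos_nonneg) auto
    ultimately show "\<exists>y. ((\<lambda>x. u x * exp (- I x)) has_real_derivative y) (at x) \<and> y \<le> 0" by blast
  next
    have "continuous_on {s..T} I"
      unfolding I_def by (intro indefinite_integral_continuous_1 integrable_continuous_real k)
    moreover have "continuous_on {s..T} u"
      using DERIV_isCont[OF u] by (auto intro!: continuous_at_imp_continuous_on)
    ultimately show "continuous_on {s..T} (\<lambda>x. u x * exp (- I x))" by (intro continuous_intros)
  qed
  then show ?thesis by (simp add: I_def exp_minus field_simps)
qed

lemma riccati_no_global_solution:
  fixes \<phi> \<phi>' :: "real \<Rightarrow> real"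
  assumes "\<And>t. t \<ge> T \<Longrightarrow> (\<phi> has_real_derivative \<phi>' t) (at t)" "\<And>t. t \<ge> T \<Longrightarrow> \<phi>' t \<ge> k * (\<phi> t)\<^sup>2"
    and "\<phi> T > 0" "k > 0"
  shows False
proof -
  have pos: "\<phi> t > 0" if "t \<ge> T" for t
  proof -
    have "\<phi> T \<le> \<phi> t"
    proof (rule DERIV_nonneg_imp_nondecreasing[OF that])
      fix x assume x: "T \<le> x" "x \<le> t"
      have "0 \<le> \<phi>' x" using assms(2)[OF x(1)] assms(4) by (smt (verit) mult_nonneg_nonneg zero_le_power2)
      then show "\<exists>y. (\<phi> has_real_derivative y) (at x) \<and> 0 \<le> y" using assms(1)[OF x(1)] by blast
    qed
    then show ?thesis using assms(3) by simp
  qed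
  \<comment> \<open>The blow-up time of the exact solution of y' = k y^2 with the same value at
    \<open>T\<close>; there the bound on 1 / \<open>\<phi>\<close> + k t leaves no room for a
    positive 1 / \<open>\<phi>\<close>.\<close>
  define t where "t = T + 1 / (k * \<phi> T)"
  have t: "T \<le> t" using assms by (simp add: t_def)
  have "1 / \<phi> t + k * t \<le> 1 / \<phi> T + k * T"
  proof (rule DERIV_nonpos_imp_nonincreasing[OF t])
    fix x assume x: "T \<le> x" "x \<le> t"
    have "((\<lambda>x. 1 / \<phi> x + k * x) has_real_derivative - \<phi>' x / (\<phi> x)\<^sup>2 + k) (at x)"
      using assms(1)[OF x(1)] pos[OF x(1)] by (auto intro!: derivative_eq_intros simp: power2_eq_square)
    moreover have "k \<le> \<phi>' x / (\<phi> x)\<^sup>2"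
      using assms(2)[OF x(1)] pos[OF x(1)] by (simp add: pos_le_divide_eq)
    ultimately show "\<exists>y. ((\<lambda>x. 1 / \<phi> x + k * x) has_real_derivative y) (at x) \<and> y \<le> 0"
      by (intro exI conjI) auto
  qed
  moreover have "k * t = k * T + 1 / \<phi> T" using assms by (simp add: t_def field_simps)
  moreover have "0 < 1 / \<phi> t" using pos[OF t] by simp
  ultimately show False by simp
qed

text \<open>Half the logarithmic derivative of p apart from the term with F: the first two summands
  come from the equation for P, the third is half the logarithmic derivative of the square of
  \<open>coefA 2\<close>. For the ansatz it is the linear coefficient in g' =
  \<open>growth_rate\<close> g - f g.\<close>

definition growth_rate :: "real \<Rightarrow> real"
  where "growth_rate t = 1 / coefA 1 t - coefA 2 t / (coefB 1 t * coefB 2 t)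
    - coefA 1 t * (bggg_r t - 3/4) / ((bggg_r t - 9/4) * (bggg_r t + 3/4))"

lemma growth_rate_eq:
  assumes t: "0 < t"
  shows "growth_rate t = (let r = bggg_r t in
    (1 - 3 * (r - 9/4) / (2 * r * (r - 3/4)) - (r + 9/4) / (r + 3/4)\<^sup>2) / coefA 1 t)"
proof -
  obtain r x1 x2 x3 x4 where r: "bggg_r t = r" "9/4 < r"
    and x: "r - 9/4 = x1" "r + 9/4 = x2" "r - 3/4 = x3" "r + 3/4 = x4"
    and x0: "x1 > 0" "x2 > 0" "x3 > 0" "x4 > 0" and sq: "(coefA 1 t)\<^sup>2 = x1 * x2 / (x3 * x4)"
      "(coefA 2 t)\<^sup>2 = x1 * x4 / 3" "(coefB 2 t)\<^sup>2 = x3 * x2 / 3" "coefB 1 t = 2 * r / 3"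
    by (rule coef_factors[OF t])
  obtain A1 A2 B2 where AB: "coefA 1 t = A1" "coefA 2 t = A2" "coefB 2 t = B2" by blast
  have A0: "A1 > 0" "A2 > 0" "B2 > 0" using coef_pos[OF t] AB by metis+
  note sq = sq[unfolded AB]
  \<comment> \<open>This relation between the three square roots makes \<open>growth_rate\<close> a
    rational function of \<open>r\<close> divided by \<open>A1\<close>.\<close>
  have "(A2 * B2)\<^sup>2 = (A1 * (x3 * x4 / 3))\<^sup>2"
    unfolding power_mult_distrib sq using x0 by (simp add: power2_eq_square field_simps)
  then have AB2: "A2 * B2 = A1 * (x3 * x4 / 3)"
    using A0 x0 by (simp add: power2_eq_iff_nonneg)
  have "A2 / (coefB 1 t * B2) = A2\<^sup>2 / (coefB 1 t * (A2 * B2))"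
    using A0 by (simp add: power2_eq_square)
  also have "\<dots> = 3 * x1 / (2 * r * x3) / A1"
    unfolding AB2 sq using A0 x0 r by (simp add: field_simps)
  finally have 1: "A2 / (coefB 1 t * B2) = 3 * x1 / (2 * r * x3) / A1" .
  have "A1 * x3 / (x1 * x4) = A1\<^sup>2 * x3 / (x1 * x4) / A1" using A0 by (simp add: power2_eq_square)
  also have "\<dots> = x2 / x4\<^sup>2 / A1" unfolding sq using A0 x0 by (simp add: field_simps power2_eq_square)
  finally have 2: "A1 * x3 / (x1 * x4) = x2 / x4\<^sup>2 / A1" .
  show ?thesis
    unfolding growth_rate_def AB Let_def r(1) x 1 2 by (simp add: diff_divide_distrib)
qed

text \<open>The two corrections to 1 in \<open>growth_rate_eq\<close> are at most 2 / r each, and r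
  at least 8 / \<open>\<delta>\<close> makes their sum at most \<open>\<delta>\<close> / 2. Dividing
  by \<open>coefA 1\<close>, which is below 1, only helps.\<close>

lemma growth_rate_ge:
  assumes t: "0 < t" and r: "bggg_r t \<ge> 8 / \<delta>" and \<delta>: "0 < \<delta>" "\<delta> \<le> 1"
  shows "growth_rate t \<ge> 1 - \<delta> / 2"
proof -
  define r where "r = bggg_r t"
  have r94: "9/4 < r" using bggg_r_gt[OF t] by (simp add: r_def)
  have "3 * (r - 9/4) / (2 * r * (r - 3/4)) \<le> 2 / r"
    using r94 by (simp add: field_simps)
  moreover have "(r + 9/4) / (r + 3/4)\<^sup>2 \<le> 2 / r"
  proof -
    have "(r + 9/4) * r \<le> 2 * (r + 3/4)\<^sup>2" using r94 by (simp add: power2_eq_square algebra_simps)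
    then have "(r + 9/4) / (r + 3/4)\<^sup>2 * r \<le> 2" using r94 by (simp add: pos_divide_le_eq)
    then show ?thesis using r94 by (simp add: pos_le_divide_eq)
  qed
  moreover have "4 / r \<le> \<delta> / 2" using assms(2) \<delta> r94 by (simp add: r_def[symmetric] field_simps)
  ultimately have q: "1 - \<delta> / 2 \<le> 1 - 3 * (r - 9/4) / (2 * r * (r - 3/4)) - (r + 9/4) / (r + 3/4)\<^sup>2" (is "_ \<le> ?q")
    by simp
  have "?q * 1 \<le> ?q * (1 / coefA 1 t)"
    using q \<delta> coefA_1_less_1[OF t] coef_pos[OF t, of 1] by (intro mult_left_mono) auto
  then show ?thesis using q unfolding growth_rate_eq[OF t] Let_def r_def[symmetric] by simp
qed

text \<open>Linear parts compared: without the nonlinear terms f is a multiple of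
  \<open>coefA 1\<close>, whose logarithmic derivative stands on the left, and g grows at
  \<open>growth_rate\<close>. So the linear terms alone cannot increase f / g.\<close>

lemma growth_rate_ge_log_deriv:
  assumes t: "0 < t"
  shows "(coefA 1 t / (coefA 2 t)\<^sup>2 - coefA 1 t / (coefB 2 t)\<^sup>2) / 2 \<le> growth_rate t"
proof -
  obtain r x1 x2 x3 x4 where r: "bggg_r t = r" "9/4 < r"
    and x: "r - 9/4 = x1" "r + 9/4 = x2" "r - 3/4 = x3" "r + 3/4 = x4"
    and x0: "x1 > 0" "x2 > 0" "x3 > 0" "x4 > 0" and sq: "(coefA 1 t)\<^sup>2 = x1 * x2 / (x3 * x4)"
      "(coefA 2 t)\<^sup>2 = x1 * x4 / 3" "(coefB 2 t)\<^sup>2 = x3 * x2 / 3" "coefB 1 t = 2 * r / 3"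
    by (rule coef_factors[OF t])
  obtain A1 where A1: "coefA 1 t = A1" by blast
  have A0: "A1 > 0" using coef_pos[OF t] A1 by metis
  note sq = sq[unfolded A1]
  have "(A1 / (x1 * x4 / 3) - A1 / (x3 * x2 / 3)) / 2 = A1\<^sup>2 * (3 * (x3 * x2 - x1 * x4)) / (2 * (x1 * x2 * x3 * x4)) / A1"
    using A0 x0 by (simp add: field_simps power2_eq_square)
  also have "3 * (x3 * x2 - x1 * x4) = 9 * r" unfolding x[symmetric] by (simp add: field_simps)
  also have "A1\<^sup>2 * (9 * r) / (2 * (x1 * x2 * x3 * x4)) / A1 = 9 * r / (2 * (x3\<^sup>2 * x4\<^sup>2)) / A1"
    unfolding sq using A0 x0 by (simp add: field_simps power2_eq_square)
  finally have 1: "(coefA 1 t / (coefA 2 t)\<^sup>2 - coefA 1 t / (coefB 2 t)\<^sup>2) / 2 = 9 * r / (2 * (x3\<^sup>2 * x4\<^sup>2)) / A1"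
    unfolding sq A1 .
  have "0 \<le> 1 - 3 * x1 / (2 * r * x3) - x2 / x4\<^sup>2 - 9 * r / (2 * (x3\<^sup>2 * x4\<^sup>2))"
  proof -
    \<comment> \<open>Expanded around the endpoint r = 9/4, the cleared numerator is a polynomial in
      \<open>w\<close> with positive coefficients and no constant term.\<close>
    define w where "w = x1"
    have w: "w > 0" "r = 9/4 + w" using x0 x by (auto simp: w_def)
    have "2 * r * x3\<^sup>2 * x4\<^sup>2 - 3 * x1 * x3 * x4\<^sup>2 - 2 * r * x2 * x3\<^sup>2 - 9 * r\<^sup>2
        = 405/8 * w + 675/8 * w^2 + 57 * w^3 + 35/2 * w^4 + 2 * w^5"
      unfolding x[symmetric] w(2) by (simp add: field_simps power2_eq_square power3_eq_cube power4_eq_xxxx eval_nat_numeral)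
    then have "0 \<le> 2 * r * x3\<^sup>2 * x4\<^sup>2 - 3 * x1 * x3 * x4\<^sup>2 - 2 * r * x2 * x3\<^sup>2 - 9 * r\<^sup>2"
      using w(1) by simp
    then have "0 \<le> (2 * r * x3\<^sup>2 * x4\<^sup>2 - 3 * x1 * x3 * x4\<^sup>2 - 2 * r * x2 * x3\<^sup>2 - 9 * r\<^sup>2) / (2 * r * x3\<^sup>2 * x4\<^sup>2)"
      using r(2) by (intro divide_nonneg_nonneg) auto
    also have "\<dots> = 1 - 3 * x1 / (2 * r * x3) - x2 / x4\<^sup>2 - 9 * r / (2 * (x3\<^sup>2 * x4\<^sup>2))"
      using x0 r(2) by (simp add: diff_divide_distrib power2_eq_square)
    finally show ?thesis .
  qed
  then have "9 * r / (2 * (x3\<^sup>2 * x4\<^sup>2)) / A1 \<le> (1 - 3 * x1 / (2 * r * x3) - x2 / x4\<^sup>2) / A1"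
    using A0 by (intro divide_right_mono) auto
  then show ?thesis unfolding 1 unfolding growth_rate_eq[OF t] Let_def r(1) x A1 .
qed

lemma coefA_1_ge_half:
  assumes t: "0 < t" and r: "bggg_r t \<ge> 3"
  shows "coefA 1 t \<ge> 1 / 2"
proof -
  define r where "r = bggg_r t"
  have r: "r \<ge> 3" using assms by (simp add: r_def)
  then have "3 * 3 \<le> r * r" by (intro mult_mono) auto
  then have "(1 / 2)\<^sup>2 \<le> (r - 9/4) * (r + 9/4) / ((r - 3/4) * (r + 3/4))"
    using r by (simp add: field_simps power2_eq_square)
  then have "(1 / 2)\<^sup>2 \<le> (coefA 1 t)\<^sup>2"
    by (simp add: coef_sq[OF t] r_def)
  then show ?thesis
    by (rule power2_le_imp_le) (use coef_pos(1)[OF t, of 1] in simp)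
qed

lemma has_real_derivative_coefA_2_sq:
  assumes "0 < t"
  shows "((\<lambda>t. (coefA 2 t)\<^sup>2) has_real_derivative 2 / 3 * (bggg_r t - 3/4) * coefA 1 t) (at t)"
proof -
  define r where "r = bggg_r t"
  have 1: "((\<lambda>r::real. (r - 9/4) * (r + 3/4) / 3) has_real_derivative 2 / 3 * (r - 3/4)) (at r)"
    by (auto intro!: derivative_eq_intros simp: field_simps)
  have "((\<lambda>t. (bggg_r t - 9/4) * (bggg_r t + 3/4) / 3) has_real_derivative 2 / 3 * (r - 3/4) * coefA 1 t) (at t)"
    using DERIV_chain2[OF 1[unfolded r_def] has_real_derivative_bggg_r[OF assms]] by (simp add: r_def)
  then have "((\<lambda>t. (coefA 2 t)\<^sup>2) has_real_derivative 2 / 3 * (r - 3/4) * coefA 1 t) (at t)"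
    by (rule has_field_derivative_transform_within_open[of _ _ _ "{0<..}"]) (use assms in \<open>auto simp: coef_sq\<close>)
  then show ?thesis by (simp add: r_def)
qed

lemma continuous_on_bggg_r: "continuous_on {0<..} bggg_r"
  using DERIV_isCont[OF has_real_derivative_bggg_r] by (auto intro!: continuous_at_imp_continuous_on)

lemma continuous_on_coef: "continuous_on {0<..} (coefA i)" "continuous_on {0<..} (coefB i)"
proof -
  have "continuous_on {0<..} (\<lambda>t. sqrt ((bggg_r t - 9/4) * (bggg_r t + 9/4)) / sqrt ((bggg_r t - 3/4) * (bggg_r t + 3/4)))"
    using bggg_r_gt by (intro continuous_intros continuous_on_bggg_r) (force simp: mult_eq_0_iff)+
  moreover have "continuous_on {0<..} (\<lambda>t. sqrt ((bggg_r t - 9/4) * (bggg_r t + 3/4) / 3))"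
    "continuous_on {0<..} (\<lambda>t. 2 * bggg_r t / 3)"
    "continuous_on {0<..} (\<lambda>t. sqrt ((bggg_r t - 3/4) * (bggg_r t + 9/4) / 3))"
    by (intro continuous_intros continuous_on_bggg_r; simp)+
  ultimately show "continuous_on {0<..} (coefA i)" "continuous_on {0<..} (coefB i)"
    by (cases "i = 1"; simp add: coefA_def[abs_def] coefB_def[abs_def] Let_def)+
qed

text \<open>The equations of \<open>instanton_ode\<close> on the half-line once the eta_minus
  components vanish; \<open>P\<close> stands for the squared norm of the coefficient of the second
  eta_plus form.\<close>

locale reduced_instanton =
  fixes b P :: "real \<Rightarrow> real"
  assumes b_deriv: "t > 0 \<Longrightarrow> (b has_real_derivative
      coefA 1 t / (coefA 2 t)\<^sup>2 * (b t - P t) - coefA 1 t / (coefB 2 t)\<^sup>2 * b t) (at t)"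
    and P_deriv: "t > 0 \<Longrightarrow> (P has_real_derivative
      2 * ((1 - b t) / coefA 1 t - coefA 2 t / (coefB 1 t * coefB 2 t)) * P t) (at t)"
    and P_nonneg: "t > 0 \<Longrightarrow> P t \<ge> 0"
begin

definition F :: "real \<Rightarrow> real"
  where "F t = b t / (coefA 1 t)\<^sup>2"

definition p :: "real \<Rightarrow> real"
  where "p t = P t / (coefA 2 t)\<^sup>2"

lemma p_nonneg: "t > 0 \<Longrightarrow> p t \<ge> 0"
  by (simp add: p_def P_nonneg)

lemma F_deriv:
  assumes t: "t > 0"
  shows "(F has_real_derivative - p t / coefA 1 t) (at t)"
proof -
  note d = DERIV_divide[OF b_deriv[OF t] has_real_derivative_coefA_1_sq[OF t]]
  have pos: "coefA 1 t > 0" "coefA 2 t > 0" using coef_pos[OF t] by auto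
  show ?thesis
    unfolding F_def[abs_def] p_def
    by (rule DERIV_cong[OF d]) (use pos in \<open>simp_all add: divide_simps\<close>, simp add: algebra_simps power2_eq_square power4_eq_xxxx)
qed

lemma p_deriv:
  assumes t: "t > 0"
  shows "(p has_real_derivative 2 * (growth_rate t - coefA 1 t * F t) * p t) (at t)"
proof -
  note d = DERIV_divide[OF P_deriv[OF t] has_real_derivative_coefA_2_sq[OF t]]
  have pos: "coefA 1 t > 0" "coefA 2 t > 0" using coef_pos[OF t] by auto
  define X where "X = (bggg_r t - 9/4) * (bggg_r t + 3/4)"
  have X: "(coefA 2 t)\<^sup>2 = X / 3" "X > 0" using bggg_r_gt[OF t] by (simp_all add: coef_sq[OF t] X_def)
  define Y where "Y = coefA 2 t / (coefB 1 t * coefB 2 t)"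
  define Z where "Z = bggg_r t - 3/4"
  show ?thesis
    unfolding p_def[abs_def] growth_rate_def F_def Y_def[symmetric] X_def[symmetric] Z_def[symmetric]
  proof (rule DERIV_cong[OF d[folded Y_def Z_def]])
    show "(coefA 2 t)\<^sup>2 \<noteq> 0" using pos by simp
    show "(2 * ((1 - b t) / coefA 1 t - Y) * P t * (coefA 2 t)\<^sup>2 - P t * (2 / 3 * Z * coefA 1 t)) /
        ((coefA 2 t)\<^sup>2 * (coefA 2 t)\<^sup>2) =
      2 * (1 / coefA 1 t - Y - coefA 1 t * Z / X - coefA 1 t * (b t / (coefA 1 t)\<^sup>2)) * (P t / (coefA 2 t)\<^sup>2)"
      unfolding X(1) using pos X(2) by (simp add: field_simps power2_eq_square)
  qed
qed

lemma F_antimono: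
  assumes "0 < s" "s \<le> t"
  shows "F t \<le> F s"
proof (rule DERIV_nonpos_imp_nonincreasing[OF assms(2)])
  fix x assume "s \<le> x" "x \<le> t"
  then have x: "x > 0" using assms by simp
  then show "\<exists>y. (F has_real_derivative y) (at x) \<and> y \<le> 0"
    using F_deriv[OF x] p_nonneg[OF x] coef_pos[OF x, of 1] by (intro exI conjI) auto
qed

text \<open>The equation for \<open>P\<close> is linear and homogeneous. Gronwall applied to
  \<open>P\<close> gives vanishing after \<open>s\<close>, applied to \<open>- P\<close> it gives
  vanishing before \<open>s\<close>.\<close>

lemma P_eq_0:
  assumes "s > 0" "P s = 0" "t > 0"
  shows "P t = 0"
proof -
  define m where "m t = 2 * ((1 - b t) / coefA 1 t - coefA 2 t / (coefB 1 t * coefB 2 t))" for t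
  have "continuous_on {0<..} b"
    using DERIV_isCont[OF b_deriv] by (auto intro!: continuous_at_imp_continuous_on)
  then have m: "continuous_on {0<..} m"
    unfolding m_def using coef_pos by (intro continuous_intros continuous_on_coef) (auto simp: less_imp_neq[symmetric])
  have d: "(P has_real_derivative m x * P x) (at x)" if "x > 0" for x
    using P_deriv[OF that] by (simp add: m_def)
  show ?thesis
  proof (cases "s \<le> t")
    case True
    have "P t \<le> P s * exp (integral {s..t} m)"
      using assms d by (intro gronwall[OF True] continuous_on_subset[OF m]) auto
    then show ?thesis using assms(2) P_nonneg[OF assms(3)] by simp
  next
    case False
    have "- P s \<le> - P t * exp (integral {t..s} m)"
      by (rule gronwall[where u = "\<lambda>x. - P x" and u' = "\<lambda>x. m x * - P x"])
        (use False assms d in \<open>auto intro!: continuous_on_subset[OF m] derivative_eq_intros\<close>)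
    then have "P t * exp (integral {t..s} m) \<le> 0" using assms(2) by simp
    then show ?thesis using P_nonneg[OF assms(3)] by (simp add: mult_le_0_iff)
  qed
qed

text \<open>Far out, \<open>p\<close> increases, so \<open>\<phi>\<close> = - F grows at least
  linearly. Once \<open>\<phi>\<close> is at least 1, its quadratic feedback dominates:
  \<open>p\<close> - \<open>\<phi>\<close>^2 / 4 is nondecreasing, hence \<open>p\<close> is
  eventually at least \<open>\<phi>\<close>^2 / 8, and \<open>\<phi>\<close>' >= \<open>p\<close>
  becomes a Riccati inequality.\<close>

lemma blow_up:
  assumes P: "\<And>t. t > 0 \<Longrightarrow> P t > 0" and t0: "t0 > 0" "F t0 < 1"
  shows False
proof -
  have p_pos: "p t > 0" if "t > 0" for t
    using P[OF that] coef_pos[OF that, of 2] by (simp add: p_def)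
  define \<delta> where "\<delta> = min 1 (1 - F t0)"
  have \<delta>: "0 < \<delta>" "\<delta> \<le> 1" "F t0 \<le> 1 - \<delta>" using t0 by (auto simp: \<delta>_def)
  \<comment> \<open>The summand 3 serves \<open>coefA_1_ge_half\<close>, the summand
    \<open>8 / \<delta>\<close> serves \<open>growth_rate_ge\<close>.\<close>
  obtain T' where T': "T' > 0" "\<And>t. t \<ge> T' \<Longrightarrow> 3 + 8 / \<delta> \<le> bggg_r t"
    using bggg_r_unbounded by blast
  define T where "T = max t0 T'"
  have T: "T > 0" using T' by (simp add: T_def)
  have far: "t > 0" "growth_rate t \<ge> 1 - \<delta> / 2" "coefA 1 t \<ge> 1 / 2" "coefA 1 t < 1" "F t \<le> 1 - \<delta>"
    if "t \<ge> T" for t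
  proof -
    show t: "t > 0" using that T by simp
    have r: "3 + 8 / \<delta> \<le> bggg_r t" using T'(2) that by (simp add: T_def)
    have "0 < 8 / \<delta>" using \<delta> by simp
    then show "growth_rate t \<ge> 1 - \<delta> / 2" "coefA 1 t \<ge> 1 / 2"
      using r \<delta> by (intro growth_rate_ge[OF t] coefA_1_ge_half[OF t]; linarith)+
    show "coefA 1 t < 1" using coefA_1_less_1[OF t] .
    show "F t \<le> 1 - \<delta>" using F_antimono[OF t0(1), of t] that \<delta> by (simp add: T_def)
  qed
  have AF: "coefA 1 t * F t \<le> 1 - \<delta>" if "t \<ge> T" for t
  proof (cases "F t \<ge> 0")
    case True
    then have "coefA 1 t * F t \<le> F t" using far[OF that] by (simp add: mult_left_le_one_le)
    then show ?thesis using far[OF that] by simp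
  next
    case False
    then have "coefA 1 t * F t \<le> 0" using far(3)[OF that] by (simp add: mult_nonneg_nonpos)
    then show ?thesis using \<delta> by simp
  qed
  have p_mono: "p T \<le> p t" if "t \<ge> T" for t
  proof (rule DERIV_nonneg_imp_nondecreasing[OF that])
    fix x assume x: "T \<le> x" "x \<le> t"
    have "0 \<le> growth_rate x - coefA 1 x * F x" using far(2)[OF x(1)] AF[OF x(1)] \<delta> by simp
    then have "0 \<le> 2 * (growth_rate x - coefA 1 x * F x) * p x"
      using p_pos[OF far(1)[OF x(1)]] by simp
    then show "\<exists>y. (p has_real_derivative y) (at x) \<and> 0 \<le> y" using p_deriv[OF far(1)[OF x(1)]] by blast
  qed
  define \<phi> where "\<phi> t = - F t" for t
  have \<phi>': "(\<phi> has_real_derivative p t / coefA 1 t) (at t)" if "t \<ge> T" for t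
    using DERIV_minus[OF F_deriv[OF far(1)[OF that]]] by (simp add: \<phi>_def[abs_def])
  have \<phi>'_ge: "p t \<le> p t / coefA 1 t" if "t \<ge> T" for t
    using far[OF that] p_pos[OF far(1)[OF that]] by (simp add: field_simps)
  have \<phi>_lin: "\<phi> T + p T * (t - T) \<le> \<phi> t" if "t \<ge> T" for t
  proof -
    have "\<phi> T - p T * T \<le> \<phi> t - p T * t"
    proof (rule DERIV_nonneg_imp_nondecreasing[OF that])
      fix x assume x: "T \<le> x" "x \<le> t"
      have "((\<lambda>t. \<phi> t - p T * t) has_real_derivative p x / coefA 1 x - p T) (at x)"
        using \<phi>'[OF x(1)] by (auto intro!: derivative_eq_intros)
      then show "\<exists>y. ((\<lambda>t. \<phi> t - p T * t) has_real_derivative y) (at x) \<and> 0 \<le> y"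
        using p_mono[OF x(1)] \<phi>'_ge[OF x(1)] by (intro exI conjI) auto
    qed
    then show ?thesis by (simp add: algebra_simps)
  qed
  have \<phi>_large: "\<exists>T1\<ge>T. \<forall>t\<ge>T1. c \<le> \<phi> t" for c
  proof (intro exI conjI allI impI)
    have pT: "p T > 0" using p_pos[OF T] .
    show "T \<le> T + \<bar>c - \<phi> T\<bar> / p T" using pT by simp
    fix t assume t: "T + \<bar>c - \<phi> T\<bar> / p T \<le> t"
    then have "\<bar>c - \<phi> T\<bar> / p T \<le> t - T" by simp
    then have "\<bar>c - \<phi> T\<bar> \<le> p T * (t - T)" using pT by (simp add: pos_divide_le_eq mult.commute)
    moreover have "t \<ge> T"
    proof -
      have "0 \<le> \<bar>c - \<phi> T\<bar> / p T" using pT by simp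
      then show ?thesis using t by linarith
    qed
    ultimately show "c \<le> \<phi> t" using \<phi>_lin[of t] by linarith
  qed
  obtain T2 where T2: "T2 \<ge> T" "\<And>t. t \<ge> T2 \<Longrightarrow> 1 \<le> \<phi> t" using \<phi>_large by blast
  define K where "K = p T2 - (\<phi> T2)\<^sup>2 / 4"
  have p_ge: "(\<phi> t)\<^sup>2 / 4 + K \<le> p t" if "t \<ge> T2" for t
  proof -
    have "p T2 - (\<phi> T2)\<^sup>2 / 4 \<le> p t - (\<phi> t)\<^sup>2 / 4"
    proof (rule DERIV_nonneg_imp_nondecreasing[OF that])
      fix x assume x: "T2 \<le> x" "x \<le> t"
      then have xT: "x \<ge> T" using T2 by simp
      note f = far[OF xT]
      have "((\<lambda>t. p t - (\<phi> t)\<^sup>2 / 4) has_real_derivative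
          2 * (growth_rate x - coefA 1 x * F x) * p x - \<phi> x * (p x / coefA 1 x) / 2) (at x)"
        using p_deriv[OF f(1)] \<phi>'[OF xT] by (auto intro!: derivative_eq_intros)
      moreover have "0 \<le> 2 * (growth_rate x - coefA 1 x * F x) * p x - \<phi> x * (p x / coefA 1 x) / 2"
      proof -
        have "\<phi> x * p x > 0" using T2(2)[OF x(1)] p_pos[OF f(1)] by simp
        \<comment> \<open>The weight 1/4 is fitted to \<open>coefA 1 x\<close> being at least 1/2:
          the derivative of \<open>\<phi>\<close>^2 / 4 is \<open>\<phi>\<close> p / (2 A1), and
          this is at most the term 2 A1 \<open>\<phi>\<close> p of p'.\<close>
        have "1 * 1 \<le> (2 * coefA 1 x) * (2 * coefA 1 x)" using f(3) by (intro mult_mono) auto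
        then have "1 / coefA 1 x / 2 \<le> 2 * coefA 1 x" using f(3) by (simp add: field_simps)
        then have "\<phi> x * p x * (1 / coefA 1 x / 2) \<le> \<phi> x * p x * (2 * coefA 1 x)"
          using \<open>\<phi> x * p x > 0\<close> by (intro mult_left_mono) auto
        moreover have "0 \<le> 2 * growth_rate x * p x"
          using f(2) \<delta> p_pos[OF f(1)] by simp
        ultimately show ?thesis by (simp add: \<phi>_def algebra_simps)
      qed
      ultimately show "\<exists>y. ((\<lambda>t. p t - (\<phi> t)\<^sup>2 / 4) has_real_derivative y) (at x) \<and> 0 \<le> y" by blast
    qed
    then show ?thesis by (simp add: K_def)
  qed
  \<comment> \<open>Here \<open>\<phi>\<close> is at least 1 and at least 8 |K|, so
    \<open>\<phi>\<close>^2 >= 8 |K|, and half of \<open>\<phi>\<close>^2 / 4 absorbs the constant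
    \<open>K\<close>.\<close>
  obtain T3 where T3: "T3 \<ge> T" "\<And>t. t \<ge> T3 \<Longrightarrow> 1 + 8 * \<bar>K\<bar> \<le> \<phi> t" using \<phi>_large by blast
  show False
  proof (rule riccati_no_global_solution[of "max T2 T3" \<phi> "\<lambda>t. p t / coefA 1 t" "1/8"])
    fix t assume t: "max T2 T3 \<le> t"
    then show "(\<phi> has_real_derivative p t / coefA 1 t) (at t)" using \<phi>' T2 by simp
    have f: "1 + 8 * \<bar>K\<bar> \<le> \<phi> t" using T3(2) t by simp
    then have "\<phi> t * 1 \<le> \<phi> t * \<phi> t" by (intro mult_left_mono) auto
    then have "8 * \<bar>K\<bar> \<le> (\<phi> t)\<^sup>2" using f by (simp add: power2_eq_square)
    then have "(\<phi> t)\<^sup>2 / 8 \<le> p t" using p_ge[of t] t by (simp add: abs_if split: if_splits)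
    then have "1 / 8 * (\<phi> t)\<^sup>2 \<le> p t" by simp
    also have "p t \<le> p t / coefA 1 t" using \<phi>'_ge[of t] t T2 by simp
    finally show "1 / 8 * (\<phi> t)\<^sup>2 \<le> p t / coefA 1 t" .
  next
    show "0 < \<phi> (max T2 T3)" using T2(2)[of "max T2 T3"] by simp
  qed simp
qed

lemma vanishing_of_small_slope:
  assumes F0: "(F \<longlongrightarrow> l) (at_right 0)" "l \<le> 1" and t: "t > 0"
  shows "P t = 0"
proof (rule ccontr)
  assume "P t \<noteq> 0"
  then have pos: "P s > 0" if "s > 0" for s
    using P_eq_0[OF that _ t] P_nonneg[OF that] by (cases "P s = 0") auto
  \<comment> \<open>The limit at 0 bounds F only weakly. Strict decrease between two points gives F
    1 < 1 also in the borderline case \<open>l = 1\<close>.\<close>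
  have "F 1 < F (1/2)"
  proof (rule DERIV_neg_imp_decreasing[where f = F and a = "1/2" and b = 1])
    fix x :: real assume "1/2 \<le> x" "x \<le> 1"
    then have x: "x > 0" by simp
    have "- p x / coefA 1 x < 0"
      using pos[OF x] coef_pos[OF x, of 1] coef_pos[OF x, of 2] by (simp add: p_def)
    then show "\<exists>y. (F has_real_derivative y) (at x) \<and> y < 0" using F_deriv[OF x] by blast
  qed simp
  also have "F (1/2) \<le> l"
  proof (rule tendsto_lowerbound[OF F0(1)])
    show "eventually (\<lambda>s. F (1/2) \<le> F s) (at_right 0)"
      unfolding eventually_at_right_field by (rule exI[of _ "1/2"]) (auto intro: F_antimono)
  qed simp
  finally show False using blow_up[of 1] pos F0(2) by simp
qed

text \<open>By \<open>blow_up\<close>, a nonzero \<open>p\<close> forces F >= 1 throughout. As the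
  limit \<open>q\<close> may equal 1, f <= g cannot be read off at any starting point; it is
  obtained by letting the starting point of a Gronwall estimate tend to 0. Then p >= f^2 makes F
  fall at a definite rate, against F >= 1.\<close>

lemma vanishing_of_dominant_slope:
  assumes F0: "(F \<longlongrightarrow> l) (at_right 0)"
    and q: "((\<lambda>t. coefA 1 t * F t / sqrt (p t)) \<longlongrightarrow> q) (at_right 0)" "q \<le> 1" and t: "t > 0"
  shows "P t = 0"
proof (rule ccontr)
  assume "P t \<noteq> 0"
  then have pos: "P s > 0" if "s > 0" for s
    using P_eq_0[OF that _ t] P_nonneg[OF that] by (cases "P s = 0") auto
  have p_pos: "p s > 0" if "s > 0" for s
    using pos[OF that] coef_pos[OF that, of 2] by (simp add: p_def)
  have F_ge: "F s \<ge> 1" if "s > 0" for s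
    using blow_up[OF pos that] by (cases "F s < 1") auto
  have F_le: "F s \<le> l" if "s > 0" for s
  proof (rule tendsto_lowerbound[OF F0(1)])
    show "eventually (\<lambda>x. F s \<le> F x) (at_right 0)"
      unfolding eventually_at_right_field using that by (intro exI[of _ s]) (auto intro: F_antimono)
  qed simp
  define f where "f s = coefA 1 s * F s" for s
  have f_pos: "f s > 0" if "s > 0" for s
    using coef_pos[OF that, of 1] F_ge[OF that] by (simp add: f_def)
  have f_le: "f s \<le> l" if "s > 0" for s
  proof -
    have "f s \<le> F s" using coef_pos[OF that, of 1] coefA_1_less_1[OF that] F_ge[OF that]
      by (simp add: f_def mult_left_le_one_le)
    then show ?thesis using F_le[OF that] by simp
  qed
  \<comment> \<open>\<open>D = ln (f / g)\<close>, and \<open>D' \<le> 2 f D\<close> because \<open>exp (- 2 D) \<ge> 1 - 2 D\<close>\<close>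
  define D where "D s = ln ((coefA 1 s)\<^sup>2) / 2 + ln (F s) - ln (p s) / 2" for s
  define D' where "D' s = (coefA 1 s / (coefA 2 s)\<^sup>2 - coefA 1 s / (coefB 2 s)\<^sup>2) / 2
      - p s / (coefA 1 s * F s) - (growth_rate s - coefA 1 s * F s)" for s
  have D_eq: "D s = ln (f s / sqrt (p s))" if "s > 0" for s
    using coef_pos[OF that, of 1] F_ge[OF that] p_pos[OF that]
    by (simp add: D_def f_def ln_div ln_mult ln_sqrt ln_realpow)
  have D_deriv: "(D has_real_derivative D' s) (at s)" if "s > 0" for s
  proof -
    have c: "coefA 1 s > 0" "F s > 0" "p s > 0" using coef_pos[OF that, of 1] F_ge[OF that] p_pos[OF that] by auto
    have "((\<lambda>s. ln ((coefA 1 s)\<^sup>2)) has_real_derivative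
        1 / (coefA 1 s)\<^sup>2 * ((coefA 1 s)\<^sup>2 * (coefA 1 s / (coefA 2 s)\<^sup>2 - coefA 1 s / (coefB 2 s)\<^sup>2))) (at s)"
      using DERIV_chain2[OF DERIV_ln_divide has_real_derivative_coefA_1_sq[OF that]] c by simp
    moreover have "((\<lambda>s. ln (F s)) has_real_derivative 1 / F s * (- p s / coefA 1 s)) (at s)"
      using DERIV_chain2[OF DERIV_ln_divide F_deriv[OF that]] c by simp
    moreover have "((\<lambda>s. ln (p s)) has_real_derivative 1 / p s * (2 * (growth_rate s - coefA 1 s * F s) * p s)) (at s)"
      using DERIV_chain2[OF DERIV_ln_divide p_deriv[OF that]] c by simp
    ultimately have "(D has_real_derivative
        1 / (coefA 1 s)\<^sup>2 * ((coefA 1 s)\<^sup>2 * (coefA 1 s / (coefA 2 s)\<^sup>2 - coefA 1 s / (coefB 2 s)\<^sup>2)) / 2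
        + 1 / F s * (- p s / coefA 1 s)
        - 1 / p s * (2 * (growth_rate s - coefA 1 s * F s) * p s) / 2) (at s)"
      unfolding D_def[abs_def] by (intro DERIV_diff DERIV_add DERIV_cdivide)
    moreover have e: "1 / p s * (2 * X * p s) / 2 = X" for X using c by simp
    ultimately show ?thesis
      unfolding D'_def e using c by (elim DERIV_cong) (simp add: mult.commute)
  qed
  have D_le: "D' s \<le> 2 * f s * D s" if "s > 0" for s
  proof -
    have c: "f s > 0" "p s > 0" using f_pos[OF that] p_pos[OF that] by auto
    have "exp (- (2 * D s)) = p s / (f s)\<^sup>2"
    proof -
      have "exp (D s) = f s / sqrt (p s)" using c by (simp add: D_eq[OF that])
      moreover have "exp (- (2 * D s)) = inverse ((exp (D s))\<^sup>2)"
        by (simp add: exp_minus exp_double)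
      ultimately show ?thesis using c by (simp add: power_divide)
    qed
    then have "1 - 2 * D s \<le> p s / (f s)\<^sup>2" using exp_ge_add_one_self[of "- (2 * D s)"] by simp
    then have "f s * (1 - 2 * D s) \<le> f s * (p s / (f s)\<^sup>2)" using c by (intro mult_left_mono) auto
    also have "\<dots> = p s / f s" using c by (simp add: power2_eq_square)
    finally have "f s - 2 * f s * D s \<le> p s / f s" by (simp add: algebra_simps)
    then show ?thesis
      using growth_rate_ge_log_deriv[OF that] unfolding D'_def f_def[symmetric] by linarith
  qed
  have D_nonpos: "D T \<le> 0" if T: "T > 0" for T
  proof (rule ccontr)
    assume "\<not> D T \<le> 0"
    then have DT: "D T > 0" by simp
    \<comment> \<open>Chosen so that growth from any \<open>s\<close> up to \<open>T\<close>, which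
      is by a factor of at most exp (2 l T) because f <= l, cannot carry \<open>D\<close> from below
      \<open>\<eta>\<close> to \<open>D T\<close>.\<close>
    define \<eta> where "\<eta> = D T * exp (- (2 * l * T))"
    have "exp \<eta> > q" using DT q(2) by (simp add: \<eta>_def less_le_trans[of 1] le_less_trans[of q 1])
    then have "eventually (\<lambda>s. f s / sqrt (p s) < exp \<eta>) (at_right 0)"
      unfolding f_def by (rule order_tendstoD(2)[OF q(1)])
    then obtain e where e: "e > 0" "\<And>s. 0 < s \<Longrightarrow> s < e \<Longrightarrow> f s / sqrt (p s) < exp \<eta>"
      unfolding eventually_at_right_field by blast
    define s where "s = min (e / 2) T"
    have s: "0 < s" "s < e" "s \<le> T" using e T by (auto simp: s_def)
    have "ln (f s / sqrt (p s)) < ln (exp \<eta>)"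
      using e(2)[OF s(1,2)] f_pos[OF s(1)] p_pos[OF s(1)] by (subst ln_less_cancel_iff) auto
    then have "D s < \<eta>" by (simp add: D_eq[OF s(1)])
    have cf: "continuous_on {s..T} (\<lambda>x. 2 * f x)"
    proof -
      have "continuous_on {0<..} F"
        using DERIV_isCont[OF F_deriv] by (auto intro!: continuous_at_imp_continuous_on)
      then have "continuous_on {0<..} (\<lambda>x. 2 * f x)"
        unfolding f_def by (intro continuous_intros continuous_on_coef)
      then show ?thesis by (rule continuous_on_subset) (use s in auto)
    qed
    have "D T \<le> D s * exp (integral {s..T} (\<lambda>x. 2 * f x))"
      using s by (intro gronwall[where u' = D', OF s(3) _ cf] D_deriv D_le) auto
    moreover have "integral {s..T} (\<lambda>x. 2 * f x) \<le> 2 * l * T"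
    proof -
      have "integral {s..T} (\<lambda>x. 2 * f x) \<le> integral {s..T} (\<lambda>x. 2 * l)"
        using s f_le by (intro integral_le integrable_continuous_real cf continuous_intros) auto
      also have "\<dots> = (T - s) * (2 * l)" using s by simp
      also have "\<dots> \<le> T * (2 * l)"
        using s F_ge[OF s(1)] F_le[OF s(1)] by (intro mult_right_mono) auto
      finally show ?thesis by (simp add: mult.commute mult.left_commute)
    qed
    moreover have "D s > 0"
    proof (rule ccontr)
      assume "\<not> D s > 0"
      then have "D s * exp (integral {s..T} (\<lambda>x. 2 * f x)) \<le> 0" by (simp add: mult_nonpos_nonneg)
      then show False using calculation(1) DT by simp
    qed
    ultimately have "D T \<le> D s * exp (2 * l * T)"
      by (smt (verit) exp_le_cancel_iff mult_left_mono)
    also have "\<dots> < \<eta> * exp (2 * l * T)" using \<open>D s < \<eta>\<close> by simp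
    also have "\<dots> = D T" by (simp add: \<eta>_def exp_minus)
    finally show False by simp
  qed
  have f_sq_le: "(f s)\<^sup>2 \<le> p s" if "s > 0" for s
  proof -
    have "f s / sqrt (p s) \<le> 1"
      using D_nonpos[OF that] f_pos[OF that] p_pos[OF that] unfolding D_eq[OF that] by (simp add: ln_le_zero_iff)
    then have "f s \<le> sqrt (p s)" using p_pos[OF that] by simp
    then have "(f s)\<^sup>2 \<le> (sqrt (p s))\<^sup>2" using f_pos[OF that] by (intro power_mono) auto
    then show ?thesis using p_pos[OF that] by simp
  qed
  obtain T where T: "T > 0" "\<And>t. t \<ge> T \<Longrightarrow> 3 \<le> bggg_r t" using bggg_r_unbounded by blast
  \<comment> \<open>Beyond \<open>T\<close> the slope of F is at most -1/2, since p / A1 >= f^2 / A1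
    >= A1 >= 1/2. So F has used up its value \<open>F T\<close> by this time.\<close>
  define T' where "T' = T + 2 * F T"
  have TT: "T \<le> T'" using F_ge[OF T(1)] by (simp add: T'_def)
  have "F T' + T' / 2 \<le> F T + T / 2"
  proof (rule DERIV_nonpos_imp_nonincreasing[OF TT])
    fix x assume x: "T \<le> x" "x \<le> T'"
    then have x0: "x > 0" using T by simp
    have a: "coefA 1 x \<ge> 1 / 2" using coefA_1_ge_half[OF x0] T(2)[OF x(1)] by simp
    have "coefA 1 x * 1 \<le> f x" unfolding f_def using a F_ge[OF x0] by (intro mult_left_mono) auto
    then have "(coefA 1 x)\<^sup>2 \<le> (f x)\<^sup>2" using a by (intro power_mono) auto
    then have "(coefA 1 x)\<^sup>2 / coefA 1 x \<le> p x / coefA 1 x"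
      using f_sq_le[OF x0] a by (intro divide_right_mono) auto
    moreover have "(coefA 1 x)\<^sup>2 / coefA 1 x = coefA 1 x" by (simp add: power2_eq_square)
    ultimately have "1 / 2 \<le> p x / coefA 1 x" using a by linarith
    then have "1 / 2 - p x / coefA 1 x \<le> 0" by linarith
    moreover have "((\<lambda>x. F x + x / 2) has_real_derivative 1 / 2 - p x / coefA 1 x) (at x)"
      using F_deriv[OF x0] by (auto intro!: derivative_eq_intros)
    ultimately show "\<exists>y. ((\<lambda>x. F x + x / 2) has_real_derivative y) (at x) \<and> y \<le> 0"
      by blast
  qed
  moreover have "T' / 2 = T / 2 + F T" by (simp add: T'_def)
  ultimately have "F T' \<le> 0" by linarith
  then show False using F_ge[of T'] T TT by simp
qed

lemma abelian_solution:
  assumes "\<And>t. t > 0 \<Longrightarrow> P t = 0"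
  obtains x1 where "\<And>t. t > 0 \<Longrightarrow> b t = x1 * (coefA 1 t)\<^sup>2"
proof
  fix t :: real assume t: "t > 0"
  have "(F has_real_derivative 0) (at x)" if "x > 0" for x
    using F_deriv[OF that] assms[OF that] by (simp add: p_def)
  then have "\<exists>c. \<forall>x\<in>{0<..}. F x = c"
    by (intro has_field_derivative_zero_constant) (auto intro: has_field_derivative_at_within)
  then have "F t = F 1" using t by force
  then show "b t = F 1 * (coefA 1 t)\<^sup>2" using coef_pos[OF t, of 1] by (simp add: F_def field_simps)
qed

end

section \<open>Smoothness off the singular orbit\<close>

lemma frechet_derivative_cong_open:
  assumes "open S" "x \<in> S" "\<And>y. y \<in> S \<Longrightarrow> f y = g y"
  shows "frechet_derivative f (at x) = frechet_derivative g (at x)"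
    "f differentiable (at x) \<longleftrightarrow> g differentiable (at x)"
proof -
  have "(f has_derivative D) (at x) \<longleftrightarrow> (g has_derivative D) (at x)" for D
    using has_derivative_transform_within_open[OF _ assms(1,2), of f D UNIV g]
      has_derivative_transform_within_open[OF _ assms(1,2), of g D UNIV f] assms(3) by auto
  then show "frechet_derivative f (at x) = frechet_derivative g (at x)"
    "f differentiable (at x) \<longleftrightarrow> g differentiable (at x)"
    by (simp_all add: frechet_derivative_def differentiable_def)
qed

lemma Ck_on_cong:
  assumes "open S" "\<And>y. y \<in> S \<Longrightarrow> f y = g y"
  shows "Ck_on k f S \<longleftrightarrow> Ck_on k g S"
  using assms(2)
proof (induction k arbitrary: f g)
  case 0
  then show ?case by (simp cong: continuous_on_cong)
next
  case (Suc k)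
  have "Ck_on k (\<lambda>x. frechet_derivative f (at x) v) S \<longleftrightarrow> Ck_on k (\<lambda>x. frechet_derivative g (at x) v) S" for v
    by (rule Suc.IH) (simp add: frechet_derivative_cong_open[OF assms(1) _ Suc.prems])
  then show ?case
    using frechet_derivative_cong_open(2)[OF assms(1) _ Suc.prems] by auto
qed

lemma Ck_on_SucI:
  assumes "open S" "\<And>x. x \<in> S \<Longrightarrow> (f has_derivative f' x) (at x)" "\<And>v. Ck_on k (\<lambda>x. f' x v) S"
  shows "Ck_on (Suc k) f S"
proof -
  have "Ck_on k (\<lambda>x. frechet_derivative f (at x) v) S" for v
    using Ck_on_cong[OF assms(1), of "\<lambda>x. frechet_derivative f (at x) v" "\<lambda>x. f' x v" k]
      frechet_derivative_at[OF assms(2)] assms(3) by metis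
  then show ?thesis using assms(2) by (auto simp: differentiable_def)
qed

lemma Ck_on_SucD:
  assumes "Ck_on (Suc k) f S"
  shows "x \<in> S \<Longrightarrow> (f has_derivative frechet_derivative f (at x)) (at x)"
    "Ck_on k (\<lambda>x. frechet_derivative f (at x) v) S" "Ck_on k f S"
proof -
  show "x \<in> S \<Longrightarrow> (f has_derivative frechet_derivative f (at x)) (at x)"
    using assms by (simp add: frechet_derivative_works)
  show "Ck_on k (\<lambda>x. frechet_derivative f (at x) v) S"
    using assms by simp
  show "Ck_on k f S" using assms
  proof (induction k arbitrary: f)
    case 0
    then show ?case
      by (auto intro!: continuous_at_imp_continuous_on differentiable_imp_continuous_within)
  next
    case (Suc k)
    have d: "\<forall>x\<in>S. f differentiable (at x)" and D: "\<And>v. Ck_on (Suc k) (\<lambda>x. frechet_derivative f (at x) v) S"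
      using Suc.prems Ck_on.simps(2)[of "Suc k" f S] by auto
    then show ?case using Suc.IH[OF D] by simp
  qed
qed

lemma Ck_on_const: "Ck_on k (\<lambda>x. c) S"
proof (induction k arbitrary: c)
  case (Suc k)
  have "frechet_derivative (\<lambda>x. c) (at x) = (\<lambda>v. 0)" for x :: 'a
    by (rule frechet_derivative_at[symmetric]) (rule has_derivative_const)
  then show ?case using Suc by simp
qed simp

lemma Ck_on_bounded_linear:
  assumes "open S" "bounded_linear L"
  shows "Ck_on k L S"
proof (cases k)
  case 0
  then show ?thesis using assms linear_continuous_on by auto
next
  case (Suc j)
  show ?thesis unfolding Suc
    by (rule Ck_on_SucI[OF assms(1) bounded_linear_imp_has_derivative[OF assms(2)] Ck_on_const])
qed

lemma Ck_on_add:
  assumes "open S" "Ck_on k f S" "Ck_on k g S"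
  shows "Ck_on k (\<lambda>x. f x + g x) S"
  using assms(2,3)
proof (induction k arbitrary: f g)
  case 0
  then show ?case by (auto intro: continuous_intros)
next
  case (Suc k)
  show ?case
    by (rule Ck_on_SucI[OF assms(1) has_derivative_add[OF Ck_on_SucD(1)[OF Suc.prems(1)] Ck_on_SucD(1)[OF Suc.prems(2)]]
        Suc.IH[OF Ck_on_SucD(2)[OF Suc.prems(1)] Ck_on_SucD(2)[OF Suc.prems(2)]]])
qed

lemma Ck_on_bilinear:
  assumes "open S" "bounded_bilinear bil" "Ck_on k f S" "Ck_on k g S"
  shows "Ck_on k (\<lambda>x. bil (f x) (g x)) S"
  using assms(3,4)
proof (induction k arbitrary: f g)
  case 0
  then show ?case by (auto intro: bounded_bilinear.continuous_on[OF assms(2)])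
next
  case (Suc k)
  note f = Ck_on_SucD[OF Suc.prems(1)] and g = Ck_on_SucD[OF Suc.prems(2)]
  show ?case
    by (rule Ck_on_SucI[OF assms(1) bounded_bilinear.FDERIV[OF assms(2) f(1) g(1)]
        Ck_on_add[OF assms(1) Suc.IH[OF f(3) g(2)] Suc.IH[OF f(2) g(3)]]])
qed

lemma Ck_on_linear_compose:
  assumes "open S" "bounded_linear L" "Ck_on k f S"
  shows "Ck_on k (\<lambda>x. L (f x)) S"
  using assms(3)
proof (induction k arbitrary: f)
  case 0
  then show ?case by (auto intro: bounded_linear.continuous_on[OF assms(2)])
next
  case (Suc k)
  note f = Ck_on_SucD[OF Suc.prems]
  show ?case
    by (rule Ck_on_SucI[OF assms(1) bounded_linear.has_derivative[OF assms(2) f(1)] Suc.IH[OF f(2)]])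
qed

lemmas Ck_on_mult = Ck_on_bilinear[OF _ bounded_bilinear_mult]
  and Ck_on_scaleR = Ck_on_bilinear[OF _ bounded_bilinear_scaleR]
  and Ck_on_inner = Ck_on_bilinear[OF _ bounded_bilinear_inner]
  and Ck_on_qmult = Ck_on_bilinear[OF _ bounded_bilinear_qmult]

text \<open>Real powers cover square roots and reciprocals by one chain rule. The exponent is
  generalized in the induction because differentiation lowers it by 1.\<close>

lemma Ck_on_powr:
  fixes f :: "'a::euclidean_space \<Rightarrow> real"
  assumes "open S" "Ck_on k f S" "\<And>x. x \<in> S \<Longrightarrow> f x > 0"
  shows "Ck_on k (\<lambda>x. f x powr a) S"
  using assms(2)
proof (induction k arbitrary: a)
  case 0
  then show ?case using assms(3) by (auto intro!: continuous_intros simp: less_imp_neq[symmetric])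
next
  case (Suc k)
  note f = Ck_on_SucD[OF Suc.prems]
  show ?case
  proof (rule Ck_on_SucI[OF assms(1)])
    fix x assume x: "x \<in> S"
    have "((\<lambda>y. y powr a) has_derivative (*) (a * f x powr (a - 1))) (at (f x))"
      using has_real_derivative_powr[OF assms(3)[OF x], of a] by (simp add: has_field_derivative_def)
    from has_derivative_compose[OF f(1)[OF x] this]
    show "((\<lambda>x. f x powr a) has_derivative (\<lambda>v. a * f x powr (a - 1) * frechet_derivative f (at x) v)) (at x)" .
  next
    fix v
    show "Ck_on k (\<lambda>x. a * f x powr (a - 1) * frechet_derivative f (at x) v) S"
      by (intro Ck_on_mult assms(1) Ck_on_const f(2) Suc.IH f(3))
  qed
qed

lemma Ck_on_Un:
  assumes "open S" "open T" "Ck_on k f S" "Ck_on k f T"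
  shows "Ck_on k f (S \<union> T)"
  using assms(3,4)
proof (induction k arbitrary: f)
  case 0
  then show ?case using assms by (simp add: continuous_on_open_Un)
next
  case (Suc k)
  then show ?case by auto
qed

lemma Ck_on_radius: "Ck_on k (\<lambda>y. norm (fst y)) regular"
proof -
  have "Ck_on k (\<lambda>y::point. (fst y \<bullet> fst y) powr (1/2)) regular"
    by (intro Ck_on_powr Ck_on_inner open_regular Ck_on_bounded_linear bounded_linear_fst)
      (auto simp: regular_def)
  then show ?thesis
    by (rule Ck_on_cong[THEN iffD1, rotated 2, OF _ open_regular]) (simp add: powr_half_sqrt norm_eq_sqrt_inner)
qed

text \<open>Bootstrapping: the derivative of \<open>bggg_r\<close> is \<open>coefA 1\<close>, itself
  an algebraic function of \<open>bggg_r\<close>, so each order of differentiability yields the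
  next.\<close>

lemma Ck_on_bggg_r: "Ck_on k (\<lambda>y. bggg_r (norm (fst y))) regular"
proof (induction k)
  case 0
  have "continuous_on regular (\<lambda>y. norm (fst y))" by (intro continuous_intros)
  then have "continuous_on regular (\<lambda>y. bggg_r (norm (fst y)))"
    by (rule continuous_on_compose2[OF continuous_on_bggg_r]) (auto simp: regular_def)
  then show ?case by simp
next
  case (Suc k)
  let ?r = "\<lambda>y::point. bggg_r (norm (fst y))"
  have gt: "9/4 < ?r y" if "y \<in> regular" for y
    using that bggg_r_gt by (auto simp: regular_def)
  note rad = Ck_on_SucD[OF Ck_on_radius[of "Suc k"]]
  have A: "Ck_on k (\<lambda>y. coefA 1 (norm (fst y))) regular"
  proof -
    have c: "Ck_on k (\<lambda>y. ?r y + c) regular" for c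
      by (intro Ck_on_add open_regular Suc.IH Ck_on_const)
    \<comment> \<open>Differences are written as sums with a negative constant and quotients as
      powers, to fit the closure rules for \<open>Ck_on\<close>.\<close>
    have "Ck_on k (\<lambda>y. ((?r y + -9/4) * (?r y + 9/4)) powr (1/2) * ((?r y + -3/4) * (?r y + 3/4)) powr (-1/2)) regular"
      by (intro Ck_on_mult[OF open_regular] Ck_on_powr[OF open_regular] c) (auto dest!: gt intro!: mult_pos_pos)
    then show ?thesis
    proof (rule Ck_on_cong[THEN iffD1, rotated 2, OF _ open_regular])
      fix y :: point assume "y \<in> regular"
      from gt[OF this] have "0 \<le> (?r y - 9/4) * (?r y + 9/4)" "0 \<le> (?r y - 3/4) * (?r y + 3/4)" by simp_all
      then show "((?r y + -9/4) * (?r y + 9/4)) powr (1/2) * ((?r y + -3/4) * (?r y + 3/4)) powr (-1/2) = coefA 1 (norm (fst y))"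
        using powr_minus[of "(?r y - 3/4) * (?r y + 3/4)" "1/2"]
        by (simp add: coefA_def Let_def powr_half_sqrt inverse_eq_divide)
    qed
  qed
  show ?case
  proof (rule Ck_on_SucI[OF open_regular])
    fix y :: point assume y: "y \<in> regular"
    then have "norm (fst y) > 0" by (simp add: regular_def)
    then have "(bggg_r has_derivative (*) (coefA 1 (norm (fst y)))) (at (norm (fst y)))"
      using has_real_derivative_bggg_r[unfolded has_field_derivative_def] by blast
    show "(?r has_derivative (\<lambda>v. coefA 1 (norm (fst y)) * frechet_derivative (\<lambda>y. norm (fst y)) (at y) v)) (at y)"
      by (rule has_derivative_compose[OF rad(1)[OF y] \<open>(bggg_r has_derivative _) _\<close>])
  next
    fix v :: point
    show "Ck_on k (\<lambda>y. coefA 1 (norm (fst y)) * frechet_derivative (\<lambda>y::point. norm (fst y)) (at y) v) regular"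
      by (rule Ck_on_mult[OF open_regular A rad(2)])
  qed
qed

lemma Ck_on_log_form:
  assumes "open S" "Ck_on k f S" "Ck_on k g S" "\<And>x. x \<in> S \<Longrightarrow> f x \<noteq> 0"
  shows "Ck_on k (\<lambda>x. log_form (f x) (g x)) S"
proof -
  have "Ck_on k (\<lambda>x. ((f x \<bullet> f x) powr (-1)) *\<^sub>R snd (qcnj (f x) \<odot> g x)) S"
  proof (rule Ck_on_scaleR[OF assms(1)])
    show "Ck_on k (\<lambda>x. (f x \<bullet> f x) powr (-1)) S"
      using assms(4) by (intro Ck_on_powr[OF assms(1) Ck_on_inner[OF assms(1,2,2)]]) simp
    show "Ck_on k (\<lambda>x. snd (qcnj (f x) \<odot> g x)) S"
      by (rule Ck_on_linear_compose[OF assms(1) bounded_linear_snd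
            Ck_on_qmult[OF assms(1) Ck_on_linear_compose[OF assms(1) bounded_linear_qcnj assms(2)] assms(3)]])
  qed
  then show ?thesis
    by (rule Ck_on_cong[THEN iffD1, rotated 2, OF _ assms(1)])
      (simp add: log_form_def powr_minus power2_norm_eq_inner powr_one)
qed

lemma Ck_on_etap: "Ck_on k (\<lambda>y. etap y v) regular"
proof -
  have 1: "Ck_on k (\<lambda>y::point. fst y) regular" "Ck_on k (\<lambda>y::point. qcnj (snd y)) regular"
    by (intro Ck_on_linear_compose[OF open_regular bounded_linear_qcnj] Ck_on_bounded_linear open_regular
        bounded_linear_fst bounded_linear_snd)+
  have "qcnj (snd y) \<odot> fst y \<noteq> 0" if "y \<in> regular" for y
    using that by (simp add: regular_def)
  then have "Ck_on k (\<lambda>y. theta2 y v) regular"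
    unfolding theta2_def
    by (intro Ck_on_log_form[OF open_regular] Ck_on_add[OF open_regular] Ck_on_qmult[OF open_regular] Ck_on_const 1)
  moreover have "Ck_on k (\<lambda>y. theta1 y v) regular"
    unfolding theta1_def
    by (intro Ck_on_log_form[OF open_regular] Ck_on_const 1) (simp add: regular_def)
  ultimately show ?thesis
    unfolding etap_def by (intro Ck_on_scaleR[OF open_regular] Ck_on_add[OF open_regular] Ck_on_const)
qed

section \<open>Global instantons are abelian\<close>

text \<open>The source of the bound 1/2 on f1: it gives F = f / A1 the limit f1 / (1/2) at the
  singular orbit.\<close>

lemma coefA_1_slope: "((\<lambda>t. coefA 1 t / t) \<longlongrightarrow> 1 / 2) (at_right 0)"
proof (rule lhopital_right_0)
  \<comment> \<open>The derivative of A1 is that of its square divided by 2 A1. The square has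
    derivative A1 times a rational function of r, so A1 cancels and the expression stays finite at r
    = 9/4.\<close>
  define D where "D t = 9 * bggg_r t / (2 * ((bggg_r t - 3/4) * (bggg_r t + 3/4))\<^sup>2)" for t
  have "((\<lambda>t. sqrt ((bggg_r t - 9/4) * (bggg_r t + 9/4)) / sqrt ((bggg_r t - 3/4) * (bggg_r t + 3/4))) \<longlongrightarrow>
      sqrt ((9/4 - 9/4) * (9/4 + 9/4)) / sqrt ((9/4 - 3/4) * (9/4 + 3/4))) (at_right 0)"
    by (intro tendsto_intros bggg_r_tendsto) simp
  then show "(coefA 1 \<longlongrightarrow> 0) (at_right 0)" by (simp add: coefA_def[abs_def] Let_def)
  show "((\<lambda>t::real. t) \<longlongrightarrow> 0) (at_right 0)" by (rule tendsto_ident_at)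
  have pos: "eventually (\<lambda>t::real. t > 0) (at_right 0)" by (simp add: eventually_at_right_less)
  then show "eventually (\<lambda>t::real. t \<noteq> 0) (at_right 0)" by eventually_elim simp
  show "eventually (\<lambda>t::real. (1::real) \<noteq> 0) (at_right 0)" by simp
  show "eventually (\<lambda>t. ((\<lambda>t::real. t) has_real_derivative 1) (at t)) (at_right 0)" by simp
  show "eventually (\<lambda>t. (coefA 1 has_real_derivative D t) (at t)) (at_right 0)"
    using pos
  proof eventually_elim
    case (elim t)
    define h where "h = (coefA 1 t)\<^sup>2 * (coefA 1 t / (coefA 2 t)\<^sup>2 - coefA 1 t / (coefB 2 t)\<^sup>2)"
    have c: "coefA 1 t > 0" using coef_pos[OF elim] by simp
    have "((\<lambda>t. sqrt ((coefA 1 t)\<^sup>2)) has_real_derivative inverse (sqrt ((coefA 1 t)\<^sup>2)) / 2 * h) (at t)"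
      by (rule DERIV_chain2[OF DERIV_real_sqrt]) (use c has_real_derivative_coefA_1_sq[OF elim] in \<open>simp_all add: h_def\<close>)
    then have "(coefA 1 has_real_derivative inverse (sqrt ((coefA 1 t)\<^sup>2)) / 2 * h) (at t)"
      by (rule has_field_derivative_transform_within_open[of _ _ _ "{0<..}"])
        (use elim coef_pos in \<open>auto simp: less_imp_le\<close>)
    moreover have "inverse (sqrt ((coefA 1 t)\<^sup>2)) / 2 * h = D t"
    proof -
      obtain r x1 x2 x3 x4 where r: "bggg_r t = r" "9/4 < r"
        and x: "r - 9/4 = x1" "r + 9/4 = x2" "r - 3/4 = x3" "r + 3/4 = x4"
        and x0: "x1 > 0" "x2 > 0" "x3 > 0" "x4 > 0" and sq: "(coefA 1 t)\<^sup>2 = x1 * x2 / (x3 * x4)"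
          "(coefA 2 t)\<^sup>2 = x1 * x4 / 3" "(coefB 2 t)\<^sup>2 = x3 * x2 / 3" "coefB 1 t = 2 * r / 3"
        by (rule coef_factors[OF elim])
      have "inverse (sqrt ((coefA 1 t)\<^sup>2)) / 2 * h =
          (coefA 1 t)\<^sup>2 * (1 / (coefA 2 t)\<^sup>2 - 1 / (coefB 2 t)\<^sup>2) / 2"
        using c by (simp add: h_def field_simps power2_eq_square)
      also have "\<dots> = x1 * x2 / (x3 * x4) * (1 / (x1 * x4 / 3) - 1 / (x3 * x2 / 3)) / 2"
        by (simp add: sq)
      also have "\<dots> = 3 * (x3 * x2 - x1 * x4) / (2 * (x3 * x4)\<^sup>2)"
        using x0 by (simp add: field_simps power2_eq_square)
      also have "3 * (x3 * x2 - x1 * x4) = 9 * r" unfolding x[symmetric] by (simp add: field_simps)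
      finally show ?thesis by (simp add: D_def r(1) x)
    qed
    ultimately show ?case by simp
  qed
  have "(D \<longlongrightarrow> 9 * (9/4) / (2 * ((9/4 - 3/4) * (9/4 + 3/4))\<^sup>2)) (at_right 0)"
    unfolding D_def by (intro tendsto_intros bggg_r_tendsto) simp
  then show "((\<lambda>t. D t / 1) \<longlongrightarrow> 1 / 2) (at_right 0)" by (simp add: power2_eq_square)
qed

lemma slope_of_bigo:
  assumes "(\<lambda>t. f t - c * t) \<in> O[at_right 0](\<lambda>t. t ^ 3)"
  shows "((\<lambda>t. f t / t) \<longlongrightarrow> (c::real)) (at_right 0)"
proof -
  obtain K where K: "eventually (\<lambda>t. norm (f t - c * t) \<le> K * norm (t ^ 3)) (at_right 0)"
    using assms by (auto elim: landau_o.bigE)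
  have "((\<lambda>t. f t / t - c) \<longlongrightarrow> 0) (at_right 0)"
  proof (rule Lim_null_comparison)
    have "((\<lambda>t. K * t\<^sup>2) \<longlongrightarrow> K * 0\<^sup>2) (at_right (0::real))"
      by (intro tendsto_intros)
    then show "((\<lambda>t. K * t\<^sup>2) \<longlongrightarrow> 0) (at_right (0::real))" by simp
    have "eventually (\<lambda>t::real. t > 0) (at_right 0)" by (simp add: eventually_at_right_less)
    with K show "eventually (\<lambda>t. norm (f t / t - c) \<le> K * t\<^sup>2) (at_right 0)"
    proof eventually_elim
      case (elim t)
      then have "\<bar>f t - c * t\<bar> / t \<le> K * t ^ 3 / t" by (intro divide_right_mono) auto
      moreover have "\<bar>f t - c * t\<bar> / t = \<bar>f t / t - c\<bar>"
      proof -
        have "f t / t - c = (f t - c * t) / t" using elim(2) by (simp add: diff_divide_distrib)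
        then show ?thesis using elim(2) by (simp only: abs_divide abs_of_pos)
      qed
      moreover have "K * t ^ 3 / t = K * t\<^sup>2" using elim(2) by (simp add: power2_eq_square power3_eq_cube)
      ultimately show ?case by simp
    qed
  qed
  then show ?thesis by (simp add: LIM_zero_iff)
qed

text \<open>With \<open>b\<close>, \<open>z2\<close>, \<open>z3\<close> regarded as known functions,
  the derivative of \<open>Y\<close> is a quadratic form in \<open>c\<close>, \<open>y2\<close>,
  \<open>y3\<close>. Hence it is bounded by a continuous multiple of \<open>Y\<close>, and
  \<open>Y\<close> stays zero. Only the mixed product \<open>w\<close> needs an estimate, which
  accounts for the factor \<open>1 + P\<close> in \<open>k\<close>.\<close>

lemma mixed_components_vanish:
  assumes A: "G2_instanton_on M A" "invariant_on M A" and "\<epsilon> > 0"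
    and zero: "\<And>t i. 0 < t \<Longrightarrow> t < \<epsilon> \<Longrightarrow> minus_part A i t = 0"
    and t: "t > 0"
  shows "minus_part A 1 t $ 1 = 0" (is ?c) "minus_part A 2 t $ 2 = 0" (is ?y2) "minus_part A 2 t $ 3 = 0" (is ?y3)
proof -
  define b c z2 z3 y2 y3 where "b = (\<lambda>t. plus_part A 1 t $ 1)"
    and "c = (\<lambda>t. minus_part A 1 t $ 1)"
    and "z2 = (\<lambda>t. plus_part A 2 t $ 2)" and "z3 = (\<lambda>t. plus_part A 2 t $ 3)"
    and "y2 = (\<lambda>t. minus_part A 2 t $ 2)" and "y3 = (\<lambda>t. minus_part A 2 t $ 3)"
  note defs = b_def c_def z2_def z3_def y2_def y3_def
  define P where "P = (\<lambda>t. (z2 t)\<^sup>2 + (z3 t)\<^sup>2)"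
  define Y where "Y = (\<lambda>t. (c t)\<^sup>2 + (y2 t)\<^sup>2 + (y3 t)\<^sup>2)"
  define \<kappa> where "\<kappa> t = coefB 1 t / (coefA 2 t * coefB 2 t)" for t
  define \<mu> where "\<mu> t = coefB 2 t / (coefB 1 t * coefA 2 t)" for t
  \<comment> \<open>A starting point inside the tube and not beyond \<open>t\<close>, which covers
    \<open>t\<close> on either side of \<open>\<epsilon>\<close>.\<close>
  define s where "s = min (\<epsilon> / 2) t"
  have s: "0 < s" "s < \<epsilon>" "s \<le> t" using assms by (auto simp: s_def)
  define k where "k x = (4 * \<kappa> x + 2 * \<mu> x) * (1 + P x) + 2 * (\<bar>1 - b x\<bar> / coefA 1 x)" for x
  define Y' where "Y' x = 4 * \<kappa> x * (c x * (z2 x * y2 x + z3 x * y3 x) - (c x)\<^sup>2)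
      - 2 * (1 - b x) / coefA 1 x * ((y2 x)\<^sup>2 + (y3 x)\<^sup>2)
      + 2 * \<mu> x * (c x * (z2 x * y2 x + z3 x * y3 x) - ((y2 x)\<^sup>2 + (y3 x)\<^sup>2))" for x
  have "Y t \<le> Y s * exp (integral {s..t} k)"
  proof (rule gronwall[OF s(3)])
    fix x assume x: "s \<le> x" "x \<le> t"
    then have x0: "x > 0" using s by simp
    show "(Y has_real_derivative Y' x) (at x)"
      using instanton_ode(3)[OF A x0 coef_pos[OF x0]] unfolding Y_def Y'_def \<kappa>_def \<mu>_def defs .
    have pos: "\<kappa> x > 0" "\<mu> x > 0" "coefA 1 x > 0" using coef_pos[OF x0] by (simp_all add: \<kappa>_def \<mu>_def)
    define w where "w = c x * (z2 x * y2 x + z3 x * y3 x)"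
    have w: "w \<le> (1 + P x) * Y x"
    proof -
      have "2 * (c x * (z2 x * y2 x)) \<le> (c x)\<^sup>2 * (z2 x)\<^sup>2 + (y2 x)\<^sup>2"
        using sum_squares_bound[of "c x * z2 x" "y2 x"] by (simp add: power_mult_distrib mult.assoc)
      moreover have "2 * (c x * (z3 x * y3 x)) \<le> (c x)\<^sup>2 * (z3 x)\<^sup>2 + (y3 x)\<^sup>2"
        using sum_squares_bound[of "c x * z3 x" "y3 x"] by (simp add: power_mult_distrib mult.assoc)
      ultimately have "2 * w \<le> (c x)\<^sup>2 * P x + ((y2 x)\<^sup>2 + (y3 x)\<^sup>2)"
        by (simp add: w_def P_def algebra_simps)
      also have "\<dots> \<le> Y x * P x + Y x"
        by (intro add_mono mult_right_mono) (simp_all add: Y_def P_def)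
      finally have "2 * w \<le> (1 + P x) * Y x" by (simp add: algebra_simps)
      moreover have "0 \<le> (1 + P x) * Y x" by (simp add: Y_def P_def)
      ultimately show ?thesis by linarith
    qed
    have y: "0 \<le> (y2 x)\<^sup>2 + (y3 x)\<^sup>2" "(y2 x)\<^sup>2 + (y3 x)\<^sup>2 \<le> Y x" by (simp_all add: Y_def)
    have r1: "4 * \<kappa> x * (w - (c x)\<^sup>2) \<le> 4 * \<kappa> x * ((1 + P x) * Y x)"
      using pos w by (intro mult_left_mono) (auto intro: order_trans[of _ w])
    have "w - ((y2 x)\<^sup>2 + (y3 x)\<^sup>2) \<le> (1 + P x) * Y x" using w y(1) by linarith
    then have r2: "2 * \<mu> x * (w - ((y2 x)\<^sup>2 + (y3 x)\<^sup>2)) \<le> 2 * \<mu> x * ((1 + P x) * Y x)"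
      using pos by (intro mult_left_mono) auto
    define q where "q = (1 - b x) / coefA 1 x"
    have q: "2 * (1 - b x) / coefA 1 x = 2 * q" "\<bar>1 - b x\<bar> / coefA 1 x = \<bar>q\<bar>"
      using pos by (simp_all add: q_def)
    have "- (2 * q) * ((y2 x)\<^sup>2 + (y3 x)\<^sup>2) \<le> 2 * \<bar>q\<bar> * ((y2 x)\<^sup>2 + (y3 x)\<^sup>2)"
      by (intro mult_right_mono y) simp
    also have "\<dots> \<le> 2 * \<bar>q\<bar> * Y x"
      by (intro mult_left_mono y) simp
    finally have r3: "- (2 * q * ((y2 x)\<^sup>2 + (y3 x)\<^sup>2)) \<le> 2 * \<bar>q\<bar> * Y x" by simp
    have "k x * Y x = 4 * \<kappa> x * ((1 + P x) * Y x) + 2 * \<mu> x * ((1 + P x) * Y x) + 2 * \<bar>q\<bar> * Y x"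
      unfolding k_def q by (simp add: algebra_simps)
    then show "Y' x \<le> k x * Y x"
      using r1 r2 r3 unfolding Y'_def w_def[symmetric] q by linarith
  next
    have "isCont b x" "isCont P x" if "x > 0" for x
      unfolding P_def defs
      by (rule DERIV_isCont[OF instanton_ode(1)[OF A that coef_pos[OF that]]]
          DERIV_isCont[OF instanton_ode(2)[OF A that coef_pos[OF that]]])+
    then have "continuous_on {0<..} b" "continuous_on {0<..} P"
      by (auto intro!: continuous_at_imp_continuous_on)
    then have "continuous_on {0<..} k"
      unfolding k_def \<kappa>_def \<mu>_def using coef_pos
      by (intro continuous_intros continuous_on_coef) (auto simp: less_imp_neq[symmetric])
    then show "continuous_on {s..t} k" by (rule continuous_on_subset) (use s in auto)
  qed
  also have "Y s = 0" using zero[OF s(1,2)] by (simp add: Y_def c_def y2_def y3_def)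
  finally have "(c t)\<^sup>2 + (y2 t)\<^sup>2 + (y3 t)\<^sup>2 \<le> 0" by (simp add: Y_def)
  moreover have "(c t)\<^sup>2 \<ge> 0" "(y2 t)\<^sup>2 \<ge> 0" "(y3 t)\<^sup>2 \<ge> 0" by simp_all
  ultimately have "(c t)\<^sup>2 = 0" "(y2 t)\<^sup>2 = 0" "(y3 t)\<^sup>2 = 0" by linarith+
  then show ?c ?y2 ?y3
    by (simp_all add: c_def y2_def y3_def)
qed

text \<open>The ansatz holds only inside the tube and supplies the limits at t = 0; the
  contradiction with a nonzero \<open>P\<close> comes from the equations of the extension on the
  whole half-line.\<close>

lemma global_instanton_abelian:
  assumes A: "G2_instanton_on M A" "invariant_on M A" and \<epsilon>: "\<epsilon> > 0"
    and ansatz: "connection_eq_on {x \<in> tube \<epsilon>. fst x \<noteq> 0} A (invariant_ansatz f g)"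
    and f: "(\<lambda>t. f t - f1 * t) \<in> O[at_right 0](\<lambda>t. t ^ 3)"
    and g: "(\<lambda>t. g t - g1 * t) \<in> O[at_right 0](\<lambda>t. t ^ 3)"
    and slopes: "f1 \<le> 1 / 2 \<or> (g1 \<ge> 0 \<and> g1 \<ge> f1)"
  obtains x1 where "\<And>t. 0 < t \<Longrightarrow> t < \<epsilon> \<Longrightarrow> f t = x1 * coefA 1 t" "\<And>t. 0 < t \<Longrightarrow> t < \<epsilon> \<Longrightarrow> g t = 0"
proof -
  have near: "plus_part A 1 t $ 1 = coefA 1 t * f t"
    "plus_part A 2 t $ 2 = coefA 2 t * g t" "plus_part A 2 t $ 3 = 0"
    "\<And>i. minus_part A i t = 0" if t: "0 < t" "t < \<epsilon>" for t
  proof -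
    note bp = base_point_simps[OF t(1)]
    have "base_point t \<in> {x \<in> tube \<epsilon>. fst x \<noteq> 0}" using bp t by (simp add: tube_def)
    then have e: "A (base_point t) v = invariant_ansatz f g (base_point t) v" if "v \<in> tangent (base_point t)" for v
      using ansatz that unfolding connection_eq_on_def by blast
    show "plus_part A 1 t $ 1 = coefA 1 t * f t"
      "plus_part A 2 t $ 2 = coefA 2 t * g t" "plus_part A 2 t $ 3 = 0"
      "\<And>i. minus_part A i t = 0"
      by (simp_all add: e frame_tangent invariant_ansatz_def Let_def bp eta_eq coframe_frame[OF t(1)] Tgen_def axis_def)
  qed
  define b P where "b = (\<lambda>t. plus_part A 1 t $ 1)"
    and "P = (\<lambda>t. (plus_part A 2 t $ 2)\<^sup>2 + (plus_part A 2 t $ 3)\<^sup>2)"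
  have nearb: "b t = coefA 1 t * f t" "P t = (coefA 2 t * g t)\<^sup>2" if "0 < t" "t < \<epsilon>" for t
    using near(1-3)[OF that] by (simp_all add: b_def P_def)
  note van = mixed_components_vanish[OF A \<epsilon> near(4)]
  interpret reduced_instanton b P
  proof
    fix t :: real assume t: "t > 0"
    show "(b has_real_derivative coefA 1 t / (coefA 2 t)\<^sup>2 * (b t - P t) - coefA 1 t / (coefB 2 t)\<^sup>2 * b t) (at t)"
      using instanton_ode(1)[OF A t coef_pos[OF t]] by (simp add: van[OF _ _ t] b_def P_def)
    show "(P has_real_derivative 2 * ((1 - b t) / coefA 1 t - coefA 2 t / (coefB 1 t * coefB 2 t)) * P t) (at t)"
      using instanton_ode(2)[OF A t coef_pos[OF t]] by (simp add: van[OF _ _ t] b_def P_def)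
    show "P t \<ge> 0" by (simp add: P_def)
  qed
  have evt: "eventually (\<lambda>t. 0 < t \<and> t < \<epsilon>) (at_right 0)"
    using \<epsilon> by (auto simp: eventually_at_right_field)
  have F_lim: "(F \<longlongrightarrow> 2 * f1) (at_right 0)"
  proof -
    have "((\<lambda>t. f t / t / (coefA 1 t / t)) \<longlongrightarrow> f1 / (1 / 2)) (at_right 0)"
      by (intro tendsto_divide slope_of_bigo[OF f] coefA_1_slope) simp
    moreover have "eventually (\<lambda>t. f t / t / (coefA 1 t / t) = F t) (at_right 0)"
      using evt
    proof eventually_elim
      case (elim t)
      then show ?case using coef_pos[of t 1] by (simp add: F_def nearb power2_eq_square)
    qed
    ultimately have "(F \<longlongrightarrow> f1 / (1 / 2)) (at_right 0)" by (rule Lim_transform_eventually)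
    then show ?thesis by (simp add: mult.commute)
  qed
  have P0: "P t = 0" if t: "t > 0" for t
  proof (cases "f1 \<le> 1 / 2")
    case True
    then show ?thesis by (intro vanishing_of_small_slope[OF F_lim _ t]) simp
  next
    case False
    then have fg: "0 < f1" "f1 \<le> g1" using slopes by auto
    have gt: "((\<lambda>t. g t / t) \<longlongrightarrow> g1) (at_right 0)" by (rule slope_of_bigo[OF g])
    have "((\<lambda>t. f t / t / (g t / t)) \<longlongrightarrow> f1 / g1) (at_right 0)"
      using fg by (intro tendsto_divide slope_of_bigo[OF f] gt) simp
    \<comment> \<open>The slope \<open>g1\<close> is positive here, so g is positive near 0 and the
      square root of p is g itself, not only its absolute value.\<close>
    moreover have "eventually (\<lambda>t. g t / t > 0) (at_right 0)"
      using order_tendstoD(1)[OF gt, of 0] fg by simp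
    with evt have "eventually (\<lambda>t. f t / t / (g t / t) = coefA 1 t * F t / sqrt (p t)) (at_right 0)"
    proof eventually_elim
      case (elim t)
      then have g0: "g t > 0" by (simp add: zero_less_divide_iff)
      have c: "coefA 1 t > 0" "coefA 2 t > 0" using coef_pos elim by auto
      have "p t = (g t)\<^sup>2"
        using c elim by (simp add: p_def nearb power_mult_distrib)
      then have "sqrt (p t) = g t" using g0 by simp
      moreover have "coefA 1 t * F t = f t"
        using c elim by (simp add: F_def nearb power2_eq_square)
      ultimately show ?case using elim by simp
    qed
    ultimately have "((\<lambda>t. coefA 1 t * F t / sqrt (p t)) \<longlongrightarrow> f1 / g1) (at_right 0)"
      by (rule Lim_transform_eventually)
    moreover have "f1 / g1 \<le> 1" using fg by simp
    ultimately show ?thesis by (rule vanishing_of_dominant_slope[OF F_lim _ _ t])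
  qed
  obtain x1 where x1: "\<And>t. t > 0 \<Longrightarrow> b t = x1 * (coefA 1 t)\<^sup>2"
    using abelian_solution P0 by blast
  show thesis
  proof (rule that[of x1])
    fix t assume t: "0 < t" "t < \<epsilon>"
    show "f t = x1 * coefA 1 t"
      using x1[OF t(1)] coef_pos[OF t(1), of 1] by (simp add: nearb[OF t] power2_eq_square)
    show "g t = 0"
      using P0[OF t(1)] coef_pos(1)[OF t(1), of 2] by (simp add: nearb[OF t])
  qed
qed

section \<open>Global extension of abelian instantons\<close>

definition abelian_coeff :: "real \<Rightarrow> 3 \<Rightarrow> real \<Rightarrow> real ^ 3"
  where "abelian_coeff x1 i t = (if i = 1 then (x1 * (coefA 1 t)\<^sup>2) *\<^sub>R Tgen 1 else 0)"

lemma abelian_instanton_eq: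
  assumes "x \<in> M" "fst x \<noteq> 0"
  shows "abelian_instanton x1 x v = ((coefA 1 (norm (fst x)))\<^sup>2 * x1 * etap x v $ 1) *\<^sub>R Tgen 1"
  using assms by (simp add: abelian_instanton_def Let_def eta_eq coef_sq radius_def)

lemma invariant_form_abelian_coeff:
  "invariant_form (\<lambda>t. 0) (abelian_coeff x1) (\<lambda>i t. 0) x v =
    ((coefA 1 (norm (fst x)))\<^sup>2 * x1 * etap x v $ 1) *\<^sub>R Tgen 1"
  by (simp add: invariant_form_def abelian_coeff_def sum_3 mult_ac)

lemma abelian_connection_eq:
  assumes "connection_eq_on {x \<in> M. fst x \<noteq> 0} A (abelian_instanton x1)"
  shows "connection_eq_on {x \<in> M. fst x \<noteq> 0} A (invariant_form (\<lambda>t. 0) (abelian_coeff x1) (\<lambda>i t. 0))"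
  using assms by (simp add: connection_eq_on_def abelian_instanton_eq invariant_form_abelian_coeff del: split_paired_All)

text \<open>The logarithmic derivative of the square of \<open>coefA 1\<close>, by
  \<open>has_real_derivative_coefA_1_sq\<close>.\<close>

definition log_deriv :: "real \<Rightarrow> real"
  where "log_deriv t = coefA 1 t / (coefA 2 t)\<^sup>2 - coefA 1 t / (coefB 2 t)\<^sup>2"

text \<open>All values are multiples of \<open>Tgen 1\<close>, so the bracket drops out and the
  curvature is the exterior derivative of \<open>h\<close> times the first eta_plus form.\<close>

lemma curvature_abelian:
  assumes A: "connection_eq_on {x \<in> M. fst x \<noteq> 0} A (abelian_instanton x1)"
    and x: "x \<in> M" "fst x \<noteq> 0" and vw: "v \<in> tangent x" "w \<in> tangent x"
  defines "h \<equiv> x1 * (coefA 1 (norm (fst x)))\<^sup>2"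
  shows "curvature A x [v, w] =
    (h * log_deriv (norm (fst x)) * (dnorm x v * etap x w $ 1 - dnorm x w * etap x v $ 1)
      - 2 * h * ((etap x v $ 2 * etap x w $ 3 - etap x v $ 3 * etap x w $ 2)
        + (etam x v $ 2 * etam x w $ 3 - etam x v $ 3 * etam x w $ 2))) *\<^sub>R Tgen 1"
proof -
  let ?t = "norm (fst x)"
  have t: "?t > 0" using x by simp
  define P' where "P' i = (if i = 1 then (h * log_deriv ?t) *\<^sub>R Tgen 1 else 0)" for i :: 3
  have P': "(abelian_coeff x1 i has_vector_derivative P' i) (at ?t)" for i
  proof (cases "i = 1")
    case True
    have "((\<lambda>t. x1 * (coefA 1 t)\<^sup>2) has_vector_derivative h * log_deriv ?t) (at ?t)"
      using DERIV_cmult[OF has_real_derivative_coefA_1_sq[OF t], of x1]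
      by (simp add: has_real_derivative_iff_has_vector_derivative h_def log_deriv_def mult.assoc)
    from bounded_linear.has_vector_derivative[OF bounded_linear_scaleR_left this]
    show ?thesis by (simp add: True P'_def abelian_coeff_def[abs_def])
  next
    case False
    then show ?thesis by (simp add: P'_def abelian_coeff_def[abs_def])
  qed
  have br: "su2_bracket (a *\<^sub>R Tgen 1) (c *\<^sub>R Tgen 1) = 0" for a c
    by (simp add: su2_bracket_def cross_mult_left cross_mult_right cross_refl)
  have cr: "cross3 u u' $ 1 = u $ 2 * u' $ 3 - u $ 3 * u' $ 2" for u u' :: "real ^ 3"
    by (simp add: cross3_def)
  show ?thesis
    unfolding curvature_invariant_form[OF abelian_connection_eq[OF A] x vw has_vector_derivative_const P'
        has_vector_derivative_const]
    by (simp add: invariant_form_abelian_coeff sum_3 P'_def abelian_coeff_def h_def br cr algebra_simps)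
qed

lemma abelian_instanton_equation:
  assumes A: "connection_eq_on {x \<in> M. fst x \<noteq> 0} A (abelian_instanton x1)"
    and x: "x \<in> M" "fst x \<noteq> 0" and vs: "length vs = 6" "set vs \<subseteq> tangent x"
  shows "wedge 2 (curvature A x) (psi x) vs = 0"
  unfolding psi_eq_coassociative_form
proof (rule abelian_wedge_coassociative_form[OF vs(1)])
  let ?t = "norm (fst x)"
  let ?h = "x1 * (coefA 1 ?t)\<^sup>2"
  have t: "?t > 0" using x by simp
  fix us :: "point list" assume us: "length us = 2" "set us \<subseteq> set vs"
  then obtain v w where vw: "us = [v, w]" by (auto simp: length_Suc_conv numeral_2_eq_2)
  have w: "wedge 1 (one_form \<alpha>) (one_form \<beta>) [v, w] = \<alpha> v * \<beta> w - \<alpha> w * \<beta> v" for \<alpha> \<beta> :: "point \<Rightarrow> real"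
    by (simp add: wedge_1_Cons wedge_1_2_Nil one_form_def mult.commute del: One_nat_def)
  have "v \<in> tangent x" "w \<in> tangent x" using us vs by (auto simp: vw)
  from curvature_abelian[OF A x this]
  show "curvature A x us = (?h * log_deriv ?t * wedge 1 (one_form (dt x)) (one_form (eta_plus 1 x)) us
      - 2 * ?h * (wedge 1 (one_form (eta_plus 2 x)) (one_form (eta_plus 3 x)) us
        + wedge 1 (one_form (eta_minus 2 x)) (one_form (eta_minus 3 x)) us)) *\<^sub>R Tgen 1"
    unfolding vw w dt_eq[OF x(2)] eta_eq[OF x] by (simp add: mult.commute)
next
  let ?t = "norm (fst x)"
  have t: "?t > 0" using x by simp
  obtain A1 A2 B2 where c: "coefA 1 ?t = A1" "coefA 2 ?t = A2" "coefB 2 ?t = B2" by blast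
  have "A1 > 0" "A2 > 0" "B2 > 0" using c coef_pos[OF t] by metis+
  then show "x1 * (coefA 1 ?t)\<^sup>2 * log_deriv ?t *
      (coefA 2 (radius x) * coefB 2 (radius x) * coefA 3 (radius x) * coefB 3 (radius x)) =
    x1 * (coefA 1 ?t)\<^sup>2 * (coefA 1 (radius x) * coefB 2 (radius x) * coefB 3 (radius x)
      - coefA 1 (radius x) * coefA 2 (radius x) * coefA 3 (radius x))"
    unfolding radius_def coef_3 log_deriv_def c by (simp add: field_simps power2_eq_square)
qed

text \<open>Up to constant factors these ratios are the coefficients of the abelian curvature in the
  orthonormal coframe. They stay bounded at the singular orbit because the factor r - 9/4 cancels in
  the first and only the numerator of the second contains it.\<close>

lemma coef_ratio_le:
  assumes t: "0 < t"
  shows "(coefA 1 t)\<^sup>2 / (coefA 2 t)\<^sup>2 \<le> 2" "(coefA 1 t)\<^sup>2 / (coefB 2 t)\<^sup>2 \<le> 2"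
proof -
  obtain r x1 x2 x3 x4 where r: "bggg_r t = r" "9/4 < r"
    and x: "r - 9/4 = x1" "r + 9/4 = x2" "r - 3/4 = x3" "r + 3/4 = x4"
    and x0: "x1 > 0" "x2 > 0" "x3 > 0" "x4 > 0" and sq: "(coefA 1 t)\<^sup>2 = x1 * x2 / (x3 * x4)"
      "(coefA 2 t)\<^sup>2 = x1 * x4 / 3" "(coefB 2 t)\<^sup>2 = x3 * x2 / 3" "coefB 1 t = 2 * r / 3"
    by (rule coef_factors[OF t])
  have "3/2 * 3 \<le> x3 * x4" using r(2) x by (intro mult_mono) auto
  then have "9/2 * x4 \<le> x3 * x4 * x4" using x0 by (intro mult_right_mono) auto
  moreover have "3 * x2 \<le> 9 * x4" using r(2) by (simp flip: x)
  ultimately have "3 * x2 \<le> 2 * (x3 * x4 * x4)" by linarith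
  moreover have "(coefA 1 t)\<^sup>2 / (coefA 2 t)\<^sup>2 = 3 * x2 / (x3 * x4 * x4)"
    unfolding sq using x0 by (simp add: field_simps)
  ultimately show "(coefA 1 t)\<^sup>2 / (coefA 2 t)\<^sup>2 \<le> 2"
    using x0 by (simp add: pos_divide_le_eq)
  have "3/2 * (3/2) \<le> x3 * x3" using r(2) x by (intro mult_mono) auto
  then have "9/4 * x4 \<le> x3 * x3 * x4" using x0 by (intro mult_right_mono) auto
  moreover have "3 * x1 \<le> 9/2 * x4" using r(2) by (simp flip: x)
  ultimately have "3 * x1 \<le> 2 * (x3 * x3 * x4)" by linarith
  moreover have "(coefA 1 t)\<^sup>2 / (coefB 2 t)\<^sup>2 = 3 * x1 / (x3 * x3 * x4)"
    unfolding sq using x0 by (simp add: field_simps)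
  ultimately show "(coefA 1 t)\<^sup>2 / (coefB 2 t)\<^sup>2 \<le> 2"
    using x0 by (simp add: pos_divide_le_eq)
qed

lemma unit_vector_coframe_bounds:
  assumes x: "x \<in> M" "fst x \<noteq> 0" and u: "metric x e e = 1"
  shows "\<bar>dnorm x e\<bar> \<le> 1" "\<bar>2 * coefA i (norm (fst x)) * etap x e $ i\<bar> \<le> 1"
    "\<bar>2 * coefB i (norm (fst x)) * etam x e $ i\<bar> \<le> 1"
proof -
  let ?a = "\<lambda>i. 2 * coefA i (norm (fst x)) * etap x e $ i" and ?b = "\<lambda>i. 2 * coefB i (norm (fst x)) * etam x e $ i"
  have s: "(dnorm x e)\<^sup>2 + (\<Sum>i\<in>UNIV. (?a i)\<^sup>2 + (?b i)\<^sup>2) = 1"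
    using u unfolding metric_def dt_eq[OF x(2)] eta_eq[OF x] radius_def
    by (simp add: power2_eq_square mult_ac)
  have "(?a i)\<^sup>2 + (?b i)\<^sup>2 \<le> (\<Sum>i\<in>UNIV. (?a i)\<^sup>2 + (?b i)\<^sup>2)"
    by (rule member_le_sum) auto
  moreover have "0 \<le> (\<Sum>i\<in>UNIV. (?a i)\<^sup>2 + (?b i)\<^sup>2)" by (rule sum_nonneg) simp
  moreover have "0 \<le> (?a i)\<^sup>2" "0 \<le> (?b i)\<^sup>2" "0 \<le> (dnorm x e)\<^sup>2" by simp_all
  ultimately have "(dnorm x e)\<^sup>2 \<le> 1" "(?a i)\<^sup>2 \<le> 1" "(?b i)\<^sup>2 \<le> 1" using s by linarith+
  then show "\<bar>dnorm x e\<bar> \<le> 1" "\<bar>?a i\<bar> \<le> 1" "\<bar>?b i\<bar> \<le> 1"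
    by (simp_all only: abs_square_le_1)
qed

lemma bounded_curvature_abelian:
  assumes A: "connection_eq_on {x \<in> M. fst x \<noteq> 0} A (abelian_instanton x1)"
  shows "bounded_curvature A"
proof -
  have bound: "norm (curvature A x [v, w]) \<le> 8 * \<bar>x1\<bar>"
    if x: "x \<in> M" "fst x \<noteq> 0" and vw: "v \<in> tangent x" "w \<in> tangent x" and u: "metric x v v = 1" "metric x w w = 1"
    for x v w
  proof -
    let ?t = "norm (fst x)"
    have t: "?t > 0" using x by simp
    obtain A1 A2 B2 where c: "coefA 1 ?t = A1" "coefA 2 ?t = A2" "coefB 2 ?t = B2" by blast
    have c3: "coefA 3 ?t = A2" "coefB 3 ?t = B2" using c by (simp_all add: coef_3)
    have c0: "A1 > 0" "A2 > 0" "B2 > 0" using c coef_pos[OF t] by metis+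
    note bv = unit_vector_coframe_bounds[OF x u(1)] and bw = unit_vector_coframe_bounds[OF x u(2)]
    have prod1: "\<bar>a * b\<bar> \<le> 1" if "\<bar>a\<bar> \<le> 1" "\<bar>b\<bar> \<le> 1" for a b :: real
      using that by (simp add: abs_mult mult_le_one)
    define p1 where "p1 = dnorm x v * (2 * A1 * etap x w $ 1) - dnorm x w * (2 * A1 * etap x v $ 1)"
    define p2 where "p2 = (2 * A2 * etap x v $ 2) * (2 * A2 * etap x w $ 3) - (2 * A2 * etap x v $ 3) * (2 * A2 * etap x w $ 2)"
    define p3 where "p3 = (2 * B2 * etam x v $ 2) * (2 * B2 * etam x w $ 3) - (2 * B2 * etam x v $ 3) * (2 * B2 * etam x w $ 2)"
    have diff2: "\<bar>a - b\<bar> \<le> 2" if "\<bar>a\<bar> \<le> 1" "\<bar>b\<bar> \<le> 1" for a b :: real using that by linarith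
    have p1: "\<bar>p1\<bar> \<le> 2"
      unfolding p1_def by (rule diff2[OF prod1[OF bv(1) bw(2)[of 1, unfolded c]] prod1[OF bw(1) bv(2)[of 1, unfolded c]]])
    have p2: "\<bar>p2\<bar> \<le> 2"
      unfolding p2_def by (rule diff2[OF prod1[OF bv(2)[of 2, unfolded c] bw(2)[of 3, unfolded c3]]
            prod1[OF bv(2)[of 3, unfolded c3] bw(2)[of 2, unfolded c]]])
    have p3: "\<bar>p3\<bar> \<le> 2"
      unfolding p3_def by (rule diff2[OF prod1[OF bv(3)[of 2, unfolded c] bw(3)[of 3, unfolded c3]]
            prod1[OF bv(3)[of 3, unfolded c3] bw(3)[of 2, unfolded c]]])
    \<comment> \<open>In terms of the orthonormal coframe the powers of \<open>A1\<close>,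
      \<open>A2\<close>, \<open>B2\<close> combine into these two ratios; each of the three
      resulting terms is at most 2 in absolute value.\<close>
    define \<alpha> \<beta> where "\<alpha> = A1\<^sup>2 / A2\<^sup>2" and "\<beta> = A1\<^sup>2 / B2\<^sup>2"
    have \<alpha>: "0 \<le> \<alpha>" "\<alpha> \<le> 2" and \<beta>: "0 \<le> \<beta>" "\<beta> \<le> 2"
      using coef_ratio_le[OF t] by (simp_all add: \<alpha>_def \<beta>_def c)
    have "curvature A x [v, w] = (x1 * ((\<alpha> - \<beta>) / 2 * p1 - \<alpha> / 2 * p2 - \<beta> / 2 * p3)) *\<^sub>R Tgen 1"
      unfolding curvature_abelian[OF A x vw] c log_deriv_def \<alpha>_def \<beta>_def p1_def p2_def p3_def using c0
      by (intro arg_cong[of _ _ "\<lambda>c. c *\<^sub>R Tgen 1"]) (simp add: field_simps power2_eq_square)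
    then have "norm (curvature A x [v, w]) = \<bar>x1\<bar> * \<bar>(\<alpha> - \<beta>) / 2 * p1 - \<alpha> / 2 * p2 - \<beta> / 2 * p3\<bar>"
      by (simp add: Tgen_def abs_mult)
    also have "\<dots> \<le> \<bar>x1\<bar> * 8"
    proof (rule mult_left_mono)
      have "\<bar>(\<alpha> - \<beta>) / 2 * p1\<bar> \<le> 1 * 2" unfolding abs_mult using p1 \<alpha> \<beta> by (intro mult_mono) auto
      moreover have "\<bar>\<alpha> / 2 * p2\<bar> \<le> 1 * 2" unfolding abs_mult using p2 \<alpha> by (intro mult_mono) auto
      moreover have "\<bar>\<beta> / 2 * p3\<bar> \<le> 1 * 2" unfolding abs_mult using p3 \<beta> by (intro mult_mono) auto
      ultimately show "\<bar>(\<alpha> - \<beta>) / 2 * p1 - \<alpha> / 2 * p2 - \<beta> / 2 * p3\<bar> \<le> 8" by linarith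
    qed simp
    finally show ?thesis by simp
  qed
  define S where "S = {(i, j). i < j \<and> j < (7::nat)}"
  have "finite S" by (rule finite_subset[of _ "{..<7} \<times> {..<7}"]) (auto simp: S_def)
  have "sqrt (\<Sum>(i, j)\<in>S. (norm (curvature A x [es ! i, es ! j]))\<^sup>2) \<le> sqrt (real (card S) * (8 * \<bar>x1\<bar>)\<^sup>2)"
    if x: "x \<in> M" "fst x \<noteq> 0" and es: "orthonormal_frame x es" for x es
  proof (intro real_sqrt_le_mono sum_bounded_above[THEN order_trans])
    fix p assume "p \<in> S"
    then obtain i j where p: "p = (i, j)" "i < j" "j < 7" by (auto simp: S_def)
    have "es ! i \<in> set es" "es ! j \<in> set es" using es p by (simp_all add: orthonormal_frame_def)
    then have "es ! i \<in> tangent x" "es ! j \<in> tangent x" "metric x (es ! i) (es ! i) = 1" "metric x (es ! j) (es ! j) = 1"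
      using es p unfolding orthonormal_frame_def by auto
    then show "(case p of (i, j) \<Rightarrow> (norm (curvature A x [es ! i, es ! j]))\<^sup>2) \<le> (8 * \<bar>x1\<bar>)\<^sup>2"
      unfolding p(1) prod.case by (intro power_mono bound[OF x] norm_ge_zero)
  qed simp
  then show ?thesis unfolding bounded_curvature_def S_def[symmetric] by blast
qed

lemma tube_subset: "tube \<epsilon> \<subseteq> M"
  by (auto simp: tube_def)

lemma act_M: "norm a1 = 1 \<Longrightarrow> norm a2 = 1 \<Longrightarrow> x \<in> M \<Longrightarrow> act a1 a2 x \<in> M"
  by (simp add: M_def SU2_def act_def)

lemma extends_abelian:
  assumes \<epsilon>: "\<epsilon> > 0" and G2: "G2_instanton_on (tube \<epsilon>) A" and inv: "invariant_on (tube \<epsilon>) A"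
    and ab: "connection_eq_on {x \<in> tube \<epsilon>. fst x \<noteq> 0} A (abelian_instanton x1)"
  shows "extends_globally_with_bounded_curvature \<epsilon> A"
proof -
  define A' :: connection where "A' x v = (if x \<in> tube \<epsilon> then A x v else abelian_instanton x1 x v)" for x v
  have off: "fst x \<noteq> 0" if "x \<in> M" "x \<notin> tube \<epsilon>" for x
    using that \<epsilon> by (auto simp: tube_def)
  have A': "connection_eq_on {x \<in> M. fst x \<noteq> 0} A' (abelian_instanton x1)"
    using ab unfolding connection_eq_on_def A'_def by simp
  note A'_form = abelian_connection_eq[OF A']
  have pull_tube: "pullback retract_M A' y v = pullback retract_M A y v" if "retract_M y \<in> tube \<epsilon>" for y v
    using that by (simp add: pullback_def A'_def)
  have pull_reg: "pullback retract_M A' y v = ((coefA 1 (norm (fst y)))\<^sup>2 * x1 * etap y v $ 1) *\<^sub>R Tgen 1"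
    if "y \<in> regular" for y v
    using pullback_retract_invariant_form[OF A'_form, of y v] that
    by (simp add: regular_def invariant_form_abelian_coeff)
  have smooth_A: "smooth_connection_on (tube \<epsilon>) A" using G2 by (simp add: G2_instanton_on_def)
  define V where "V = {y::point. snd y \<noteq> 0 \<and> retract_M y \<in> tube \<epsilon>}"
  have V_eq: "V = {y. snd y \<noteq> 0 \<and> norm (fst y) < \<epsilon>}"
    using retract_M_in_M by (auto simp: V_def tube_def retract_M_def)
  have V_open: "open V"
    unfolding V_eq by (intro open_Collect_conj open_Collect_neq open_Collect_less continuous_intros)
  \<comment> \<open>Smoothness is local, and this open cover separates its two sources: on
    \<open>V\<close> it is inherited from \<open>A\<close>, on \<open>regular\<close> it follows
    from the explicit formula. By \<open>ab\<close> that formula holds also where the two sets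
    overlap.\<close>
  have cover: "{y. snd y \<noteq> 0 \<and> retract_M y \<in> M} = V \<union> regular"
    using \<epsilon> retract_M_in_M by (auto simp: V_eq regular_def)
  have smooth: "smooth_connection_on M A'"
    unfolding smooth_connection_on_def Let_def cover
  proof (intro conjI ballI allI)
    fix y assume y: "y \<in> V \<union> regular"
    show "linear (pullback retract_M A' y)"
    proof (cases "y \<in> V")
      case True
      then have "pullback retract_M A' y = pullback retract_M A y"
        by (intro ext pull_tube) (simp add: V_def)
      moreover have "linear (pullback retract_M A y)"
        using smooth_A True unfolding smooth_connection_on_def Let_def V_def by blast
      ultimately show ?thesis by simp
    next
      case False
      then have "y \<in> regular" using y by simp
      then show ?thesis
        by (intro linearI) (simp_all add: pull_reg linear_add[OF linear_eta(1)] linear_scale[OF linear_eta(1)] algebra_simps)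
    qed
  next
    fix v
    show "smooth_on (\<lambda>y. pullback retract_M A' y v) (V \<union> regular)"
      unfolding smooth_on_def
    proof
      fix k
      have "Ck_on k (\<lambda>y. pullback retract_M A y v) V"
        using smooth_A unfolding smooth_connection_on_def smooth_on_def Let_def V_def by blast
      then have "Ck_on k (\<lambda>y. pullback retract_M A' y v) V"
        by (rule Ck_on_cong[THEN iffD1, rotated 2, OF _ V_open]) (simp add: pull_tube V_def)
      moreover have "Ck_on k (\<lambda>y. pullback retract_M A' y v) regular"
      proof -
        let ?r = "\<lambda>y::point. bggg_r (norm (fst y))"
        have gt: "9/4 < ?r y" if "y \<in> regular" for y
          using that bggg_r_gt by (auto simp: regular_def)
        have c: "Ck_on k (\<lambda>y. ?r y + c) regular" for c
          by (intro Ck_on_add[OF open_regular] Ck_on_bggg_r Ck_on_const)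
        have q: "Ck_on k (\<lambda>y. ((?r y + -3/4) * (?r y + 3/4)) powr (-1)) regular"
          using gt by (intro Ck_on_powr[OF open_regular] Ck_on_mult[OF open_regular] c) (auto intro!: mult_pos_pos dest!: gt)
        have "Ck_on k (\<lambda>y. (((?r y + -9/4) * (?r y + 9/4)) * ((?r y + -3/4) * (?r y + 3/4)) powr (-1)
            * x1 * etap y v $ 1) *\<^sub>R Tgen 1) regular"
          by (rule Ck_on_scaleR[OF open_regular Ck_on_mult[OF open_regular Ck_on_mult[OF open_regular
                  Ck_on_mult[OF open_regular Ck_on_mult[OF open_regular c c] q] Ck_on_const]
                Ck_on_linear_compose[OF open_regular bounded_linear_vec_nth Ck_on_etap]] Ck_on_const])
        then show ?thesis
        proof (rule Ck_on_cong[THEN iffD1, rotated 2, OF _ open_regular])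
          fix y :: point assume y: "y \<in> regular"
          then have "norm (fst y) > 0" by (simp add: regular_def)
          then have "(coefA 1 (norm (fst y)))\<^sup>2 =
              ((?r y + -9/4) * (?r y + 9/4)) * ((?r y + -3/4) * (?r y + 3/4)) powr (-1)"
            using gt[OF y] by (simp add: coef_sq powr_minus_divide)
          then show "(((?r y + -9/4) * (?r y + 9/4)) * ((?r y + -3/4) * (?r y + 3/4)) powr (-1)
            * x1 * etap y v $ 1) *\<^sub>R Tgen 1 = pullback retract_M A' y v"
            by (simp only: pull_reg[OF y])
        qed
      qed
      ultimately show "Ck_on k (\<lambda>y. pullback retract_M A' y v) (V \<union> regular)"
        by (rule Ck_on_Un[OF V_open open_regular])
    qed
  qed
  have inv': "invariant_on M A'"
    unfolding invariant_on_def connection_eq_on_def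
  proof (intro conjI ballI allI)
    fix a1 a2 x v assume a: "a1 \<in> SU2" "a2 \<in> SU2" and x: "x \<in> M" and v: "v \<in> tangent x"
    have n: "norm a1 = 1" "norm a2 = 1" using a by (simp_all add: SU2_def)
    have mem: "act a1 a2 x \<in> M" using act_M[OF n x] .
    have tube_iff: "act a1 a2 x \<in> tube \<epsilon> \<longleftrightarrow> x \<in> tube \<epsilon>"
      using mem x by (simp add: tube_def act_radius[OF n(1)])
    show "pullback (act a1 a2) A' x v = A' x v"
    proof (cases "x \<in> tube \<epsilon>")
      case True
      have "pullback (act a1 a2) A x v = A x v"
        using inv a True v unfolding invariant_on_def connection_eq_on_def by blast
      then show ?thesis using True tube_iff by (simp add: pullback_linear[OF linear_act] A'_def)
    next
      case False
      have "norm (fst (act a1 a2 x)) \<noteq> 0" using off[OF x False] act_radius[OF n(1)] by simp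
      then have "fst (act a1 a2 x) \<noteq> 0" by (metis norm_zero)
      then show ?thesis
        using False tube_iff off[OF x False] mem x
        by (simp add: pullback_linear[OF linear_act] A'_def abelian_instanton_eq act_radius[OF n(1)] coframe_act[OF n])
    qed
  next
    fix \<theta> x v assume x: "x \<in> M" and v: "v \<in> tangent x"
    have nf: "norm (fst (act_u1 \<theta> x)) = norm (fst x)" by (simp add: act_u1_def)
    have mem: "act_u1 \<theta> x \<in> M" using x by (simp add: act_u1_def M_def)
    have tube_iff: "act_u1 \<theta> x \<in> tube \<epsilon> \<longleftrightarrow> x \<in> tube \<epsilon>"
      using mem x by (simp add: tube_def nf)
    show "pullback (act_u1 \<theta>) A' x v = Ad (qcnj (u1 \<theta>)) (A' x v)"
    proof (cases "x \<in> tube \<epsilon>")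
      case True
      have "pullback (act_u1 \<theta>) A x v = Ad (qcnj (u1 \<theta>)) (A x v)"
        using inv True v unfolding invariant_on_def connection_eq_on_def by blast
      then show ?thesis using True tube_iff by (simp add: pullback_linear[OF linear_act_u1] A'_def)
    next
      case False
      have "norm (fst (act_u1 \<theta> x)) \<noteq> 0" using off[OF x False] nf by simp
      then have f: "fst (act_u1 \<theta> x) \<noteq> 0" by (metis norm_zero)
      have T: "Ad (qcnj (u1 \<theta>)) (Tgen 1) = Tgen 1"
        by (simp add: Ad_u1 Tgen_def vec_eq_iff forall_3 axis_def)
      have Ad_1: "Ad (qcnj (u1 \<theta>)) w $ 1 = w $ 1" for w
        by (simp add: Ad_u1)
      show ?thesis
        using False tube_iff off[OF x False] mem x f
        by (simp add: pullback_linear[OF linear_act_u1] A'_def abelian_instanton_eq nf coframe_act_u1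
            linear_scale[OF linear_Ad] T Ad_1)
    qed
  qed
  have "G2_instanton_on M A'"
    unfolding G2_instanton_on_def using smooth abelian_instanton_equation[OF A'] by blast
  moreover have "connection_eq_on (tube \<epsilon>) A' A"
    by (simp add: connection_eq_on_def A'_def)
  ultimately show ?thesis
    unfolding extends_globally_with_bounded_curvature_def
    using inv' bounded_curvature_abelian[OF A'] by blast
qed

text \<open>The abelian formula says nothing on the singular orbit itself. There the values are
  limits along (s, q) as s tends to 0, and the span is closed. Tangency constrains only the second
  component, so one vector \<open>v\<close> is tangent along the whole approach.\<close>

lemma gauge_group_U1_of_abelian:
  assumes \<epsilon>: "\<epsilon> > 0" and smooth: "smooth_connection_on (tube \<epsilon>) A"
    and ab: "connection_eq_on {x \<in> tube \<epsilon>. fst x \<noteq> 0} A (abelian_instanton x1)"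
  shows "has_gauge_group_U1_on (tube \<epsilon>) A"
  unfolding has_gauge_group_U1_on_def
proof (intro exI conjI ballI)
  show "Tgen 1 \<noteq> 0" by (simp add: Tgen_def)
  fix x v assume x: "x \<in> tube \<epsilon>" and v: "v \<in> tangent x"
  have off: "A y w \<in> span {Tgen 1}" if "y \<in> tube \<epsilon>" "fst y \<noteq> 0" "w \<in> tangent y" for y w
  proof -
    have "A y w = abelian_instanton x1 y w" using ab that unfolding connection_eq_on_def by blast
    then show ?thesis by (simp add: abelian_instanton_def Let_def span_breakdown_eq span_base span_scale)
  qed
  show "A x v \<in> span {Tgen 1}"
  proof (cases "fst x = 0")
    case False
    then show ?thesis using off x v by blast
  next
    case True
    define \<gamma> where "\<gamma> s = (((s, 0), snd x) :: point)" for s :: real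
    have xM: "x \<in> M" using x tube_subset by blast
    then have sx: "snd x \<noteq> 0" by (auto simp: M_def SU2_def)
    have \<gamma>0: "\<gamma> 0 = x" using True by (simp add: \<gamma>_def prod_eq_iff)
    have V: "x \<in> {y. snd y \<noteq> 0 \<and> retract_M y \<in> tube \<epsilon>}"
      using x sx retract_M_M[OF xM] by simp
    have "smooth_on (\<lambda>y. pullback retract_M A y v) {y. snd y \<noteq> 0 \<and> retract_M y \<in> tube \<epsilon>}"
      using smooth unfolding smooth_connection_on_def Let_def by blast
    then have "(\<lambda>y. pullback retract_M A y v) differentiable (at x)"
      using V by (rule smooth_on_differentiable)
    then have "isCont (\<lambda>y. pullback retract_M A y v) (\<gamma> 0)"
      unfolding \<gamma>0 by (rule differentiable_imp_continuous_within)
    moreover have "(\<gamma> \<longlongrightarrow> \<gamma> 0) (at_right 0)"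
      unfolding \<gamma>_def by (intro tendsto_intros)
    ultimately have lim: "((\<lambda>s. pullback retract_M A (\<gamma> s) v) \<longlongrightarrow> pullback retract_M A x v) (at_right 0)"
      using isCont_tendsto_compose[of "\<gamma> 0" "\<lambda>y. pullback retract_M A y v" \<gamma>] by (simp add: \<gamma>0)
    have ev: "eventually (\<lambda>s. pullback retract_M A (\<gamma> s) v \<in> span {Tgen 1}) (at_right 0)"
      unfolding eventually_at_right_field
    proof (intro exI conjI allI impI)
      show "0 < \<epsilon>" by (rule \<epsilon>)
      fix s :: real assume s: "0 < s" "s < \<epsilon>"
      have mem: "\<gamma> s \<in> M" using xM by (simp add: \<gamma>_def M_def)
      have "\<gamma> s \<in> tube \<epsilon>" using mem s by (simp add: tube_def \<gamma>_def norm_prod_def)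
      moreover have "fst (\<gamma> s) \<noteq> 0" using s by (simp add: \<gamma>_def prod_eq_iff)
      moreover have tan: "v \<in> tangent (\<gamma> s)" using v by (simp add: tangent_def \<gamma>_def)
      ultimately show "pullback retract_M A (\<gamma> s) v \<in> span {Tgen 1}"
        unfolding pullback_retract_M[OF mem tan] by (rule off)
    qed
    have "pullback retract_M A x v \<in> span {Tgen 1}"
      by (rule Lim_in_closed_set[OF closed_span ev _ lim]) simp
    then show ?thesis by (simp add: pullback_retract_M[OF xM v])
  qed
qed

theorem theorem8:
  fixes A :: connection and f g :: "real \<Rightarrow> real" and f1 g1 \<epsilon> :: real
  assumes "\<epsilon> > 0"
    and "G2_instanton_on (tube \<epsilon>) A"
    and "invariant_on (tube \<epsilon>) A"
    and "connection_eq_on {x \<in> tube \<epsilon>. fst x \<noteq> 0} A (invariant_ansatz f g)"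
    and "(\<lambda>t. f t - f1 * t) \<in> O[at_right 0](\<lambda>t. t ^ 3)"
    and "(\<lambda>t. g t - g1 * t) \<in> O[at_right 0](\<lambda>t. t ^ 3)"
    and "f1 \<le> 1 / 2 \<or> (g1 \<ge> 0 \<and> g1 \<ge> f1)"
  shows "extends_globally_with_bounded_curvature \<epsilon> A \<longleftrightarrow>
    has_gauge_group_U1_on (tube \<epsilon>) A \<and>
    (\<exists>x1. connection_eq_on {x \<in> tube \<epsilon>. fst x \<noteq> 0} A (abelian_instanton x1))"
proof
  assume "extends_globally_with_bounded_curvature \<epsilon> A"
  then obtain A' where A': "G2_instanton_on M A'" "invariant_on M A'" "connection_eq_on (tube \<epsilon>) A' A"
    unfolding extends_globally_with_bounded_curvature_def by blast
  have "connection_eq_on {x \<in> tube \<epsilon>. fst x \<noteq> 0} A' (invariant_ansatz f g)"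
    using A'(3) assms(4) by (simp add: connection_eq_on_def del: split_paired_All)
  then obtain x1 where x1: "\<And>t. 0 < t \<Longrightarrow> t < \<epsilon> \<Longrightarrow> f t = x1 * coefA 1 t" "\<And>t. 0 < t \<Longrightarrow> t < \<epsilon> \<Longrightarrow> g t = 0"
    using global_instanton_abelian[OF A'(1,2) assms(1) _ assms(5-7)] by blast
  have "connection_eq_on {x \<in> tube \<epsilon>. fst x \<noteq> 0} A (abelian_instanton x1)"
    unfolding connection_eq_on_def
  proof (intro ballI)
    fix x v assume x: "x \<in> {x \<in> tube \<epsilon>. fst x \<noteq> 0}" and v: "v \<in> tangent x"
    have t: "0 < radius x" "radius x < \<epsilon>" and xM: "x \<in> M" "fst x \<noteq> 0"
      using x by (auto simp: tube_def radius_def)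
    have "A x v = invariant_ansatz f g x v"
      using assms(4) x v unfolding connection_eq_on_def by blast
    also have "\<dots> = abelian_instanton x1 x v"
      using x1[OF t] by (simp add: abelian_instanton_eq[OF xM] invariant_ansatz_def Let_def eta_eq[OF xM]
          radius_def power2_eq_square mult_ac)
    finally show "A x v = abelian_instanton x1 x v" .
  qed
  then show "has_gauge_group_U1_on (tube \<epsilon>) A \<and>
      (\<exists>x1. connection_eq_on {x \<in> tube \<epsilon>. fst x \<noteq> 0} A (abelian_instanton x1))"
    using gauge_group_U1_of_abelian[OF assms(1)] assms(2) unfolding G2_instanton_on_def by blast
next
  assume "has_gauge_group_U1_on (tube \<epsilon>) A \<and>
    (\<exists>x1. connection_eq_on {x \<in> tube \<epsilon>. fst x \<noteq> 0} A (abelian_instanton x1))"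
  then show "extends_globally_with_bounded_curvature \<epsilon> A"
    using extends_abelian[OF assms(1-3)] by blast
qed

end
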